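(* Let $E\to M$ be a vector bundle and let $$\mathcal J=\begin{pmatrix}N&\pi^\sharp\\ \sigma_\natural&-N^\star\end{pmatrix}$$ be a generalized almost complex structure on the omni-Lie algebroid $\mathfrak{ol}(E)=\mathfrak{D}E\oplus\mathfrak{J}E$, where $N:\mathfrak{D}E\to\mathfrak{D}E$ is a bundle map with $N^\star(\mathfrak{J}E)\subset\mathfrak{J}E$, $\pi\in\Gamma(\mathrm{Hom}(\wedge^2\mathfrak{J}E,E)_{\mathfrak{D}E})$ and $\sigma\in\Gamma(\mathrm{Hom}(\wedge^2\mathfrak{D}E,E)_{\mathfrak{J}E})$ satisfy $\pi^\sharp\circ\sigma_\natural+N^2=-\mathrm{id}$, $N\circ\pi^\sharp=\pi^\sharp\circ N^\star$, $\sigma_\natural\circ N=N^\star\circ\sigma_\natural$. Then $\mathcal J$ is a generalized complex structure on $\mathfrak{ol}(E)$ if and only if the following four conditions hold: (i) $\pi^\sharp([\mu,\nu]_\pi)=[\pi^\sharp(\mu),\pi^\sharp(\nu)]_{\mathfrak D}$ for all $\mu,\nu\in\Gamma(\mathfrak{J}E)$, where $$[\mu,\nu]_\pi:=\mathfrak{L}_{\pi^\sharp(\mu)}\nu-\mathfrak{L}_{\pi^\sharp(\nu)}\mu-\mathsf d\langle\pi^\sharp(\mu),\nu\rangle_E.$$ (ii) $N^\star([\mu,\nu]_\pi)=\mathfrak{L}_{\pi^\sharp(\mu)}(N^\star(\nu))-\mathfrak{L}_{\pi^\sharp(\nu)}(N^\star(\mu))-\mathsf d\,\pi(N^\star(\mu),\nu)$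 for all $\mu,\nu\in\Gamma(\mathfrak{J}E)$. (iii) $T(N)(\mathfrak d,\mathfrak t)=\pi^\sharp(i_{\mathfrak d\wedge\mathfrak t}\mathsf d\sigma)$ for all $\mathfrak d,\mathfrak t\in\Gamma(\mathfrak{D}E)$, where $T(N)$ is the Nijenhuis tensor $$T(N)(\mathfrak d,\mathfrak t)=[N(\mathfrak d),N(\mathfrak t)]_{\mathfrak D}-N\big([N(\mathfrak d),\mathfrak t]_{\mathfrak D}+[\mathfrak d,N(\mathfrak t)]_{\mathfrak D}-N[\mathfrak d,\mathfrak t]_{\mathfrak D}\big).$$ (iv) For all $\mathfrak d,\mathfrak t,\mathfrak k\in\Gamma(\mathfrak{D}E)$, $$\mathsf d\sigma(N(\mathfrak d),\mathfrak t,\mathfrak k)+\mathsf d\sigma(\mathfrak d,N(\mathfrak t),\mathfrak k)+\mathsf d\sigma(\mathfrak d,\mathfrak t,N(\mathfrak k))=\mathsf d\sigma_N(\mathfrak d,\mathfrak t,\mathfrak k),$$ where $\sigma_N\in\Gamma(\mathrm{Hom}(\wedge^2\mathfrak{D}E,E)_{\mathfrak{J}E})$ is $\sigma_N(\mathfrak d,\mathfrak t)=\sigma(N(\mathfrak d),\mathfrak t)$.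
   Context: All objects are smooth. $\mathfrak{D}E$ is the gauge Lie algebroid of $E$: its sections are the $\mathbb{R}$-linear maps $\mathfrak d:\Gamma(E)\to\Gamma(E)$ with $\mathfrak d(fu)=f\mathfrak d(u)+\mathrm{j}(\mathfrak d)(f)u$ for a vector field $\mathrm{j}(\mathfrak d)$ on $M$; its bracket $[\cdot,\cdot]_{\mathfrak D}$ is the commutator and its anchor is $\mathrm{j}$. $\mathfrak{J}E$ is the first jet bundle of $E$. There is a nondegenerate $E$-valued pairing $\langle\mu,\mathfrak d\rangle_E=\langle\mathfrak d,\mu\rangle_E=\mathfrak d(u)(m)$ for $\mu=[u]_m\in(\mathfrak{J}E)_m$, $\mathfrak d\in(\mathfrak{D}E)_m$; through it $\mathfrak{J}E\subset\mathrm{Hom}(\mathfrak{D}E,E)$ and $\mathfrak{D}E\subset\mathrm{Hom}(\mathfrak{J}E,E)$. The operator $\mathsf d:\Gamma(E)\to\Gamma(\mathfrak{J}E)$ is $(\mathsf d u)(\mathfrak d)=\mathfrak d(u)$; more generally $\mathsf d$ denotes the coboundary operator on $\Gamma(\mathrm{Hom}(\wedge^\bullet\mathfrak{D}E,E))$ of the Lie algebroid $\mathfrak{D}E$ with its tautological representation on $E$. For $\mathfrak d\in\Gamma(\mathfrak{D}E)$ the Lie derivative $\mathfrak{L}_{\mathfrak d}$ on $\Gamma(\mathfrak{J}E)$ is $\langle\mathfrak{L}_{\mathfrak d}\mu,\mathfrak d'\rangle_E=\mathfrak d\langle\mu,\mathfrak d'\rangle_E-\langle\mu,[\mathfrak d,\mathfrak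 d']_{\mathfrak D}\rangle_E$. The omni-Lie algebroid $\mathfrak{ol}(E)=\mathfrak{D}E\oplus\mathfrak{J}E$ carries the pairing $(\mathfrak d+\mu,\mathfrak t+\nu)_E=\tfrac12(\langle\mu,\mathfrak t\rangle_E+\langle\nu,\mathfrak d\rangle_E)$ and the bracket $[\![\mathfrak d+\mu,\mathfrak r+\nu]\!]=[\mathfrak d,\mathfrak r]_{\mathfrak D}+\mathfrak{L}_{\mathfrak d}\nu-\mathfrak{L}_{\mathfrak r}\mu+\mathsf d(\mu(\mathfrak r))$. A generalized almost complex structure on $\mathfrak{ol}(E)$ is a bundle map $\mathcal J:\mathfrak{ol}(E)\to\mathfrak{ol}(E)$ with $\mathcal J^2=-\mathrm{id}$ and $(\mathcal J(e_1),\mathcal J(e_2))_E=(e_1,e_2)_E$; it is a generalized complex structure if moreover $[\![\mathcal J(e_1),\mathcal J(e_2)]\!]-[\![e_1,e_2]\!]-\mathcal J([\![\mathcal J(e_1),e_2]\!]+[\![e_1,\mathcal J(e_2)]\!])=0$ for all $e_1,e_2\in\Gamma(\mathfrak{ol}(E))$. For a bundle map $N:\mathfrak{D}E\to\mathfrak{D}E$, $N^\star:\mathrm{Hom}(\mathfrak{D}E,E)\to\mathrm{Hom}(\mathfrak{D}E,E)$ is $N^\star(\nu)(\mathfrak d)=\nu(N(\mathfrak d))$. $\mathrm{Hom}(\wedge^k\mathfrak{D}E,E)_{\mathfrak{J}E}$ ($k\ge2$) consists of those $\sigma\in\mathrm{Hom}(\wedge^k\mathfrak{D}E,E)$ for which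 $\sigma_\natural:\wedge^{k-1}\mathfrak{D}E\to\mathrm{Hom}(\mathfrak{D}E,E)$, $\sigma_\natural(\mathfrak d_1,\dots,\mathfrak d_{k-1})(\mathfrak d_k)=\sigma(\mathfrak d_1,\dots,\mathfrak d_k)$, has image in $\mathfrak{J}E$; these form a subcomplex for $\mathsf d$. Thus $i_{\mathfrak d\wedge\mathfrak t}\mathsf d\sigma=\mathsf d\sigma(\mathfrak d,\mathfrak t,\cdot)\in\Gamma(\mathfrak{J}E)$. $\mathrm{Hom}(\wedge^2\mathfrak{J}E,E)_{\mathfrak{D}E}$ consists of those $\pi\in\mathrm{Hom}(\wedge^2\mathfrak{J}E,E)$ for which $\pi^\sharp:\mathfrak{J}E\to\mathrm{Hom}(\mathfrak{J}E,E)$, $\pi^\sharp(\mu)(\nu)=\pi(\mu,\nu)$, has image in $\mathfrak{D}E$. The matrix means $\mathcal J(\mathfrak d+\mu)=\big(N(\mathfrak d)+\pi^\sharp(\mu)\big)+\big(\sigma_\natural(\mathfrak d)-N^\star(\mu)\big)$. *)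

theory Defs
  imports "HOL-Analysis.Analysis" "HOL-Library.Function_Algebras"
begin

text \<open>
  Sections of a vector bundle and linear maps are HOL functions with values in a vector space, so
  they are added and scaled pointwise.
\<close>

instantiation "fun" :: (type, real_vector) real_vector
begin

definition scaleR_fun :: "real \<Rightarrow> ('a \<Rightarrow> 'b) \<Rightarrow> 'a \<Rightarrow> 'b"
  where "scaleR_fun c f = (\<lambda>x. c *\<^sub>R f x)"

instance
  by standard (simp_all add: scaleR_fun_def fun_eq_iff scaleR_add_right scaleR_add_left)

end

lemma scaleR_fun_apply [simp]: "(c *\<^sub>R f) x = c *\<^sub>R f x"
  by (simp add: scaleR_fun_def)


section \<open>Smooth functions on open subsets of Euclidean space\<close>

text \<open>
  The model space of an \<open>n\<close>-dimensional manifold is the library's \<^term>\<open>Euclidean_space n\<close>, whose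
  points are the sequences \<open>x\<close> with \<open>x i = 0\<close> for \<open>i \<ge> n\<close>.  In this way the dimension is an
  arbitrary natural number, zero included.
\<close>

definition partial_deriv :: "nat \<Rightarrow> ((nat \<Rightarrow> real) \<Rightarrow> real) \<Rightarrow> (nat \<Rightarrow> real) \<Rightarrow> real"
  where "partial_deriv i f x = deriv (\<lambda>t. f (x(i := t))) (x i)"

primrec C_k_on :: "nat \<Rightarrow> nat \<Rightarrow> (nat \<Rightarrow> real) set \<Rightarrow> ((nat \<Rightarrow> real) \<Rightarrow> real) \<Rightarrow> bool"
  where
    "C_k_on n 0 V f \<longleftrightarrow> continuous_on V f"
  | "C_k_on n (Suc k) V f \<longleftrightarrow> continuous_on V f \<and>
       (\<forall>i<n. (\<forall>x\<in>V. (\<lambda>t. f (x(i := t))) differentiable (at (x i))) \<and>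
              C_k_on n k V (partial_deriv i f))"

definition smooth_on :: "nat \<Rightarrow> (nat \<Rightarrow> real) set \<Rightarrow> ((nat \<Rightarrow> real) \<Rightarrow> real) \<Rightarrow> bool"
  where "smooth_on n V f \<longleftrightarrow> (\<forall>k. C_k_on n k V f)"


section \<open>Smooth manifolds and smooth vector bundles\<close>

type_synonym 'm chart = "'m set \<times> ('m \<Rightarrow> nat \<Rightarrow> real)"

text \<open>
  The base \<open>M\<close> is the type \<open>'m\<close>.  The fibre over \<open>m\<close> is a linear subspace \<open>fib m\<close> of an ambient real
  vector space \<open>'v\<close>.  The ambient space carries no topology and serves only to have the fibrewise
  operations at hand: every vector bundle is of this form up to isomorphism (embed all fibres in
  their direct sum).  The smooth structure is given by local frames \<open>(W, e)\<close>, where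
  \<open>e 0, \<dots>, e (rnk - 1)\<close> are sections over the open set \<open>W\<close> that form a basis of each fibre; this is
  the same thing as a local trivialization over \<open>W\<close>.
\<close>

record ('m, 'v) vbundle =
  mdim :: nat
  charts :: "'m chart set"
  rnk :: nat
  fib :: "'m \<Rightarrow> 'v set"
  frames :: "('m set \<times> (nat \<Rightarrow> 'm \<Rightarrow> 'v)) set"

definition smooth_atlas ::
    "nat \<Rightarrow> ('m::{t2_space, second_countable_topology}) chart set \<Rightarrow> bool"
  where "smooth_atlas n A \<longleftrightarrow>
    (\<Union>(U, \<phi>)\<in>A. U) = UNIV \<and>
    (\<forall>(U, \<phi>)\<in>A. open U \<and> openin (Euclidean_space n) (\<phi> ` U) \<and>
       homeomorphism U (\<phi> ` U) \<phi> (inv_into U \<phi>)) \<and>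
    (\<forall>(U, \<phi>)\<in>A. \<forall>(U', \<phi>')\<in>A. \<forall>i<n.
       smooth_on n (\<phi> ` (U \<inter> U')) (\<lambda>x. \<phi>' (inv_into U \<phi> x) i))"

definition smooth_fun :: "('m, 'v) vbundle \<Rightarrow> 'm set \<Rightarrow> ('m \<Rightarrow> real) \<Rightarrow> bool"
  where "smooth_fun E W f \<longleftrightarrow>
    (\<forall>(U, \<phi>)\<in>charts E. smooth_on (mdim E) (\<phi> ` (U \<inter> W)) (\<lambda>x. f (inv_into U \<phi> x)))"

definition C_infinity :: "('m, 'v) vbundle \<Rightarrow> ('m \<Rightarrow> real) set"
  where "C_infinity E = {f. smooth_fun E UNIV f}"

text \<open>The \<open>a\<close>-th component of \<open>u\<close> in the frame \<open>e\<close>.\<close>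

definition frame_comp ::
    "('m, 'v::real_vector) vbundle \<Rightarrow> (nat \<Rightarrow> 'm \<Rightarrow> 'v) \<Rightarrow> ('m \<Rightarrow> 'v) \<Rightarrow> nat \<Rightarrow> 'm \<Rightarrow> real"
  where "frame_comp E e u a m = representation ((\<lambda>b. e b m) ` {..<rnk E}) (u m) (e a m)"

definition vector_bundle ::
    "('m::{t2_space, second_countable_topology}, 'v::real_vector) vbundle \<Rightarrow> bool"
  where "vector_bundle E \<longleftrightarrow>
    smooth_atlas (mdim E) (charts E) \<and>
    (\<forall>m. subspace (fib E m)) \<and>
    (\<Union>(W, e)\<in>frames E. W) = UNIV \<and>
    (\<forall>(W, e)\<in>frames E. open W \<and>
       (\<forall>m\<in>W. inj_on (\<lambda>a. e a m) {..<rnk E} \<and>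
              independent ((\<lambda>a. e a m) ` {..<rnk E}) \<and>
              span ((\<lambda>a. e a m) ` {..<rnk E}) = fib E m)) \<and>
    (\<forall>(W, e)\<in>frames E. \<forall>(W', e')\<in>frames E. \<forall>a<rnk E. \<forall>b<rnk E.
       smooth_fun E (W \<inter> W') (frame_comp E e (e' a) b))"

text \<open>\<open>\<Gamma>(E)\<close>\<close>

definition Gamma :: "('m, 'v::real_vector) vbundle \<Rightarrow> ('m \<Rightarrow> 'v) set"
  where "Gamma E = {u. (\<forall>m. u m \<in> fib E m) \<and>
    (\<forall>(W, e)\<in>frames E. \<forall>a<rnk E. smooth_fun E W (frame_comp E e u a))}"

definition fmult :: "('m \<Rightarrow> real) \<Rightarrow> ('m \<Rightarrow> 'v::real_vector) \<Rightarrow> 'm \<Rightarrow> 'v"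
  where "fmult f u = (\<lambda>m. f m *\<^sub>R u m)"

text \<open>Vector fields on \<open>M\<close>, as derivations of \<open>C\<^sup>\<infinity>(M)\<close>.\<close>

definition vector_field :: "('m, 'v) vbundle \<Rightarrow> (('m \<Rightarrow> real) \<Rightarrow> 'm \<Rightarrow> real) \<Rightarrow> bool"
  where "vector_field E X \<longleftrightarrow>
    (\<forall>f\<in>C_infinity E. X f \<in> C_infinity E) \<and>
    (\<forall>f\<in>C_infinity E. \<forall>g\<in>C_infinity E.
       (\<forall>a b. X (a *\<^sub>R f + b *\<^sub>R g) = a *\<^sub>R X f + b *\<^sub>R X g) \<and>
       X (f * g) = f * X g + g * X f)"


section \<open>Bundles derived from a vector bundle\<close>

text \<open>
  A section of any of the bundles below is represented by the function mapping \<open>m\<close> to its value in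
  the fibre over \<open>m\<close>.  The fibres consist of functions that are zero outside of the space they are
  supposed to be defined on, so that equality in HOL is equality of linear maps.

  A fibrewise linear map \<open>F\<close> between bundles is smooth iff it maps smooth sections to smooth
  sections.  The arguments \<open>A\<close>, \<open>\<Gamma>A\<close> are the fibres and the smooth sections of a bundle.
\<close>

definition linear_map_on :: "'a::real_vector set \<Rightarrow> ('a \<Rightarrow> 'b::real_vector) \<Rightarrow> bool"
  where "linear_map_on V f \<longleftrightarrow>
    (\<forall>x\<in>V. \<forall>y\<in>V. \<forall>a b. f (a *\<^sub>R x + b *\<^sub>R y) = a *\<^sub>R f x + b *\<^sub>R f y)"

definition bundle_map ::
    "('m \<Rightarrow> 'a::real_vector set) \<Rightarrow> ('m \<Rightarrow> 'a) set \<Rightarrow>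
     ('m \<Rightarrow> 'b::real_vector set) \<Rightarrow> ('m \<Rightarrow> 'b) set \<Rightarrow> ('m \<Rightarrow> 'a \<Rightarrow> 'b) \<Rightarrow> bool"
  where "bundle_map A \<Gamma>A B \<Gamma>B F \<longleftrightarrow>
    (\<forall>m. linear_map_on (A m) (F m) \<and> F m ` A m \<subseteq> B m) \<and>
    (\<forall>s\<in>\<Gamma>A. (\<lambda>m. F m (s m)) \<in> \<Gamma>B)"

text \<open>Smooth sections of \<open>Hom(\<Lambda>\<^sup>2A, B)\<close>.\<close>

definition two_form ::
    "('m \<Rightarrow> 'a::real_vector set) \<Rightarrow> ('m \<Rightarrow> 'a) set \<Rightarrow>
     ('m \<Rightarrow> 'b::real_vector set) \<Rightarrow> ('m \<Rightarrow> 'b) set \<Rightarrow> ('m \<Rightarrow> 'a \<Rightarrow> 'a \<Rightarrow> 'b) \<Rightarrow> bool"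
  where "two_form A \<Gamma>A B \<Gamma>B F \<longleftrightarrow>
    (\<forall>m. \<forall>x\<in>A m. linear_map_on (A m) (F m x) \<and>
       (\<forall>y\<in>A m. F m x y \<in> B m \<and> F m y x = - F m x y)) \<and>
    (\<forall>s\<in>\<Gamma>A. \<forall>t\<in>\<Gamma>A. (\<lambda>m. F m (s m) (t m)) \<in> \<Gamma>B)"

definition ap :: "('m \<Rightarrow> 'a \<Rightarrow> 'b) \<Rightarrow> ('m \<Rightarrow> 'a) \<Rightarrow> 'm \<Rightarrow> 'b"
  where "ap F s = (\<lambda>m. F m (s m))"


subsection \<open>The gauge Lie algebroid\<close>

text \<open>The operators \<open>\<Gamma>(E) \<rightarrow> \<Gamma>(E)\<close> that are the sections of the gauge Lie algebroid.\<close>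

definition gauge_derivations ::
    "('m, 'v::real_vector) vbundle \<Rightarrow> (('m \<Rightarrow> 'v) \<Rightarrow> 'm \<Rightarrow> 'v) set"
  where "gauge_derivations E = {d.
    (\<forall>u\<in>Gamma E. d u \<in> Gamma E) \<and> (\<forall>u. u \<notin> Gamma E \<longrightarrow> d u = 0) \<and>
    linear_map_on (Gamma E) d \<and>
    (\<exists>X. vector_field E X \<and>
       (\<forall>f\<in>C_infinity E. \<forall>u\<in>Gamma E. d (fmult f u) = fmult f (d u) + fmult (X f) u))}"

text \<open>
  An element of the fibre over \<open>m\<close> is the value at \<open>m\<close> of such an operator, i.e. the map
  \<open>u \<mapsto> d(u)(m)\<close> from \<open>\<Gamma>(E)\<close> to the fibre of \<open>E\<close> over \<open>m\<close>.  \<open>act\<close> recovers the operator from the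
  section \<open>m \<mapsto> (u \<mapsto> d(u)(m))\<close>.
\<close>

type_synonym ('m, 'v) dfib = "('m \<Rightarrow> 'v) \<Rightarrow> 'v"

definition act :: "('m \<Rightarrow> ('m, 'v) dfib) \<Rightarrow> ('m \<Rightarrow> 'v) \<Rightarrow> 'm \<Rightarrow> 'v"
  where "act d u = (\<lambda>m. d m u)"

definition Gamma_D :: "('m, 'v::real_vector) vbundle \<Rightarrow> ('m \<Rightarrow> ('m, 'v) dfib) set"
  where "Gamma_D E = {d. act d \<in> gauge_derivations E}"

definition fib_D :: "('m, 'v::real_vector) vbundle \<Rightarrow> 'm \<Rightarrow> ('m, 'v) dfib set"
  where "fib_D E m = {d m | d. d \<in> Gamma_D E}"

definition bracket_D ::
    "('m \<Rightarrow> ('m, 'v::real_vector) dfib) \<Rightarrow> ('m \<Rightarrow> ('m, 'v) dfib) \<Rightarrow> 'm \<Rightarrow> ('m, 'v) dfib"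
  where "bracket_D d t = (\<lambda>m u. act d (act t u) m - act t (act d u) m)"


subsection \<open>The first jet bundle\<close>

text \<open>Two sections have the same 1-jet at \<open>m\<close> if values and first derivatives at \<open>m\<close> agree.\<close>

definition same_jet ::
    "('m, 'v::real_vector) vbundle \<Rightarrow> 'm \<Rightarrow> ('m \<Rightarrow> 'v) \<Rightarrow> ('m \<Rightarrow> 'v) \<Rightarrow> bool"
  where "same_jet E m u v \<longleftrightarrow> u m = v m \<and>
    (\<forall>(W, e)\<in>frames E. \<forall>(U, \<phi>)\<in>charts E. m \<in> W \<inter> U \<longrightarrow>
       (\<forall>a<rnk E. \<forall>i<mdim E.
          partial_deriv i (\<lambda>x. frame_comp E e u a (inv_into U \<phi> x)) (\<phi> m) =
          partial_deriv i (\<lambda>x. frame_comp E e v a (inv_into U \<phi> x)) (\<phi> m)))"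

definition jet :: "('m, 'v::real_vector) vbundle \<Rightarrow> 'm \<Rightarrow> ('m \<Rightarrow> 'v) \<Rightarrow> ('m \<Rightarrow> 'v) set"
  where "jet E m u = {v \<in> Gamma E. same_jet E m u v}"

text \<open>
  The pairing of a jet \<open>[u]\<^sub>m\<close> with \<open>\<delta>\<close> in the fibre of the gauge Lie algebroid is \<open>\<delta>(u)\<close>, for any
  representative \<open>u\<close>.  From now on, the jet \<open>\<mu> = [u]\<^sub>m\<close> is identified with the linear map
  \<open>\<delta> \<mapsto> \<langle>\<mu>, \<delta>\<rangle>\<close>, so that the jet bundle is a subbundle of \<open>Hom(\<DD>E, E)\<close>; the pairing
  becomes evaluation.  It induces the vector space structure.  Jets of global sections suffice, as
  each local section agrees near \<open>m\<close> with a global one.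
\<close>

definition jet_hom :: "('m, 'v::real_vector) vbundle \<Rightarrow> 'm \<Rightarrow> ('m \<Rightarrow> 'v) set \<Rightarrow> ('m, 'v) dfib \<Rightarrow> 'v"
  where "jet_hom E m j = (\<lambda>\<delta>. if \<delta> \<in> fib_D E m then \<delta> (SOME u. u \<in> j) else 0)"

type_synonym ('m, 'v) jfib = "('m, 'v) dfib \<Rightarrow> 'v"

definition fib_J :: "('m, 'v::real_vector) vbundle \<Rightarrow> 'm \<Rightarrow> ('m, 'v) jfib set"
  where "fib_J E m = {jet_hom E m (jet E m u) | u. u \<in> Gamma E}"

definition pair_E :: "('m \<Rightarrow> ('m, 'v) jfib) \<Rightarrow> ('m \<Rightarrow> ('m, 'v) dfib) \<Rightarrow> 'm \<Rightarrow> 'v"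
  where "pair_E \<mu> d = (\<lambda>m. \<mu> m (d m))"

text \<open>
  A section of the jet bundle is smooth iff it is smooth as a section of \<open>Hom(\<DD>E, E)\<close>, i.e. iff
  it maps smooth sections to smooth sections.
\<close>

definition Gamma_J :: "('m, 'v::real_vector) vbundle \<Rightarrow> ('m \<Rightarrow> ('m, 'v) jfib) set"
  where "Gamma_J E = {\<mu>. (\<forall>m. \<mu> m \<in> fib_J E m) \<and> (\<forall>d\<in>Gamma_D E. pair_E \<mu> d \<in> Gamma E)}"

text \<open>
  The section of the jet bundle that induces the map \<open>F\<close> from \<open>\<Gamma>(\<DD>E)\<close> to \<open>\<Gamma>(E)\<close>.  It is
  unique if it exists.
\<close>

definition J_section ::
    "('m, 'v::real_vector) vbundle \<Rightarrow> (('m \<Rightarrow> ('m, 'v) dfib) \<Rightarrow> 'm \<Rightarrow> 'v) \<Rightarrow> 'm \<Rightarrow> ('m, 'v) jfib"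
  where "J_section E F = (THE \<mu>. \<mu> \<in> Gamma_J E \<and> (\<forall>d\<in>Gamma_D E. pair_E \<mu> d = F d))"

text \<open>
  The coboundary operator of the gauge Lie algebroid with its tautological representation, in
  degrees 0 and 2.
\<close>

definition diff_0 :: "('m, 'v::real_vector) vbundle \<Rightarrow> ('m \<Rightarrow> 'v) \<Rightarrow> 'm \<Rightarrow> ('m, 'v) jfib"
  where "diff_0 E u = (\<lambda>m \<delta>. if \<delta> \<in> fib_D E m then \<delta> u else 0)"

definition diff_2 ::
    "('m \<Rightarrow> ('m, 'v) dfib \<Rightarrow> ('m, 'v) dfib \<Rightarrow> 'v::real_vector) \<Rightarrow>
     ('m \<Rightarrow> ('m, 'v) dfib) \<Rightarrow> ('m \<Rightarrow> ('m, 'v) dfib) \<Rightarrow> ('m \<Rightarrow> ('m, 'v) dfib) \<Rightarrow> 'm \<Rightarrow> 'v"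
  where "diff_2 \<sigma> d t k =
    (let s = (\<lambda>x y m. \<sigma> m (x m) (y m)) in
       act d (s t k) - act t (s d k) + act k (s d t)
       - s (bracket_D d t) k + s (bracket_D d k) t - s (bracket_D t k) d)"

definition Lie_derivative ::
    "('m, 'v::real_vector) vbundle \<Rightarrow> ('m \<Rightarrow> ('m, 'v) dfib) \<Rightarrow> ('m \<Rightarrow> ('m, 'v) jfib) \<Rightarrow>
     'm \<Rightarrow> ('m, 'v) jfib"
  where "Lie_derivative E d \<mu> =
    J_section E (\<lambda>d'. act d (pair_E \<mu> d') - pair_E \<mu> (bracket_D d d'))"


section \<open>Generalized complex structures on the omni-Lie algebroid\<close>

type_synonym ('m, 'v) olfib = "('m, 'v) dfib \<times> ('m, 'v) jfib"

definition fib_ol :: "('m, 'v::real_vector) vbundle \<Rightarrow> 'm \<Rightarrow> ('m, 'v) olfib set"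
  where "fib_ol E m = fib_D E m \<times> fib_J E m"

definition Gamma_ol :: "('m, 'v::real_vector) vbundle \<Rightarrow> ('m \<Rightarrow> ('m, 'v) olfib) set"
  where "Gamma_ol E = {\<lambda>m. (d m, \<mu> m) | d \<mu>. d \<in> Gamma_D E \<and> \<mu> \<in> Gamma_J E}"

definition pair_ol :: "('m, 'v) olfib \<Rightarrow> ('m, 'v) olfib \<Rightarrow> 'v::real_vector"
  where "pair_ol e\<^sub>1 e\<^sub>2 = (1 / 2) *\<^sub>R (snd e\<^sub>1 (fst e\<^sub>2) + snd e\<^sub>2 (fst e\<^sub>1))"

definition bracket_ol ::
    "('m, 'v::real_vector) vbundle \<Rightarrow> ('m \<Rightarrow> ('m, 'v) olfib) \<Rightarrow> ('m \<Rightarrow> ('m, 'v) olfib) \<Rightarrow>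
     'm \<Rightarrow> ('m, 'v) olfib"
  where "bracket_ol E e\<^sub>1 e\<^sub>2 =
    (let d = fst \<circ> e\<^sub>1; \<mu> = snd \<circ> e\<^sub>1; r = fst \<circ> e\<^sub>2; \<nu> = snd \<circ> e\<^sub>2 in
       (\<lambda>m. (bracket_D d r m,
             (Lie_derivative E d \<nu> - Lie_derivative E r \<mu> + diff_0 E (pair_E \<mu> r)) m)))"

definition generalized_almost_complex ::
    "('m, 'v::real_vector) vbundle \<Rightarrow> ('m \<Rightarrow> ('m, 'v) olfib \<Rightarrow> ('m, 'v) olfib) \<Rightarrow> bool"
  where "generalized_almost_complex E J \<longleftrightarrow>
    bundle_map (fib_ol E) (Gamma_ol E) (fib_ol E) (Gamma_ol E) J \<and>
    (\<forall>m. \<forall>e\<in>fib_ol E m. J m (J m e) = - e) \<and>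
    (\<forall>m. \<forall>e\<^sub>1\<in>fib_ol E m. \<forall>e\<^sub>2\<in>fib_ol E m. pair_ol (J m e\<^sub>1) (J m e\<^sub>2) = pair_ol e\<^sub>1 e\<^sub>2)"

definition generalized_complex ::
    "('m, 'v::real_vector) vbundle \<Rightarrow> ('m \<Rightarrow> ('m, 'v) olfib \<Rightarrow> ('m, 'v) olfib) \<Rightarrow> bool"
  where "generalized_complex E J \<longleftrightarrow> generalized_almost_complex E J \<and>
    (\<forall>e\<^sub>1\<in>Gamma_ol E. \<forall>e\<^sub>2\<in>Gamma_ol E.
       bracket_ol E (ap J e\<^sub>1) (ap J e\<^sub>2) - bracket_ol E e\<^sub>1 e\<^sub>2
       - ap J (bracket_ol E (ap J e\<^sub>1) e\<^sub>2 + bracket_ol E e\<^sub>1 (ap J e\<^sub>2)) = 0)"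


section \<open>Components of a generalized almost complex structure\<close>

definition star ::
    "('m, 'v::real_vector) vbundle \<Rightarrow> ('m \<Rightarrow> ('m, 'v) dfib \<Rightarrow> ('m, 'v) dfib) \<Rightarrow>
     'm \<Rightarrow> ('m, 'v) jfib \<Rightarrow> ('m, 'v) jfib"
  where "star E N m \<nu> = (\<lambda>\<delta>. if \<delta> \<in> fib_D E m then \<nu> (N m \<delta>) else 0)"

definition flat ::
    "('m, 'v::real_vector) vbundle \<Rightarrow> ('m \<Rightarrow> ('m, 'v) dfib \<Rightarrow> ('m, 'v) dfib \<Rightarrow> 'v) \<Rightarrow>
     'm \<Rightarrow> ('m, 'v) dfib \<Rightarrow> ('m, 'v) jfib"
  where "flat E \<sigma> m \<delta> = (\<lambda>\<epsilon>. if \<epsilon> \<in> fib_D E m then \<sigma> m \<delta> \<epsilon> else 0)"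

text \<open>
  In the embedding of the gauge Lie algebroid in \<open>Hom(\<JJ>E, E)\<close>, the element \<open>\<delta>\<close> is the map
  \<open>[u]\<^sub>m \<mapsto> \<delta>(u)\<close>.  Accordingly, \<open>\<pi>\<^sup>\<sharp>(\<mu>) = \<pi>(\<mu>, \<cdot>)\<close> is written as the map
  \<open>u \<mapsto> \<pi>(\<mu>, [u]\<^sub>m)\<close> on \<open>\<Gamma>(E)\<close>, where \<open>[u]\<^sub>m\<close> is the value of \<^term>\<open>diff_0 E u\<close> at \<open>m\<close>.
\<close>

definition sharp ::
    "('m, 'v::real_vector) vbundle \<Rightarrow> ('m \<Rightarrow> ('m, 'v) jfib \<Rightarrow> ('m, 'v) jfib \<Rightarrow> 'v) \<Rightarrow>
     'm \<Rightarrow> ('m, 'v) jfib \<Rightarrow> ('m, 'v) dfib"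
  where "sharp E \<pi> m \<mu> = (\<lambda>u. if u \<in> Gamma E then \<pi> m \<mu> (diff_0 E u m) else 0)"

text \<open>Sections of \<open>Hom(\<Lambda>\<^sup>2\<DD>E, E)\<close> with values in the jet bundle, and
  of \<open>Hom(\<Lambda>\<^sup>2\<JJ>E, E)\<close> with values in the gauge Lie algebroid.\<close>

definition two_form_D ::
    "('m, 'v::real_vector) vbundle \<Rightarrow> ('m \<Rightarrow> ('m, 'v) dfib \<Rightarrow> ('m, 'v) dfib \<Rightarrow> 'v) \<Rightarrow> bool"
  where "two_form_D E \<sigma> \<longleftrightarrow>
    two_form (fib_D E) (Gamma_D E) (fib E) (Gamma E) \<sigma> \<and>
    (\<forall>m. \<forall>\<delta>\<in>fib_D E m. flat E \<sigma> m \<delta> \<in> fib_J E m)"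

definition two_form_J ::
    "('m, 'v::real_vector) vbundle \<Rightarrow> ('m \<Rightarrow> ('m, 'v) jfib \<Rightarrow> ('m, 'v) jfib \<Rightarrow> 'v) \<Rightarrow> bool"
  where "two_form_J E \<pi> \<longleftrightarrow>
    two_form (fib_J E) (Gamma_J E) (fib E) (Gamma E) \<pi> \<and>
    (\<forall>m. \<forall>\<mu>\<in>fib_J E m. sharp E \<pi> m \<mu> \<in> fib_D E m)"

definition matrix_J ::
    "('m, 'v::real_vector) vbundle \<Rightarrow> ('m \<Rightarrow> ('m, 'v) dfib \<Rightarrow> ('m, 'v) dfib) \<Rightarrow>
     ('m \<Rightarrow> ('m, 'v) jfib \<Rightarrow> ('m, 'v) jfib \<Rightarrow> 'v) \<Rightarrow>
     ('m \<Rightarrow> ('m, 'v) dfib \<Rightarrow> ('m, 'v) dfib \<Rightarrow> 'v) \<Rightarrow>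
     'm \<Rightarrow> ('m, 'v) olfib \<Rightarrow> ('m, 'v) olfib"
  where "matrix_J E N \<pi> \<sigma> m = (\<lambda>(\<delta>, \<mu>).
    (N m \<delta> + sharp E \<pi> m \<mu>, flat E \<sigma> m \<delta> - star E N m \<mu>))"

definition bracket_\<pi> ::
    "('m, 'v::real_vector) vbundle \<Rightarrow> ('m \<Rightarrow> ('m, 'v) jfib \<Rightarrow> ('m, 'v) jfib \<Rightarrow> 'v) \<Rightarrow>
     ('m \<Rightarrow> ('m, 'v) jfib) \<Rightarrow> ('m \<Rightarrow> ('m, 'v) jfib) \<Rightarrow> 'm \<Rightarrow> ('m, 'v) jfib"
  where "bracket_\<pi> E \<pi> \<mu> \<nu> =
    Lie_derivative E (ap (sharp E \<pi>) \<mu>) \<nu> - Lie_derivative E (ap (sharp E \<pi>) \<nu>) \<mu>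
    - diff_0 E (pair_E \<nu> (ap (sharp E \<pi>) \<mu>))"

definition Nijenhuis ::
    "('m \<Rightarrow> ('m, 'v::real_vector) dfib \<Rightarrow> ('m, 'v) dfib) \<Rightarrow>
     ('m \<Rightarrow> ('m, 'v) dfib) \<Rightarrow> ('m \<Rightarrow> ('m, 'v) dfib) \<Rightarrow> 'm \<Rightarrow> ('m, 'v) dfib"
  where "Nijenhuis N d t =
    bracket_D (ap N d) (ap N t)
    - ap N (bracket_D (ap N d) t + bracket_D d (ap N t) - ap N (bracket_D d t))"

end

theory Submission
  imports Defs
begin

text \<open>
  Let \<open>\<J>\<close> be the endomorphism of \<open>\<DD>E \<oplus> \<JJ>E\<close> given by the matrix, and let
  \<open>T(a, b) = [\<J>a, \<J>b] - [a, b] - \<J>([\<J>a, b] + [a, \<J>b])\<close> be its torsion with respect to the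
  omni-Lie bracket.  Integrability says \<open>T = 0\<close>, and the four conditions say that \<open>T\<close> vanishes on
  pairs of arguments from the same summand:

    \<^item> on two sections of \<open>\<JJ>E\<close> the components of \<open>T\<close> are the defects in (i) and (ii);
    \<^item> on two sections \<open>d\<close>, \<open>t\<close> of \<open>\<DD>E\<close> they are the defects in (iii) and (iv), because
      \<open>i\<^bsub>d\<and>t\<^esub> d\<sigma> = L\<^sub>d \<sigma>(t) - L\<^sub>t \<sigma>(d) + d(\<sigma>(d, t)) - \<sigma>[d, t]\<close>.

  It remains to see why nothing new happens on mixed arguments.  The bracket is invariant,
  \<open>([a, b], c) + (b, [a, c]) = a \<cdot> (b, c)\<close>, its symmetric part is exact, and \<open>\<J>\<close> is skew and
  orthogonal for the pairing.  From this \<open>(T(a, b), c)\<close> is antisymmetric in all three arguments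
  (\<open>torsion_skew\<close>, \<open>torsion_skew'\<close>).  Two of three arguments always lie in the same summand, so every
  component of a mixed torsion is, up to sign, a component of an unmixed one, and the pairing is
  nondegenerate (\<open>integrable_iff\<close>).

  This computation uses only a few rules of calculus for the two bundles; they are
  collected in the locale \<open>gauge_calculus\<close>.  The rest of the text derives these rules from the
  definition of the bundles, where two analytic facts carry the weight.

    \<^item> A derivation of \<open>\<Gamma>(E)\<close> is a differential operator of first order
      (\<open>derivation_vanish\<close>).  So \<open>\<delta>(u)\<close> depends only on the 1-jet of \<open>u\<close>, and the jet of
      \<open>u\<close> may be identified with the map \<open>\<delta> \<mapsto> \<delta>(u)\<close> (\<open>fib_J_eq\<close>).  The proof is Hadamard's lemma
      together with bump functions.

    \<^item> The Lie derivative of a smooth section of the jet bundle is again such a section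
      (\<open>has_Lie_jet_Gamma_J\<close>): locally \<open>\<mu> = \<Sum>\<^sub>i g\<^sub>i dw\<^sub>i\<close> with smooth \<open>g\<^sub>i\<close>, and \<open>L\<^sub>d (g dw) = X(g) dw + g d(dw)\<close>, where
      \<open>X\<close> is the vector field of \<open>d\<close>.  The coefficients \<open>g\<^sub>i\<close> are smooth since they can be
      read off from the pairings of \<open>\<mu>\<close> with the identity and with the coordinate derivations.
\<close>

section \<open>Functions of class \<open>C\<^sup>k\<close> on Euclidean space\<close>

lemma openin_Euclidean_space_iff:
  "openin (Euclidean_space n) V \<longleftrightarrow> (\<exists>T. open T \<and> V = T \<inter> {x. \<forall>i\<ge>n. x i = 0})"
  unfolding Euclidean_space_def by (simp add: openin_subtopology euclidean_product_topology)

lemma Euclidean_space_zero: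
  "openin (Euclidean_space n) V \<Longrightarrow> x \<in> V \<Longrightarrow> n \<le> i \<Longrightarrow> x i = 0"
  by (auto simp: openin_Euclidean_space_iff)

lemma continuous_on_coord: "continuous_on S (\<lambda>x::'a \<Rightarrow> real. x i)"
  by (rule continuous_on_subset[OF continuous_on_product_coordinates]) simp

lemma continuous_on_fst_coord: "continuous_on S (\<lambda>z::('a \<Rightarrow> real) \<times> 'b::topological_space. fst z i)"
  by (rule continuous_on_compose2[OF continuous_on_coord[of UNIV i] continuous_on_fst[OF continuous_on_id]]) simp

lemma continuous_on_fun_upd: "continuous_on S (\<lambda>t::real. (x::nat\<Rightarrow>real)(i := t))"
proof (rule continuous_on_coordinatewise_then_product)
  show "continuous_on S (\<lambda>t. (x(i := t)) j)" for j by (cases "j = i") simp_all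
qed

lemma tendsto_coordinatewise:
  fixes c :: "'b \<Rightarrow> 'a \<Rightarrow> real"
  assumes "\<And>j. ((\<lambda>t. c t j) \<longlongrightarrow> l j) F"
  shows "(c \<longlongrightarrow> l) F"
proof -
  have "limitin (product_topology (\<lambda>_. euclidean) UNIV) c l F"
    unfolding limitin_componentwise using assms by (simp add: limitin_canonical_iff)
  then show ?thesis by (simp add: euclidean_product_topology limitin_canonical_iff)
qed

text \<open>
  The sets on which functions are differentiated are open in \<open>\<real>\<^sup>n\<close> but not in the space of all
  sequences.  Since partial derivatives only look along coordinate lines in \<open>\<real>\<^sup>n\<close>, relative openness
  suffices for them to be local.
\<close>

lemma eventually_coord_line:
  assumes "openin (Euclidean_space n) V" "x \<in> V" "i < n"
  shows "\<forall>\<^sub>F t in nhds (x i). x(i := t) \<in> V"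
proof -
  obtain T where T: "open T" "V = T \<inter> {x. \<forall>i\<ge>n. x i = 0}"
    using assms(1) by (auto simp: openin_Euclidean_space_iff)
  have "open ((\<lambda>t. x(i := t)) -` T)"
    using continuous_on_fun_upd[of UNIV x i] T(1) by (simp add: continuous_on_open_vimage)
  then have "\<forall>\<^sub>F t in nhds (x i). t \<in> (\<lambda>t. x(i := t)) -` T"
    using assms T by (intro eventually_nhds_in_open) auto
  then show ?thesis
    by (rule eventually_mono) (use assms T in auto)
qed

lemma partial_derivI:
  "((\<lambda>t. f (x(i := t))) has_real_derivative D) (at (x i)) \<Longrightarrow> partial_deriv i f x = D"
  by (simp add: partial_deriv_def DERIV_imp_deriv)

lemma C_k_on_imp_continuous: "C_k_on n k V f \<Longrightarrow> continuous_on V f"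
  by (cases k) auto

lemma C_k_on_imp_partial:
  "C_k_on n (Suc k) V f \<Longrightarrow> i < n \<Longrightarrow> x \<in> V \<Longrightarrow>
    ((\<lambda>t. f (x(i := t))) has_real_derivative partial_deriv i f x) (at (x i))"
  by (auto simp: partial_deriv_def DERIV_deriv_iff_real_differentiable)

lemma partial_deriv_cong:
  assumes "openin (Euclidean_space n) V" "\<And>x. x \<in> V \<Longrightarrow> f x = g x" "i < n" "x \<in> V"
  shows "partial_deriv i f x = partial_deriv i g x"
  unfolding partial_deriv_def
  by (rule deriv_cong_ev)
    (rule eventually_mono[OF eventually_coord_line[OF assms(1,4,3)] assms(2)], simp_all)

lemma C_k_on_cong:
  assumes V: "openin (Euclidean_space n) V"
  shows "(\<And>x. x \<in> V \<Longrightarrow> f x = g x) \<Longrightarrow> C_k_on n k V f \<Longrightarrow> C_k_on n k V g"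
proof (induction k arbitrary: f g)
  case 0
  then show ?case using continuous_on_cong[of V V f g] by simp
next
  case (Suc k)
  have c: "continuous_on V g"
    using Suc.prems continuous_on_cong[of V V f g] by simp
  have "(\<lambda>t. g (x(i := t))) differentiable at (x i)" if "i < n" "x \<in> V" for i x
  proof -
    have "((\<lambda>t. f (x(i := t))) has_real_derivative partial_deriv i f x) (at (x i))"
      using C_k_on_imp_partial[OF Suc.prems(2)] that by blast
    moreover have "\<forall>\<^sub>F t in nhds (x i). f (x(i := t)) = g (x(i := t))"
      by (rule eventually_mono[OF eventually_coord_line[OF V that(2,1)] Suc.prems(1)])
    ultimately have "((\<lambda>t. g (x(i := t))) has_real_derivative partial_deriv i f x) (at (x i))"
      using DERIV_cong_ev[OF refl, of "\<lambda>t. f (x(i := t))" "\<lambda>t. g (x(i := t))" "x i"] by blast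
    then show ?thesis by (auto simp: real_differentiable_def)
  qed
  moreover have "C_k_on n k V (partial_deriv i g)" if "i < n" for i
  proof (rule Suc.IH)
    show "C_k_on n k V (partial_deriv i f)" using Suc.prems(2) that by simp
    show "partial_deriv i f x = partial_deriv i g x" if "x \<in> V" for x
      using partial_deriv_cong[OF V Suc.prems(1) \<open>i < n\<close> that] by simp
  qed
  ultimately show ?case using c by simp
qed

text \<open>
  The candidates \<open>f' i\<close> have to agree with the partial derivatives only on \<open>V\<close>, because being \<open>C\<^sup>k\<close> on
  \<open>V\<close> depends on the values on \<open>V\<close> alone.
\<close>

lemma C_k_on_SucI:
  assumes V: "openin (Euclidean_space n) V"
    and "continuous_on V f"
    and D: "\<And>i x. i < n \<Longrightarrow> x \<in> V \<Longrightarrow> ((\<lambda>t. f (x(i := t))) has_real_derivative f' i x) (at (x i))"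
    and "\<And>i. i < n \<Longrightarrow> C_k_on n k V (f' i)"
  shows "C_k_on n (Suc k) V f"
proof -
  have "C_k_on n k V (partial_deriv i f)" if "i < n" for i
    by (rule C_k_on_cong[OF V _ assms(4)[OF that]]) (simp add: partial_derivI[OF D] that)
  then show ?thesis
    using assms(2) D by (auto simp: real_differentiable_def)
qed

lemma C_k_on_SucD: "C_k_on n (Suc k) V f \<Longrightarrow> C_k_on n k V f"
  by (induction k arbitrary: f) auto

lemma C_k_on_subset: "C_k_on n k V f \<Longrightarrow> V' \<subseteq> V \<Longrightarrow> C_k_on n k V' f"
proof (induction k arbitrary: f)
  case 0
  then show ?case using continuous_on_subset by auto
next
  case (Suc k)
  have "C_k_on n k V' (partial_deriv i f)" if "i < n" for i
    using Suc that by simp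
  moreover have "continuous_on V' f"
    using Suc.prems continuous_on_subset by auto
  ultimately show ?case
    using Suc.prems by auto
qed

lemma continuous_on_local:
  assumes V: "openin (Euclidean_space n) V"
    and "\<And>x. x \<in> V \<Longrightarrow> \<exists>V'. x \<in> V' \<and> openin (Euclidean_space n) V' \<and> V' \<subseteq> V \<and> continuous_on V' f"
  shows "continuous_on V f"
  unfolding continuous_on_def
proof
  fix x assume "x \<in> V"
  then obtain V' where V': "x \<in> V'" "openin (Euclidean_space n) V'" "V' \<subseteq> V" "continuous_on V' f"
    using assms(2) by blast
  then obtain T where T: "open T" "V' = T \<inter> {x. \<forall>i\<ge>n. x i = 0}"
    by (auto simp: openin_Euclidean_space_iff)
  have "at x within V = at x within V'"
    by (rule at_within_nhd[OF _ T(1)]) (use T V' Euclidean_space_zero[OF V] in auto)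
  then show "(f \<longlongrightarrow> f x) (at x within V)"
    using V' by (simp add: continuous_on_def)
qed

lemma C_k_on_local:
  assumes V: "openin (Euclidean_space n) V"
    and "\<And>x. x \<in> V \<Longrightarrow> \<exists>V'. x \<in> V' \<and> openin (Euclidean_space n) V' \<and> V' \<subseteq> V \<and> C_k_on n k V' f"
  shows "C_k_on n k V f"
proof -
  obtain B where B: "\<And>x. x \<in> V \<Longrightarrow> x \<in> B x" "\<And>x. x \<in> V \<Longrightarrow> openin (Euclidean_space n) (B x)"
    "\<And>x. x \<in> V \<Longrightarrow> B x \<subseteq> V" "\<And>x. x \<in> V \<Longrightarrow> C_k_on n k (B x) f"
    using assms(2) by metis
  have cont: "continuous_on V g" if "\<And>x. x \<in> V \<Longrightarrow> continuous_on (B x) g" for g :: "(nat \<Rightarrow> real) \<Rightarrow> real"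
  proof (rule continuous_on_local[OF V])
    fix x assume x: "x \<in> V"
    show "\<exists>V'. x \<in> V' \<and> openin (Euclidean_space n) V' \<and> V' \<subseteq> V \<and> continuous_on V' g"
      using B(1-3)[OF x] that[OF x] by auto
  qed
  have "(\<And>x. x \<in> V \<Longrightarrow> C_k_on n k (B x) g) \<Longrightarrow> C_k_on n k V g" for g
  proof (induction k arbitrary: g)
    case 0
    then show ?case using cont by simp
  next
    case (Suc k)
    have "continuous_on V g"
      by (rule cont) (rule C_k_on_imp_continuous[OF Suc.prems])
    moreover have "(\<lambda>t. g (x(i := t))) differentiable at (x i)" if "i < n" "x \<in> V" for i x
      using Suc.prems[OF that(2)] that B(1)[OF that(2)] by simp
    moreover have "C_k_on n k V (partial_deriv i g)" if "i < n" for i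
    proof (rule Suc.IH)
      show "C_k_on n k (B x) (partial_deriv i g)" if "x \<in> V" for x
        using Suc.prems[OF that] \<open>i < n\<close> by simp
    qed
    ultimately show ?case by simp
  qed
  then show ?thesis using B(4) by blast
qed

lemma C_k_on_const:
  assumes "openin (Euclidean_space n) V" shows "C_k_on n k V (\<lambda>x. c)"
proof (induction k arbitrary: c)
  case (Suc k)
  show ?case by (rule C_k_on_SucI[OF assms, where f' = "\<lambda>_ _. 0"]) (use Suc in \<open>auto\<close>)
qed simp

lemma C_k_on_coord:
  assumes "openin (Euclidean_space n) V" shows "C_k_on n k V (\<lambda>x. x j)"
proof (cases k)
  case (Suc k)
  show ?thesis unfolding Suc
  proof (rule C_k_on_SucI[OF assms, where f' = "\<lambda>i _. if i = j then 1 else 0"])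
    show "((\<lambda>t. (x(i := t)) j) has_real_derivative (if i = j then 1 else 0)) (at (x i))" for i x
      by (cases "i = j") simp_all
  qed (auto intro: continuous_on_coord C_k_on_const[OF assms])
qed (auto intro: continuous_on_coord)

lemma C_k_on_add:
  assumes V: "openin (Euclidean_space n) V"
  shows "C_k_on n k V f \<Longrightarrow> C_k_on n k V g \<Longrightarrow> C_k_on n k V (\<lambda>x. f x + g x)"
proof (induction k arbitrary: f g)
  case (Suc k)
  note pf = C_k_on_imp_partial[OF Suc.prems(1)] and pg = C_k_on_imp_partial[OF Suc.prems(2)]
  show ?case
  proof (rule C_k_on_SucI[OF V, where f' = "\<lambda>i x. partial_deriv i f x + partial_deriv i g x"])
    show "continuous_on V (\<lambda>x. f x + g x)"
      using Suc.prems by (auto intro!: continuous_intros)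
    show "((\<lambda>t. f (x(i := t)) + g (x(i := t))) has_real_derivative
           partial_deriv i f x + partial_deriv i g x) (at (x i))" if "i < n" "x \<in> V" for i x
      by (rule DERIV_add[OF pf[OF that] pg[OF that]])
    show "C_k_on n k V (\<lambda>x. partial_deriv i f x + partial_deriv i g x)" if "i < n" for i
      using Suc that by simp
  qed
qed (auto intro: continuous_intros)

lemma C_k_on_mult:
  assumes V: "openin (Euclidean_space n) V"
  shows "C_k_on n k V f \<Longrightarrow> C_k_on n k V g \<Longrightarrow> C_k_on n k V (\<lambda>x. f x * g x)"
proof (induction k arbitrary: f g)
  case (Suc k)
  note pf = C_k_on_imp_partial[OF Suc.prems(1)] and pg = C_k_on_imp_partial[OF Suc.prems(2)]
  show ?case
  proof (rule C_k_on_SucI[OF V, where f' = "\<lambda>i x. partial_deriv i f x * g x + partial_deriv i g x * f x"])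
    show "continuous_on V (\<lambda>x. f x * g x)"
      using Suc.prems by (auto intro!: continuous_intros)
    show "((\<lambda>t. f (x(i := t)) * g (x(i := t))) has_real_derivative
           partial_deriv i f x * g x + partial_deriv i g x * f x) (at (x i))" if "i < n" "x \<in> V" for i x
      using DERIV_mult[OF pf[OF that] pg[OF that]] unfolding fun_upd_triv .
    show "C_k_on n k V (\<lambda>x. partial_deriv i f x * g x + partial_deriv i g x * f x)" if "i < n" for i
      using that Suc.prems C_k_on_SucD[OF Suc.prems(1)] C_k_on_SucD[OF Suc.prems(2)]
      by (intro C_k_on_add[OF V] Suc.IH) auto
  qed
qed (auto intro: continuous_intros)

lemma C_k_on_sum:
  assumes V: "openin (Euclidean_space n) V"
  shows "(\<And>a. a \<in> A \<Longrightarrow> C_k_on n k V (f a)) \<Longrightarrow> C_k_on n k V (\<lambda>x. \<Sum>a\<in>A. f a x)"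
  by (induction A rule: infinite_finite_induct) (auto intro: C_k_on_const C_k_on_add V)

section \<open>Hadamard's lemma and the chain rule\<close>

definition coord_box :: "nat \<Rightarrow> (nat \<Rightarrow> real) \<Rightarrow> real \<Rightarrow> (nat \<Rightarrow> real) set"
  where "coord_box n p r = {x. (\<forall>i\<ge>n. x i = 0) \<and> (\<forall>i<n. \<bar>x i - p i\<bar> < r)}"

lemma openin_coord_box: "openin (Euclidean_space n) (coord_box n p r)"
proof -
  have "open (\<Inter>i\<in>{..<n}. {x::nat \<Rightarrow> real. \<bar>x i - p i\<bar> < r})"
    by (intro open_INT ballI open_Collect_less continuous_on_rabs continuous_on_diff continuous_on_const continuous_on_coord) simp
  moreover have "(\<Inter>i\<in>{..<n}. {x::nat \<Rightarrow> real. \<bar>x i - p i\<bar> < r}) = {x. \<forall>i<n. \<bar>x i - p i\<bar> < r}"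
    by auto
  ultimately show ?thesis
    unfolding openin_Euclidean_space_iff coord_box_def by (intro exI conjI) auto
qed

text \<open>
  A neighbourhood in the product topology restricts finitely many coordinates, so the coordinates
  below \<open>n\<close> admit a common radius.
\<close>

lemma coord_box_exists:
  assumes "openin (Euclidean_space n) V" "p \<in> V"
  obtains r where "r > 0" "coord_box n p r \<subseteq> V"
proof -
  obtain T where T: "open T" "V = T \<inter> {x. \<forall>i\<ge>n. x i = 0}"
    using assms(1) by (auto simp: openin_Euclidean_space_iff)
  then obtain X where X: "p \<in> Pi\<^sub>E UNIV X" "\<And>i. open (X i)" "Pi\<^sub>E UNIV X \<subseteq> T"
    using product_topology_open_contains_basis[of "\<lambda>_. euclidean" UNIV T p] assms(2)
    by (auto simp: euclidean_product_topology)
  then have "\<exists>e>0. ball (p i) e \<subseteq> X i" for i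
    using X(1,2) open_contains_ball[of "X i"] by (auto simp: PiE_UNIV_domain)
  then obtain e where e: "\<And>i. e i > 0" "\<And>i. ball (p i) (e i) \<subseteq> X i" by metis
  define r where "r = Min (insert 1 (e ` {..<n}))"
  have r: "r > 0" "\<And>i. i < n \<Longrightarrow> r \<le> e i" using e(1) by (auto simp: r_def)
  have "coord_box n p r \<subseteq> V"
  proof
    fix x assume x: "x \<in> coord_box n p r"
    have "x i \<in> X i" for i
    proof (cases "i < n")
      case True
      then have "x i \<in> ball (p i) (e i)" using x r(2)[OF True] by (auto simp: coord_box_def dist_real_def)
      then show ?thesis using e by blast
    next
      case False
      then have "x i = p i" using x assms(2) T by (auto simp: coord_box_def)
      then show ?thesis using X(1) by auto
    qed
    then show "x \<in> V" using X(3) T x by (auto simp: coord_box_def)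
  qed
  then show ?thesis using that r by blast
qed

text \<open>
  As \<open>s\<close> runs from 0 to 1, the point moves from
  \<open>(y\<^sub>0, \<dots>, y\<^bsub>j-1\<^esub>, p\<^sub>j, p\<^bsub>j+1\<^esub>, \<dots>)\<close> to \<open>(y\<^sub>0, \<dots>, y\<^bsub>j-1\<^esub>, y\<^sub>j, p\<^bsub>j+1\<^esub>, \<dots>)\<close>.  Connecting \<open>p\<close>
  with \<open>y\<close> by such coordinate segments, instead of one straight line, keeps every derivative below a
  derivative in one variable, so that the chain rule in several variables can be deduced from
  Hadamard's lemma.
\<close>

definition slide :: "(nat \<Rightarrow> real) \<Rightarrow> nat \<Rightarrow> (nat \<Rightarrow> real) \<Rightarrow> real \<Rightarrow> nat \<Rightarrow> real"
  where "slide p j y s = (\<lambda>i. if i < j then y i else if i = j then p j + s * (y j - p j) else p i)"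

lemma slide_mem:
  assumes "p \<in> coord_box n p r" "y \<in> coord_box n p r" "0 \<le> s" "s \<le> 1" "j < n"
  shows "slide p j y s \<in> coord_box n p r"
proof -
  have "\<bar>s * (y j - p j)\<bar> < r"
  proof -
    have "\<bar>s * (y j - p j)\<bar> \<le> 1 * \<bar>y j - p j\<bar>"
      unfolding abs_mult using assms by (intro mult_right_mono) auto
    then show ?thesis using assms(2,5) by (auto simp: coord_box_def)
  qed
  moreover have "r > 0" using assms by (auto simp: coord_box_def)
  ultimately show ?thesis using assms by (auto simp: coord_box_def slide_def)
qed

lemma continuous_on_slide:
  "continuous_on S (\<lambda>(y, s). slide p j y s)"
  unfolding case_prod_beta
proof (rule continuous_on_coordinatewise_then_product)
  fix i
  show "continuous_on S (\<lambda>z. slide p j (fst z) (snd z) i)"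
    unfolding slide_def
    by (cases "i < j"; cases "i = j") (auto intro!: continuous_intros continuous_on_fst_coord)
qed

text \<open>
  Differentiation under the integral sign.  Moving the coordinate \<open>i\<close> of \<open>y\<close> moves the same
  coordinate of \<open>slide p j y s\<close> with speed 1, \<open>s\<close> or 0, according to whether \<open>i < j\<close>, \<open>i = j\<close> or
  \<open>i > j\<close>.  The weight \<open>s ^ l\<close> absorbs the factor \<open>s\<close>, which makes the induction on \<open>k\<close> possible.
\<close>

lemma C_k_on_slide_integral:
  assumes p: "p \<in> coord_box n p r" and j: "j < n"
  shows "C_k_on n k (coord_box n p r) g \<Longrightarrow>
    C_k_on n k (coord_box n p r) (\<lambda>y. integral {0..1} (\<lambda>s. s ^ l * g (slide p j y s)))"
proof (induction k arbitrary: g l)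
  case 0
  let ?B = "coord_box n p r"
  have "continuous_on (?B \<times> cbox 0 1) (\<lambda>(y,s). s ^ l * g (slide p j y s))"
  proof -
    have "continuous_on (?B \<times> cbox 0 1) (\<lambda>z. g (case z of (y,s) \<Rightarrow> slide p j y s))"
      by (rule continuous_on_compose2[OF _ continuous_on_slide, where t = ?B])
        (use 0 slide_mem[OF p _ _ _ j] in auto)
    then show ?thesis unfolding case_prod_beta
      by (intro continuous_on_mult continuous_on_power continuous_on_snd continuous_on_id)
  qed
  from integral_continuous_on_param[OF this] show ?case by simp
next
  case (Suc k)
  let ?B = "coord_box n p r"
  have cont: "continuous_on (?B \<times> cbox 0 1) (\<lambda>(y,s). s ^ l * h (slide p j y s))"
    if "continuous_on ?B h" for h l
  proof -
    have "continuous_on (?B \<times> cbox 0 1) (\<lambda>z. h (case z of (y,s) \<Rightarrow> slide p j y s))"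
      by (rule continuous_on_compose2[OF _ continuous_on_slide, where t = ?B])
        (use that slide_mem[OF p _ _ _ j] in auto)
    then show ?thesis unfolding case_prod_beta
      by (intro continuous_on_mult continuous_on_power continuous_on_snd continuous_on_id)
  qed
  define L where "L i = (if i = j then Suc l else l)" for i
  define c where "c i = (if i \<le> j then 1 else 0::real)" for i
  have cg: "continuous_on ?B g" and cpg: "\<And>i. i < n \<Longrightarrow> continuous_on ?B (partial_deriv i g)"
    using Suc.prems C_k_on_imp_continuous by auto
  show ?case
  proof (rule C_k_on_SucI[OF openin_coord_box, where
      f' = "\<lambda>i y. c i * integral {0..1} (\<lambda>s. s ^ L i * partial_deriv i g (slide p j y s))"])
    from integral_continuous_on_param[OF cont[OF cg]]
    show "continuous_on ?B (\<lambda>y. integral {0..1} (\<lambda>s. s ^ l * g (slide p j y s)))" by simp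
    show "C_k_on n k ?B (\<lambda>y. c i * integral {0..1} (\<lambda>s. s ^ L i * partial_deriv i g (slide p j y s)))"
      if "i < n" for i
      using that Suc by (auto intro!: C_k_on_mult C_k_on_const openin_coord_box)
    fix i y assume i: "i < n" and y: "y \<in> ?B"
    define U where "U = {p i - r<..<p i + r}"
    have yU: "y(i := t) \<in> ?B" if "t \<in> U" for t
      using that i y by (auto simp: U_def coord_box_def)
    have U: "y i \<in> U" "open U" "convex U"
      using i y by (auto simp: U_def coord_box_def abs_less_iff)
    have "((\<lambda>t. integral (cbox 0 1) (\<lambda>s. s ^ l * g (slide p j (y(i := t)) s))) has_real_derivative
       integral (cbox 0 1) (\<lambda>s. c i * (s ^ L i * partial_deriv i g (slide p j (y(i := y i)) s)))) (at (y i) within U)"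
    proof (rule leibniz_rule_field_derivative)
      fix t s :: real assume t: "t \<in> U" and s: "s \<in> cbox 0 1"
      define z where "z = slide p j (y(i := t)) s"
      have z: "z \<in> ?B" unfolding z_def
        using slide_mem[OF p yU[OF t] _ _ j] s by simp
      have D: "((\<lambda>a. g (z(i := a))) has_real_derivative partial_deriv i g z) (at (z i))"
        using C_k_on_imp_partial[OF Suc.prems i z] .
      have "((\<lambda>t. g (slide p j (y(i := t)) s)) has_real_derivative
          (c i * (if i = j then s else 1) * partial_deriv i g z)) (at t)"
      proof -
        consider "i < j" | "i = j" | "i > j" by linarith
        then show ?thesis
        proof cases
          case 1
          have "slide p j (y(i := a)) s = z(i := a)" for a using 1 by (auto simp: slide_def z_def fun_eq_iff)
          moreover have "z i = t" using 1 by (auto simp: slide_def z_def)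
          ultimately show ?thesis using D 1 by (simp add: c_def)
        next
          case 2
          have eq: "slide p j (y(i := a)) s = z(i := p i + s * (a - p i))" for a using 2 by (auto simp: slide_def z_def fun_eq_iff)
          have zi: "z i = p i + s * (t - p i)" using 2 by (auto simp: slide_def z_def)
          have "((\<lambda>a. p i + s * (a - p i)) has_real_derivative s) (at t)"
            by (auto intro!: derivative_eq_intros)
          from DERIV_chain2[OF D[unfolded zi] this] show ?thesis unfolding eq using 2 by (simp add: c_def mult.commute)
        next
          case 3
          then have "slide p j (y(i := a)) s = z" for a by (auto simp: slide_def z_def fun_eq_iff)
          then show ?thesis using 3 by (simp add: c_def)
        qed
      qed
      then have "((\<lambda>t. s ^ l * g (slide p j (y(i := t)) s)) has_real_derivative
          s ^ l * (c i * (if i = j then s else 1) * partial_deriv i g z)) (at t)"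
        by (rule DERIV_cmult)
      then show "((\<lambda>t. s ^ l * g (slide p j (y(i := t)) s)) has_real_derivative
          c i * (s ^ L i * partial_deriv i g (slide p j (y(i := t)) s))) (at t within U)"
        unfolding z_def[symmetric] by (auto simp: L_def algebra_simps intro: DERIV_subset split: if_splits)
    next
      fix t assume t: "t \<in> U"
      have "continuous_on (cbox 0 1) (\<lambda>s. case (y(i := t), s) of (y, s) \<Rightarrow> s ^ l * g (slide p j y s))"
        by (rule continuous_on_compose2[OF cont[OF cg]]) (use yU[OF t] in \<open>auto intro!: continuous_intros\<close>)
      then show "(\<lambda>s. s ^ l * g (slide p j (y(i := t)) s)) integrable_on cbox 0 1"
        by (intro integrable_continuous) simp
    next
      have "continuous_on (U \<times> cbox 0 1) (\<lambda>z. case (y(i := fst z), snd z) of (y, s) \<Rightarrow> s ^ L i * partial_deriv i g (slide p j y s))"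
        by (rule continuous_on_compose2[OF cont[OF cpg[OF i]]])
         (use yU in \<open>auto intro!: continuous_on_Pair continuous_on_snd continuous_on_id
            continuous_on_compose2[OF continuous_on_fun_upd[of UNIV y i] continuous_on_fst[OF continuous_on_id]]\<close>)
      then show "continuous_on (U \<times> cbox 0 1) (\<lambda>(t, s). c i * (s ^ L i * partial_deriv i g (slide p j (y(i := t)) s)))"
        by (auto intro!: continuous_intros simp: case_prod_beta)
    qed (use U in auto)
    then show "((\<lambda>t. integral {0..1} (\<lambda>s. s ^ l * g (slide p j (y(i := t)) s))) has_real_derivative
           c i * integral {0..1} (\<lambda>s. s ^ L i * partial_deriv i g (slide p j y s))) (at (y i))"
      using at_within_open[OF U(1,2)] by simp
  qed
qed

definition hadamard_quotient :: "(nat \<Rightarrow> real) \<Rightarrow> ((nat \<Rightarrow> real) \<Rightarrow> real) \<Rightarrow> nat \<Rightarrow> (nat \<Rightarrow> real) \<Rightarrow> real"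
  where "hadamard_quotient p f j y = integral {0..1} (\<lambda>s. partial_deriv j f (slide p j y s))"

lemma hadamard_quotient_C_k:
  assumes "p \<in> coord_box n p r" "j < n" "C_k_on n (Suc k) (coord_box n p r) f"
  shows "C_k_on n k (coord_box n p r) (hadamard_quotient p f j)"
  using C_k_on_slide_integral[OF assms(1,2), of k "partial_deriv j f" 0] assms
  by (simp add: hadamard_quotient_def[abs_def])

lemma hadamard_quotient_at: "hadamard_quotient p f j p = partial_deriv j f p"
proof -
  have "slide p j p s = p" for s by (auto simp: slide_def)
  then show ?thesis by (simp add: hadamard_quotient_def)
qed

text \<open>
  Hadamard's lemma: the increments along the coordinate segments telescope, and each is the integral
  of the corresponding partial derivative.
\<close>

lemma hadamard:
  assumes p: "p \<in> coord_box n p r" and f: "C_k_on n (Suc k) (coord_box n p r) f" and y: "y \<in> coord_box n p r"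
  shows "f y = f p + (\<Sum>j<n. (y j - p j) * hadamard_quotient p f j y)"
proof -
  have step: "f (slide p j y 1) - f (slide p j y 0) = (y j - p j) * hadamard_quotient p f j y" if j: "j < n" for j
  proof -
    have "((\<lambda>s. (y j - p j) * partial_deriv j f (slide p j y s)) has_integral f (slide p j y 1) - f (slide p j y 0)) {0..1}"
    proof (rule fundamental_theorem_of_calculus)
      fix s :: real assume s: "s \<in> {0..1}"
      define z where "z = slide p j y s"
      have z: "z \<in> coord_box n p r" unfolding z_def
        using slide_mem[OF p y _ _ j] s by simp
      have D: "((\<lambda>a. f (z(j := a))) has_real_derivative partial_deriv j f z) (at (z j))"
        using C_k_on_imp_partial[OF f j z] .
      have eq: "slide p j y a = z(j := p j + a * (y j - p j))" for a by (auto simp: slide_def z_def fun_eq_iff)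
      have zi: "z j = p j + s * (y j - p j)" by (auto simp: slide_def z_def)
      have "((\<lambda>a. p j + a * (y j - p j)) has_real_derivative (y j - p j)) (at s)"
        by (auto intro!: derivative_eq_intros)
      from DERIV_chain2[OF D[unfolded zi] this]
      have "((\<lambda>a. f (slide p j y a)) has_real_derivative (y j - p j) * partial_deriv j f z) (at s)"
        by (simp add: eq mult.commute)
      then show "((\<lambda>a. f (slide p j y a)) has_vector_derivative (y j - p j) * partial_deriv j f (slide p j y s)) (at s within {0..1})"
        unfolding z_def[symmetric] has_real_derivative_iff_has_vector_derivative[symmetric]
        by (rule DERIV_subset) simp
    qed simp
    then show ?thesis by (metis hadamard_quotient_def integral_mult_right integral_unique)
  qed
  have sl: "slide p (Suc j) y 0 = slide p j y 1" for j by (auto simp: slide_def fun_eq_iff)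
  have "(\<Sum>j<n. (y j - p j) * hadamard_quotient p f j y) = (\<Sum>j<n. f (slide p (Suc j) y 0) - f (slide p j y 0))"
    by (intro sum.cong refl) (simp add: step[symmetric] sl)
  also have "\<dots> = f (slide p n y 0) - f (slide p 0 y 0)"
    by (rule sum_lessThan_telescope)
  also have "slide p 0 y 0 = p" by (auto simp: slide_def fun_eq_iff)
  also have "slide p n y 0 = y" using y p by (auto simp: slide_def fun_eq_iff coord_box_def)
  finally show ?thesis by simp
qed

text \<open>
  By Hadamard's lemma \<open>f(c t) - f(c t\<^sub>0) = \<Sum>\<^sub>j (c\<^sub>j t - c\<^sub>j t\<^sub>0) h\<^sub>j(c t)\<close>, where \<open>h\<^sub>j\<close> is continuous with
  value \<open>\<partial>\<^sub>j f\<close> at \<open>c t\<^sub>0\<close>; divide by \<open>t - t\<^sub>0\<close> and take the limit.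
\<close>

lemma chain_rule:
  assumes V: "openin (Euclidean_space n) V" and f: "C_k_on n (Suc k) V f"
    and c: "c t0 \<in> V" "\<forall>\<^sub>F t in nhds t0. c t \<in> V"
    and d: "\<And>j. j < n \<Longrightarrow> ((\<lambda>t. c t j) has_real_derivative c' j) (at t0)"
  shows "((\<lambda>t. f (c t)) has_real_derivative (\<Sum>j<n. partial_deriv j f (c t0) * c' j)) (at t0)"
proof -
  define p where "p = c t0"
  obtain r where r: "r > 0" "coord_box n p r \<subseteq> V"
    using coord_box_exists[OF V c(1)] p_def by blast
  let ?B = "coord_box n p r"
  have p: "p \<in> ?B" using Euclidean_space_zero[OF V c(1)] r by (auto simp: coord_box_def p_def)
  have fB: "C_k_on n (Suc k) ?B f" using C_k_on_subset[OF f r(2)] .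
  have cont_c: "isCont c t0"
  proof -
    have "isCont (\<lambda>t. c t j) t0" for j
    proof (cases "j < n")
      case True
      then show ?thesis using d DERIV_isCont by blast
    next
      case False
      have "\<forall>\<^sub>F t in nhds t0. c t j = 0"
        using c(2) by (rule eventually_mono) (use False Euclidean_space_zero[OF V] in auto)
      then show ?thesis by (subst isCont_cong[where g = "\<lambda>_. 0"]) auto
    qed
    then have "(c \<longlongrightarrow> c t0) (at t0)"
      by (intro tendsto_coordinatewise) (simp add: isCont_def)
    then show ?thesis by (simp add: continuous_within)
  qed
  have ev: "\<forall>\<^sub>F t in nhds t0. c t \<in> ?B"
  proof -
    have "\<forall>\<^sub>F t in nhds t0. \<forall>j\<in>{..<n}. \<bar>c t j - p j\<bar> < r"
    proof (rule eventually_ball_finite, simp, rule ballI)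
      fix j assume "j \<in> {..<n}"
      then have "isCont (\<lambda>t. c t j) t0" using d DERIV_isCont by blast
      then have "((\<lambda>t. c t j) \<longlongrightarrow> p j) (nhds t0)"
        by (metis isContD p_def tendsto_at_iff_tendsto_nhds)
      then have "\<forall>\<^sub>F t in nhds t0. dist (c t j) (p j) < r" using r(1) by (rule tendstoD)
      then show "\<forall>\<^sub>F t in nhds t0. \<bar>c t j - p j\<bar> < r" by (simp add: dist_real_def)
    qed
    with c(2) show ?thesis
      by eventually_elim (use Euclidean_space_zero[OF V] in \<open>auto simp: coord_box_def\<close>)
  qed
  have ev_at: "\<forall>\<^sub>F t in at t0. c t \<in> ?B"
    using ev unfolding eventually_at_filter by (rule eventually_mono) simp
  have H: "((\<lambda>t. hadamard_quotient p f j (c t)) \<longlongrightarrow> partial_deriv j f p) (at t0)" if "j < n" for j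
  proof -
    have "continuous_on ?B (hadamard_quotient p f j)"
      using hadamard_quotient_C_k[OF p that fB] C_k_on_imp_continuous by blast
    from continuous_on_tendsto_compose[OF this, of c p "at t0"] show ?thesis
      using cont_c ev_at p by (simp add: hadamard_quotient_at isCont_def p_def)
  qed
  have "((\<lambda>t. \<Sum>j<n. (c t j - p j) / (t - t0) * hadamard_quotient p f j (c t)) \<longlongrightarrow>
      (\<Sum>j<n. c' j * partial_deriv j f p)) (at t0)"
    using d H unfolding p_def has_field_derivative_iff by (intro tendsto_sum tendsto_mult) auto
  moreover have "\<forall>\<^sub>F t in at t0. (\<Sum>j<n. (c t j - p j) / (t - t0) * hadamard_quotient p f j (c t)) = (f (c t) - f (c t0)) / (t - t0)"
    using ev_at
  proof eventually_elim
    case (elim t)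
    show ?case using hadamard[OF p fB elim] by (simp add: p_def sum_divide_distrib)
  qed
  ultimately have "((\<lambda>t. (f (c t) - f (c t0)) / (t - t0)) \<longlongrightarrow> (\<Sum>j<n. c' j * partial_deriv j f p)) (at t0)"
    by (rule Lim_transform_eventually)
  then show ?thesis unfolding has_field_derivative_iff p_def by (simp add: mult.commute)
qed

lemma continuous_on_compose_coordinatewise:
  assumes V': "openin (Euclidean_space n') V'" and \<psi>: "\<And>x. x \<in> V \<Longrightarrow> \<psi> x \<in> V'"
    and f: "continuous_on V' f" and c: "\<And>j. j < n' \<Longrightarrow> continuous_on V (\<lambda>x. \<psi> x j)"
  shows "continuous_on V (\<lambda>x. f (\<psi> x))"
proof (rule continuous_on_compose2[OF f])
  show "continuous_on V \<psi>"
  proof (rule continuous_on_coordinatewise_then_product)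
    fix j show "continuous_on V (\<lambda>x. \<psi> x j)"
    proof (cases "j < n'")
      case False
      then have "\<psi> x j = 0" if "x \<in> V" for x using Euclidean_space_zero[OF V' \<psi>[OF that]] by simp
      then show ?thesis using continuous_on_cong[of V V "\<lambda>x. \<psi> x j" "\<lambda>_. 0"] by simp
    qed (rule c)
  qed
qed (use \<psi> in auto)

text \<open>
  Induction on \<open>k\<close>: by the chain rule the partial derivatives of the composition are sums of products
  of \<open>C\<^sup>k\<close> functions, where \<open>\<partial>\<^sub>j f \<circ> \<psi>\<close> is covered by the induction hypothesis.
\<close>

lemma C_k_on_compose:
  assumes V: "openin (Euclidean_space n) V" and V': "openin (Euclidean_space n') V'"
    and \<psi>: "\<And>x. x \<in> V \<Longrightarrow> \<psi> x \<in> V'"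
  shows "C_k_on n' k V' f \<Longrightarrow> (\<And>j. j < n' \<Longrightarrow> C_k_on n k V (\<lambda>x. \<psi> x j)) \<Longrightarrow> C_k_on n k V (\<lambda>x. f (\<psi> x))"
proof (induction k arbitrary: f)
  case 0
  then show ?case using continuous_on_compose_coordinatewise[of n' V' V \<psi> f] V' \<psi> by simp
next
  case (Suc k)
  have cont: "continuous_on V (\<lambda>x. f (\<psi> x))"
    using continuous_on_compose_coordinatewise[of n' V' V \<psi> f] V' \<psi> Suc.prems C_k_on_imp_continuous
    by blast
  show ?case
  proof (rule C_k_on_SucI[OF V cont, where f' = "\<lambda>i x. \<Sum>j<n'. partial_deriv j f (\<psi> x) * partial_deriv i (\<lambda>x. \<psi> x j) x"])
    show "C_k_on n k V (\<lambda>x. \<Sum>j<n'. partial_deriv j f (\<psi> x) * partial_deriv i (\<lambda>x. \<psi> x j) x)" if "i < n" for i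
    proof (rule C_k_on_sum[OF V])
      fix j assume "j \<in> {..<n'}"
      then have j: "j < n'" by simp
      have "C_k_on n k V (\<lambda>x. partial_deriv j f (\<psi> x))"
      proof (rule Suc.IH)
        show "C_k_on n' k V' (partial_deriv j f)" using Suc.prems(1) j by simp
        show "C_k_on n k V (\<lambda>x. \<psi> x l)" if "l < n'" for l
          using C_k_on_SucD[OF Suc.prems(2)[OF that]] .
      qed
      moreover have "C_k_on n k V (partial_deriv i (\<lambda>x. \<psi> x j))"
        using Suc.prems(2)[OF j] that by simp
      ultimately show "C_k_on n k V (\<lambda>x. partial_deriv j f (\<psi> x) * partial_deriv i (\<lambda>x. \<psi> x j) x)"
        by (rule C_k_on_mult[OF V])
    qed
    fix i x assume i: "i < n" and x: "x \<in> V"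
    let ?c = "\<lambda>t. \<psi> (x(i := t))"
    have "((\<lambda>t. f (?c t)) has_real_derivative (\<Sum>j<n'. partial_deriv j f (?c (x i)) * partial_deriv i (\<lambda>x. \<psi> x j) x)) (at (x i))"
    proof (rule chain_rule[OF V' Suc.prems(1)])
      show "\<forall>\<^sub>F t in nhds (x i). ?c t \<in> V'"
        by (rule eventually_mono[OF eventually_coord_line[OF V x i] \<psi>])
      show "?c (x i) \<in> V'" using \<psi> x by simp
      show "((\<lambda>t. ?c t j) has_real_derivative partial_deriv i (\<lambda>x. \<psi> x j) x) (at (x i))" if "j < n'" for j
        by (rule C_k_on_imp_partial[OF Suc.prems(2)[OF that] i x])
    qed
    then show "((\<lambda>t. f (\<psi> (x(i := t)))) has_real_derivative (\<Sum>j<n'. partial_deriv j f (\<psi> x) * partial_deriv i (\<lambda>x. \<psi> x j) x)) (at (x i))"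
      by simp
  qed
qed

section \<open>Bump functions\<close>

text \<open>
  For \<open>j = 0\<close> this is the flat function \<open>exp (-1/t)\<close>.  The powers of \<open>1/t\<close> make the family closed under
  differentiation up to linear combinations.
\<close>

definition flat_exp :: "nat \<Rightarrow> real \<Rightarrow> real"
  where "flat_exp j t = (if t \<le> 0 then 0 else inverse t ^ j * exp (- inverse t))"

text \<open>
  Substituting \<open>x = 1/t\<close>, this is the fact that the exponential function outgrows all powers.
\<close>

lemma flat_exp_tendsto_0: "(flat_exp j \<longlongrightarrow> 0) (at 0)"
proof -
  have "((\<lambda>x::real. x ^ j / exp x) \<longlongrightarrow> 0) at_top"
    by (rule tendsto_power_div_exp_0)
  from filterlim_compose[OF this filterlim_inverse_at_top_right]
  have "((\<lambda>t::real. inverse t ^ j / exp (inverse t)) \<longlongrightarrow> 0) (at_right 0)" .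
  moreover have "\<forall>\<^sub>F t in at_right 0. inverse t ^ j / exp (inverse t) = flat_exp j t"
    by (auto simp: eventually_at_filter flat_exp_def exp_minus divide_inverse)
  ultimately have r: "(flat_exp j \<longlongrightarrow> 0) (at_right 0)"
    by (rule Lim_transform_eventually)
  have "\<forall>\<^sub>F t in at_left 0. 0 = flat_exp j t"
    by (auto simp: eventually_at_filter flat_exp_def)
  from Lim_transform_eventually[OF tendsto_const this] have "(flat_exp j \<longlongrightarrow> 0) (at_left 0)" .
  with r show ?thesis using filterlim_split_at by blast
qed

lemma DERIV_flat_exp:
  "(flat_exp j has_real_derivative flat_exp (j + 2) t - real j * flat_exp (j + 1) t) (at t)"
proof -
  consider "t < 0" | "t = 0" | "t > 0" by linarith
  then show ?thesis
  proof cases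
    case 1
    have "((\<lambda>_. 0) has_real_derivative 0) (at t)" by simp
    moreover have "\<forall>\<^sub>F s in nhds t. 0 = flat_exp j s"
      using eventually_nhds_in_open[of "{..<0}" t] 1 by (auto elim!: eventually_mono simp: flat_exp_def)
    ultimately have "(flat_exp j has_real_derivative 0) (at t)"
      using DERIV_cong_ev[OF refl, of "\<lambda>_. 0" "flat_exp j" t] by blast
    then show ?thesis using 1 by (simp add: flat_exp_def)
  next
    case 2
    have "(flat_exp (Suc j) \<longlongrightarrow> 0) (at 0)" by (rule flat_exp_tendsto_0)
    moreover have "\<forall>\<^sub>F h in at 0. flat_exp (Suc j) h = (flat_exp j (0 + h) - flat_exp j 0) / h"
      by (auto simp: eventually_at_filter flat_exp_def field_simps)
    ultimately have "((\<lambda>h. (flat_exp j (0 + h) - flat_exp j 0) / h) \<longlongrightarrow> 0) (at 0)"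
      by (rule Lim_transform_eventually)
    then show ?thesis using 2 by (simp add: DERIV_def flat_exp_def)
  next
    case 3
    have "((\<lambda>t. inverse t ^ j * exp (- inverse t)) has_real_derivative
        flat_exp (j + 2) t - real j * flat_exp (j + 1) t) (at t)"
      using 3 by (auto intro!: derivative_eq_intros simp: flat_exp_def)
         (cases j; simp add: power2_eq_square field_simps)
    moreover have "\<forall>\<^sub>F s in nhds t. inverse s ^ j * exp (- inverse s) = flat_exp j s"
      using eventually_nhds_in_open[of "{0<..}" t] 3 by (auto elim!: eventually_mono simp: flat_exp_def)
    ultimately show ?thesis
      using DERIV_cong_ev[OF refl, of "\<lambda>t. inverse t ^ j * exp (- inverse t)" "flat_exp j" t] by blast
  qed
qed

lemma C_k_on_flat_exp:
  assumes V: "openin (Euclidean_space n) V"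
  shows "C_k_on n k V h \<Longrightarrow> C_k_on n k V (\<lambda>x. flat_exp j (h x))"
proof (induction k arbitrary: j)
  case 0
  have "continuous_on UNIV (flat_exp j)"
    using DERIV_flat_exp DERIV_isCont continuous_at_imp_continuous_on by blast
  then show ?case using 0 continuous_on_compose2[of UNIV "flat_exp j" V h] by simp
next
  case (Suc k)
  have cont: "continuous_on UNIV (flat_exp j)"
    using DERIV_flat_exp DERIV_isCont continuous_at_imp_continuous_on by blast
  note IH = Suc.IH[OF C_k_on_SucD[OF Suc.prems]]
  show ?case
  proof (rule C_k_on_SucI[OF V, where
      f' = "\<lambda>i x. (flat_exp (j + 2) (h x) + (- real j) * flat_exp (j + 1) (h x)) * partial_deriv i h x"])
    show "continuous_on V (\<lambda>x. flat_exp j (h x))"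
      using continuous_on_compose2[OF cont, of V h] C_k_on_imp_continuous[OF Suc.prems] by simp
    show "C_k_on n k V (\<lambda>x. (flat_exp (j + 2) (h x) + (- real j) * flat_exp (j + 1) (h x)) * partial_deriv i h x)"
      if "i < n" for i
    proof (rule C_k_on_mult[OF V C_k_on_add[OF V IH C_k_on_mult[OF V C_k_on_const[OF V] IH]]])
      show "C_k_on n k V (partial_deriv i h)" using Suc.prems that by simp
    qed
    fix i x assume i: "i < n" and x: "x \<in> V"
    have "((\<lambda>t. flat_exp j (h (x(i := t)))) has_real_derivative
      (flat_exp (j + 2) (h (x(i := x i))) - real j * flat_exp (j + 1) (h (x(i := x i)))) * partial_deriv i h x) (at (x i))"
      by (rule DERIV_chain2[OF DERIV_flat_exp C_k_on_imp_partial[OF Suc.prems i x]])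
    then show "((\<lambda>t. flat_exp j (h (x(i := t)))) has_real_derivative
      (flat_exp (j + 2) (h x) + (- real j) * flat_exp (j + 1) (h x)) * partial_deriv i h x) (at (x i))"
      by simp
  qed
qed

lemma C_k_on_inverse:
  assumes V: "openin (Euclidean_space n) V" and nz: "\<And>x. x \<in> V \<Longrightarrow> h x \<noteq> 0"
  shows "C_k_on n k V h \<Longrightarrow> C_k_on n k V (\<lambda>x. inverse (h x))"
proof (induction k)
  case 0
  then show ?case using nz by (auto intro!: continuous_on_inverse)
next
  case (Suc k)
  note IH = Suc.IH[OF C_k_on_SucD[OF Suc.prems]]
  show ?case
  proof (rule C_k_on_SucI[OF V, where f' = "\<lambda>i x. (-1) * (inverse (h x) * (partial_deriv i h x * inverse (h x)))"])
    show "continuous_on V (\<lambda>x. inverse (h x))"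
      using nz C_k_on_imp_continuous[OF Suc.prems] by (auto intro!: continuous_on_inverse)
    show "C_k_on n k V (\<lambda>x. (-1) * (inverse (h x) * (partial_deriv i h x * inverse (h x))))" if "i < n" for i
    proof (rule C_k_on_mult[OF V C_k_on_const[OF V] C_k_on_mult[OF V IH C_k_on_mult[OF V _ IH]]])
      show "C_k_on n k V (partial_deriv i h)" using Suc.prems that by simp
    qed
    fix i x assume i: "i < n" and x: "x \<in> V"
    have "h (x(i := x i)) \<noteq> 0" using nz[OF x] by simp
    from DERIV_inverse'[OF C_k_on_imp_partial[OF Suc.prems i x] this]
    have "((\<lambda>t. inverse (h (x(i := t)))) has_real_derivative
       - (inverse (h (x(i := x i))) * partial_deriv i h x * inverse (h (x(i := x i))))) (at (x i))" .
    then show "((\<lambda>t. inverse (h (x(i := t)))) has_real_derivative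
       (-1) * (inverse (h x) * (partial_deriv i h x * inverse (h x)))) (at (x i))"
      by (simp add: mult.assoc)
  qed
qed

text \<open>
  The denominator is positive everywhere because \<open>1 - t\<close> and \<open>t - 1/2\<close> are never both \<open>\<le> 0\<close>.
\<close>

definition smooth_step :: "real \<Rightarrow> real"
  where "smooth_step t = flat_exp 0 (1 - t) * inverse (flat_exp 0 (1 - t) + flat_exp 0 (t - 1/2))"

lemma smooth_step_eq: "t \<le> 1/2 \<Longrightarrow> smooth_step t = 1" "t \<ge> 1 \<Longrightarrow> smooth_step t = 0"
  by (auto simp: smooth_step_def flat_exp_def)

lemma C_k_on_diff:
  assumes V: "openin (Euclidean_space n) V" and "C_k_on n k V f" "C_k_on n k V g"
  shows "C_k_on n k V (\<lambda>x. f x - g x)"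
  using C_k_on_add[OF V assms(2) C_k_on_mult[OF V C_k_on_const[OF V, of k "-1"] assms(3)]] by simp

lemma C_k_on_smooth_step:
  assumes V: "openin (Euclidean_space n) V" and h: "C_k_on n k V h"
  shows "C_k_on n k V (\<lambda>x. smooth_step (h x))"
proof -
  have "flat_exp 0 (1 - t) + flat_exp 0 (t - 1/2) \<noteq> 0" for t
  proof -
    have "flat_exp 0 (1 - t) \<ge> 0" "flat_exp 0 (t - 1/2) \<ge> 0" "flat_exp 0 (1 - t) > 0 \<or> flat_exp 0 (t - 1/2) > 0"
      by (auto simp: flat_exp_def)
    then show ?thesis by linarith
  qed
  then show ?thesis
    unfolding smooth_step_def
    by (intro C_k_on_mult[OF V] C_k_on_inverse[OF V] C_k_on_add[OF V] C_k_on_flat_exp[OF V] C_k_on_diff[OF V] C_k_on_const[OF V] h)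
qed

text \<open>
  A smooth step applied to the squared distance from \<open>p\<close>, scaled such that the support lies in a
  compact cube \<open>K\<close> inside \<open>V\<close>.
\<close>

lemma bump_Euclidean:
  assumes V: "openin (Euclidean_space n) V" and p: "p \<in> V"
  obtains g K P where "smooth_on n {x. \<forall>i\<ge>n. x i = 0} g" "compact K" "K \<subseteq> V"
    "\<forall>x. (\<forall>i\<ge>n. x i = 0) \<longrightarrow> x \<notin> K \<longrightarrow> g x = 0"
    "openin (Euclidean_space n) P" "p \<in> P" "P \<subseteq> V" "\<forall>x\<in>P. g x = 1"
proof -
  obtain r where r: "r > 0" "coord_box n p r \<subseteq> V" using coord_box_exists[OF assms] .
  let ?E = "{x::nat\<Rightarrow>real. \<forall>i\<ge>n. x i = 0}"
  have E: "openin (Euclidean_space n) ?E" by (auto simp: openin_Euclidean_space_iff)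
  \<comment> \<open>half the radius, so that the closed cube stays inside the open box\<close>
  define s where "s = r / 2"
  have s: "0 < s" "s < r" using r by (auto simp: s_def)
  define q where "q x = (\<Sum>i<n. (x i - p i) * (x i - p i)) * inverse (s\<^sup>2)" for x
  have q_smooth: "C_k_on n k ?E q" for k
    unfolding q_def
    by (intro C_k_on_mult[OF E] C_k_on_sum[OF E] C_k_on_diff[OF E] C_k_on_const[OF E] C_k_on_coord[OF E])
  define K where "K = Pi\<^sub>E UNIV (\<lambda>i. if i < n then {p i - s..p i + s} else {0})"
  have K_iff: "x \<in> K \<longleftrightarrow> (\<forall>i. x i \<in> (if i < n then {p i - s..p i + s} else {0}))" for x
    by (simp add: K_def PiE_UNIV_domain Pi_iff)
  have q_outside: "q x \<ge> 1" if "x \<in> ?E" "x \<notin> K" for x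
  proof -
    obtain i where i: "x i \<notin> (if i < n then {p i - s..p i + s} else {0})"
      using \<open>x \<notin> K\<close> K_iff by blast
    then have "i < n" using that by (auto split: if_splits)
    then have "\<bar>s\<bar> \<le> \<bar>x i - p i\<bar>" using i s by (auto simp: abs_if)
    then have "s\<^sup>2 \<le> (x i - p i) * (x i - p i)" by (simp add: abs_le_square_iff power2_eq_square)
    also have "\<dots> \<le> (\<Sum>i<n. (x i - p i) * (x i - p i))"
      using \<open>i < n\<close> by (intro member_le_sum) auto
    finally show ?thesis using s by (simp add: q_def field_simps)
  qed
  define P where "P = coord_box n p r \<inter> {x. q x < 1/2}"
  have "openin (Euclidean_space n) P"
  proof -
    have "continuous_on (coord_box n p r) q"
      using C_k_on_imp_continuous[OF q_smooth[of 0]] by (rule continuous_on_subset) (auto simp: coord_box_def)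
    then have "openin (top_of_set (coord_box n p r)) (coord_box n p r \<inter> q -` {..<1/2})"
      by (rule continuous_openin_preimage_gen) simp
    moreover have "P = coord_box n p r \<inter> q -` {..<1/2}" by (auto simp: P_def)
    moreover have "top_of_set (coord_box n p r) = subtopology (Euclidean_space n) (coord_box n p r)"
      by (simp add: Euclidean_space_def euclidean_product_topology subtopology_subtopology)
        (metis (no_types, lifting) Int_absorb1 coord_box_def mem_Collect_eq subsetI)
    ultimately show ?thesis using openin_trans_full openin_coord_box by metis
  qed
  moreover have "p \<in> P"
    using r Euclidean_space_zero[OF V p] by (auto simp: P_def coord_box_def q_def)
  moreover have "P \<subseteq> V" using r by (auto simp: P_def)
  moreover have "K \<subseteq> V"
  proof -
    have "x \<in> coord_box n p r" if "x \<in> K" for x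
    proof -
      have x: "x i \<in> (if i < n then {p i - s..p i + s} else {0})" for i
        using that K_iff by blast
      have "x i = 0" if "i \<ge> n" for i using x[of i] that by simp
      moreover have "\<bar>x i - p i\<bar> < r" if "i < n" for i using x[of i] that s by (auto simp: abs_if)
      ultimately show ?thesis by (simp add: coord_box_def)
    qed
    then show ?thesis using r by auto
  qed
  moreover have "compact K"
  proof -
    have "compactin (product_topology (\<lambda>_. euclidean) UNIV) K"
      unfolding K_def compactin_PiE by auto
    then show ?thesis by (simp add: euclidean_product_topology)
  qed
  moreover have "smooth_on n ?E (\<lambda>x. smooth_step (q x))"
    unfolding smooth_on_def using C_k_on_smooth_step[OF E q_smooth] by blast
  moreover have "\<forall>x. (\<forall>i\<ge>n. x i = 0) \<longrightarrow> x \<notin> K \<longrightarrow> smooth_step (q x) = 0"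
    using q_outside smooth_step_eq(2) by simp
  moreover have "\<forall>x\<in>P. smooth_step (q x) = 1"
    using smooth_step_eq(1) by (simp add: P_def)
  ultimately show thesis using that by blast
qed

section \<open>Smooth functions on the base\<close>

locale smooth_vector_bundle =
  fixes E :: "('m::{t2_space, second_countable_topology}, 'v::real_vector) vbundle"
  assumes vector_bundle: "vector_bundle E"
begin

abbreviation "n \<equiv> mdim E"

lemma
  assumes "(U, \<phi>) \<in> charts E"
  shows chart_open: "open U" and chart_openin: "openin (Euclidean_space n) (\<phi> ` U)"
    and chart_homeo: "homeomorphism U (\<phi> ` U) \<phi> (inv_into U \<phi>)"
    and chart_inv: "m \<in> U \<Longrightarrow> inv_into U \<phi> (\<phi> m) = m"
proof -
  have *: "\<forall>(U, \<phi>)\<in>charts E. open U \<and> openin (Euclidean_space n) (\<phi> ` U) \<and>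
       homeomorphism U (\<phi> ` U) \<phi> (inv_into U \<phi>)"
    using vector_bundle unfolding vector_bundle_def smooth_atlas_def by (elim conjE)
  show "open U" "openin (Euclidean_space n) (\<phi> ` U)" "homeomorphism U (\<phi> ` U) \<phi> (inv_into U \<phi>)"
    using bspec[OF * assms] by simp_all
  then show "m \<in> U \<Longrightarrow> inv_into U \<phi> (\<phi> m) = m"
    by (simp add: homeomorphism_def)
qed

lemma chart_exists: "\<exists>U \<phi>. (U, \<phi>) \<in> charts E \<and> m \<in> U"
proof -
  have "(\<Union>(U, \<phi>)\<in>charts E. U) = UNIV"
    using vector_bundle unfolding vector_bundle_def smooth_atlas_def by (elim conjE)
  then have "m \<in> (\<Union>(U, \<phi>)\<in>charts E. U)" by simp
  then show ?thesis by blast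
qed

lemma chart_transition:
  "(U, \<phi>) \<in> charts E \<Longrightarrow> (U', \<phi>') \<in> charts E \<Longrightarrow> i < n \<Longrightarrow>
    smooth_on n (\<phi> ` (U \<inter> U')) (\<lambda>x. \<phi>' (inv_into U \<phi> x) i)"
proof -
  have *: "\<forall>(U, \<phi>)\<in>charts E. \<forall>(U', \<phi>')\<in>charts E. \<forall>i<n.
       smooth_on n (\<phi> ` (U \<inter> U')) (\<lambda>x. \<phi>' (inv_into U \<phi> x) i)"
    using vector_bundle unfolding vector_bundle_def smooth_atlas_def by (elim conjE)
  assume "(U, \<phi>) \<in> charts E" "(U', \<phi>') \<in> charts E" "i < n"
  with * show ?thesis by fastforce
qed

lemma chart_image_openin:
  assumes "(U, \<phi>) \<in> charts E" "open W"
  shows "openin (Euclidean_space n) (\<phi> ` (U \<inter> W))"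
proof -
  have "openin (top_of_set (\<phi> ` U)) (\<phi> ` (U \<inter> W))"
    by (rule homeomorphism_imp_open_map[OF chart_homeo[OF assms(1)]]) (use assms in \<open>auto simp: openin_open_Int\<close>)
  moreover have "top_of_set (\<phi> ` U) = subtopology (Euclidean_space n) (\<phi> ` U)"
  proof -
    have "{x. \<forall>i\<ge>n. x i = 0} \<inter> \<phi> ` U = \<phi> ` U"
      using Euclidean_space_zero[OF chart_openin[OF assms(1)]] by blast
    then show ?thesis
      by (simp add: Euclidean_space_def euclidean_product_topology subtopology_subtopology)
  qed
  ultimately show ?thesis using openin_trans_full chart_openin[OF assms(1)] by metis
qed

lemma chart_preimage_open:
  assumes "(U, \<phi>) \<in> charts E" "openin (Euclidean_space n) V"
  shows "open (U \<inter> \<phi> -` V)"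
proof -
  obtain T where T: "open T" "V = T \<inter> {x. \<forall>i\<ge>n. x i = 0}"
    using assms(2) by (auto simp: openin_Euclidean_space_iff)
  have "U \<inter> \<phi> -` V = U \<inter> \<phi> -` T"
    using T Euclidean_space_zero[OF chart_openin[OF assms(1)]] by auto
  moreover have "continuous_on U \<phi>" using chart_homeo[OF assms(1)] by (simp add: homeomorphism_def)
  ultimately show ?thesis
    using continuous_open_preimage[OF _ chart_open[OF assms(1)] T(1)] by simp
qed

lemma smooth_funI:
  assumes "\<And>U \<phi> k. (U, \<phi>) \<in> charts E \<Longrightarrow> C_k_on n k (\<phi> ` (U \<inter> W)) (\<lambda>x. f (inv_into U \<phi> x))"
  shows "smooth_fun E W f"
  using assms by (auto simp: smooth_fun_def smooth_on_def)

lemma smooth_funD: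
  "smooth_fun E W f \<Longrightarrow> (U, \<phi>) \<in> charts E \<Longrightarrow> C_k_on n k (\<phi> ` (U \<inter> W)) (\<lambda>x. f (inv_into U \<phi> x))"
  by (auto simp: smooth_fun_def smooth_on_def)

lemma smooth_fun_cong:
  assumes "open W" "\<And>m. m \<in> W \<Longrightarrow> f m = g m" "smooth_fun E W f"
  shows "smooth_fun E W g"
proof (rule smooth_funI)
  fix U \<phi> k assume c: "(U, \<phi>) \<in> charts E"
  show "C_k_on n k (\<phi> ` (U \<inter> W)) (\<lambda>x. g (inv_into U \<phi> x))"
    by (rule C_k_on_cong[OF chart_image_openin[OF c assms(1)] _ smooth_funD[OF assms(3) c]])
      (use assms(2) chart_inv[OF c] in auto)
qed

lemma smooth_fun_subset: "smooth_fun E W f \<Longrightarrow> W' \<subseteq> W \<Longrightarrow> smooth_fun E W' f"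
  by (rule smooth_funI) (rule C_k_on_subset[OF smooth_funD], auto)

lemma smooth_fun_local:
  assumes "open W" "\<And>m. m \<in> W \<Longrightarrow> \<exists>W'. m \<in> W' \<and> open W' \<and> smooth_fun E W' f"
  shows "smooth_fun E W f"
proof (rule smooth_funI)
  fix U \<phi> k assume c: "(U, \<phi>) \<in> charts E"
  show "C_k_on n k (\<phi> ` (U \<inter> W)) (\<lambda>x. f (inv_into U \<phi> x))"
  proof (rule C_k_on_local[OF chart_image_openin[OF c assms(1)]])
    fix x assume "x \<in> \<phi> ` (U \<inter> W)"
    then obtain m where m: "m \<in> U" "m \<in> W" "x = \<phi> m" by auto
    then obtain W' where W': "m \<in> W'" "open W'" "smooth_fun E W' f" using assms(2) by blast
    have "smooth_fun E (W \<inter> W') f" by (rule smooth_fun_subset[OF W'(3)]) auto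
    from smooth_funD[OF this c, of k] chart_image_openin[OF c open_Int[OF assms(1) W'(2)]]
    show "\<exists>V'. x \<in> V' \<and> openin (Euclidean_space n) V' \<and> V' \<subseteq> \<phi> ` (U \<inter> W) \<and> C_k_on n k V' (\<lambda>x. f (inv_into U \<phi> x))"
      by (intro exI[of _ "\<phi> ` (U \<inter> (W \<inter> W'))"]) (use m W' in auto)
  qed
qed

lemma smooth_fun_const: "open W \<Longrightarrow> smooth_fun E W (\<lambda>_. c)"
  by (rule smooth_funI) (rule C_k_on_const[OF chart_image_openin])

lemma smooth_fun_add: "open W \<Longrightarrow> smooth_fun E W f \<Longrightarrow> smooth_fun E W g \<Longrightarrow> smooth_fun E W (\<lambda>m. f m + g m)"
  by (rule smooth_funI) (rule C_k_on_add[OF chart_image_openin smooth_funD smooth_funD])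

lemma smooth_fun_mult: "open W \<Longrightarrow> smooth_fun E W f \<Longrightarrow> smooth_fun E W g \<Longrightarrow> smooth_fun E W (\<lambda>m. f m * g m)"
  by (rule smooth_funI) (rule C_k_on_mult[OF chart_image_openin smooth_funD smooth_funD])

lemma smooth_fun_sum:
  "open W \<Longrightarrow> (\<And>a. a \<in> A \<Longrightarrow> smooth_fun E W (f a)) \<Longrightarrow> smooth_fun E W (\<lambda>m. \<Sum>a\<in>A. f a m)"
  by (induction A rule: infinite_finite_induct) (auto intro: smooth_fun_const smooth_fun_add)

text \<open>
  A function that is smooth in one chart is smooth in all of them: the coordinate change is smooth
  by the definition of an atlas, and compositions of \<open>C\<^sup>k\<close> functions are \<open>C\<^sup>k\<close>.
\<close>

lemma smooth_fun_chart:
  assumes c: "(U, \<phi>) \<in> charts E" and W: "open W" "W \<subseteq> U"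
    and g: "\<And>k. C_k_on n k V g" "openin (Euclidean_space n) V" "\<phi> ` W \<subseteq> V"
  shows "smooth_fun E W (\<lambda>m. g (\<phi> m))"
proof (rule smooth_funI)
  fix U' \<phi>' k assume c': "(U', \<phi>') \<in> charts E"
  show "C_k_on n k (\<phi>' ` (U' \<inter> W)) (\<lambda>x. g (\<phi> (inv_into U' \<phi>' x)))"
  proof (rule C_k_on_compose[OF chart_image_openin[OF c' W(1)] g(2) _ g(1)])
    show "\<phi> (inv_into U' \<phi>' x) \<in> V" if "x \<in> \<phi>' ` (U' \<inter> W)" for x
      using that chart_inv[OF c'] g(3) by auto
    fix j assume "j < n"
    then have "C_k_on n k (\<phi>' ` (U' \<inter> U)) (\<lambda>x. \<phi> (inv_into U' \<phi>' x) j)"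
      using chart_transition[OF c' c] by (simp add: smooth_on_def)
    then show "C_k_on n k (\<phi>' ` (U' \<inter> W)) (\<lambda>x. \<phi> (inv_into U' \<phi>' x) j)"
      by (rule C_k_on_subset) (use W in auto)
  qed
qed

text \<open>
  The bump function of a chart is extended by zero.  The extension is smooth because the support in
  the chart is compact, hence closed in the Hausdorff space \<open>M\<close>.  The open sets \<open>C\<close>, where the extension vanishes, and \<open>W\<close>
  cover the base; this makes the product of the bump function with anything smooth on \<open>W\<close> smooth
  everywhere.
\<close>

lemma bump:
  assumes "open W" "m \<in> W"
  obtains \<beta> A C where "smooth_fun E UNIV \<beta>" "open A" "m \<in> A" "A \<subseteq> W" "\<forall>m'\<in>A. \<beta> m' = 1"
    "open C" "C \<union> W = UNIV" "\<forall>m'\<in>C. \<beta> m' = 0"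
proof -
  obtain U \<phi> where c: "(U, \<phi>) \<in> charts E" and mU: "m \<in> U" using chart_exists by blast
  let ?V = "\<phi> ` (U \<inter> W)"
  have V: "openin (Euclidean_space n) ?V" using chart_image_openin[OF c assms(1)] .
  have "\<phi> m \<in> ?V" using mU assms by auto
  then obtain g K P where g: "smooth_on n {x. \<forall>i\<ge>n. x i = 0} g" "compact K" "K \<subseteq> ?V"
      "\<forall>x. (\<forall>i\<ge>n. x i = 0) \<longrightarrow> x \<notin> K \<longrightarrow> g x = 0"
    and P: "openin (Euclidean_space n) P" "\<phi> m \<in> P" "P \<subseteq> ?V" "\<forall>x\<in>P. g x = 1"
    by (rule bump_Euclidean[OF V]) (rule that)
  define \<beta> where "\<beta> m' = (if m' \<in> U then g (\<phi> m') else 0)" for m'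
  define C where "C = - (inv_into U \<phi> ` K)"
  define A where "A = U \<inter> \<phi> -` P"
  have "continuous_on K (inv_into U \<phi>)"
    using chart_homeo[OF c] g(3) by (auto simp: homeomorphism_def intro: continuous_on_subset)
  then have "compact (inv_into U \<phi> ` K)" using g(2) by (rule compact_continuous_image)
  then have C: "open C" unfolding C_def by (intro open_Compl compact_imp_closed)
  have CW: "inv_into U \<phi> ` K \<subseteq> U \<inter> W" using g(3) chart_inv[OF c] by auto
  have \<beta>C: "\<beta> m' = 0" if "m' \<in> C" for m'
  proof (cases "m' \<in> U")
    case True
    then have "\<phi> m' \<notin> K" using that chart_inv[OF c, of m'] by (force simp: C_def)
    then show ?thesis using g(4) Euclidean_space_zero[OF chart_openin[OF c]] True by (simp add: \<beta>_def)
  qed (simp add: \<beta>_def)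
  have "smooth_fun E UNIV \<beta>"
  proof (rule smooth_fun_local)
    fix m' :: 'm
    consider "m' \<in> U" | "m' \<in> C" using CW by (auto simp: C_def)
    then show "\<exists>W'. m' \<in> W' \<and> open W' \<and> smooth_fun E W' \<beta>"
    proof cases
      case 1
      have "smooth_fun E U (\<lambda>m. g (\<phi> m))"
      proof (rule smooth_fun_chart[OF c chart_open[OF c]])
        show "C_k_on n k {x. \<forall>i\<ge>n. x i = 0} g" for k using g(1) by (simp add: smooth_on_def)
        show "openin (Euclidean_space n) {x. \<forall>i\<ge>n. x i = 0}" by (auto simp: openin_Euclidean_space_iff)
      qed (use Euclidean_space_zero[OF chart_openin[OF c]] in auto)
      then have "smooth_fun E U \<beta>"
        by (rule smooth_fun_cong[OF chart_open[OF c], rotated]) (simp add: \<beta>_def)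
      then show ?thesis using 1 chart_open[OF c] by blast
    next
      case 2
      have "smooth_fun E C \<beta>"
        by (rule smooth_fun_cong[OF C _ smooth_fun_const[OF C, of 0]]) (simp add: \<beta>C)
      then show ?thesis using 2 C by blast
    qed
  qed simp
  moreover have "open A" unfolding A_def by (rule chart_preimage_open[OF c P(1)])
  moreover have "m \<in> A" using mU P by (simp add: A_def)
  moreover have "A \<subseteq> W"
  proof
    fix m' assume "m' \<in> A"
    then obtain w where "m' \<in> U" "w \<in> U" "w \<in> W" "\<phi> m' = \<phi> w" using P(3) by (auto simp: A_def)
    then show "m' \<in> W" using chart_inv[OF c] by metis
  qed
  moreover have "\<forall>m'\<in>A. \<beta> m' = 1" using P(4) by (simp add: A_def \<beta>_def)
  moreover have "C \<union> W = UNIV" using CW by (auto simp: C_def)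
  ultimately show thesis using \<beta>C C that by blast
qed

end

section \<open>Local frames and the module of sections\<close>

lemma sum_fun_apply: "(\<Sum>i\<in>I. f i) x = (\<Sum>i\<in>I. f i x)"
  by (induction I rule: infinite_finite_induct) simp_all

lemma subspace_lincombI:
  assumes "x \<in> V" "\<And>x y a b. x \<in> V \<Longrightarrow> y \<in> V \<Longrightarrow> a *\<^sub>R x + b *\<^sub>R y \<in> V"
  shows "subspace V"
proof -
  have "0 \<in> V" using assms(2)[OF assms(1) assms(1), of 0 0] by simp
  moreover have "x + y \<in> V" if "x \<in> V" "y \<in> V" for x y using assms(2)[OF that, of 1 1] by simp
  moreover have "c *\<^sub>R x \<in> V" if "x \<in> V" for x c using assms(2)[OF that that, of c 0] by simp
  ultimately show ?thesis by (simp add: subspace_def)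
qed

context smooth_vector_bundle
begin

abbreviation "rk \<equiv> rnk E"

lemma fib_subspace: "subspace (fib E m)"
proof -
  have "\<forall>m. subspace (fib E m)"
    using vector_bundle unfolding vector_bundle_def by (elim conjE)
  then show ?thesis by simp
qed

lemma frame_exists: "\<exists>W e. (W, e) \<in> frames E \<and> m \<in> W"
proof -
  have "(\<Union>(W, e)\<in>frames E. W) = UNIV"
    using vector_bundle unfolding vector_bundle_def by (elim conjE)
  then have "m \<in> (\<Union>(W, e)\<in>frames E. W)" by simp
  then show ?thesis by blast
qed

lemma
  assumes "(W, e) \<in> frames E"
  shows frame_open: "open W"
    and frame_inj: "m \<in> W \<Longrightarrow> inj_on (\<lambda>a. e a m) {..<rk}"
    and frame_independent: "m \<in> W \<Longrightarrow> independent ((\<lambda>a. e a m) ` {..<rk})"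
    and frame_span: "m \<in> W \<Longrightarrow> span ((\<lambda>a. e a m) ` {..<rk}) = fib E m"
proof -
  have *: "\<forall>(W, e)\<in>frames E. open W \<and>
       (\<forall>m\<in>W. inj_on (\<lambda>a. e a m) {..<rnk E} \<and>
              independent ((\<lambda>a. e a m) ` {..<rnk E}) \<and>
              span ((\<lambda>a. e a m) ` {..<rnk E}) = fib E m)"
    using vector_bundle unfolding vector_bundle_def by (elim conjE)
  show "open W" "m \<in> W \<Longrightarrow> inj_on (\<lambda>a. e a m) {..<rk}"
    "m \<in> W \<Longrightarrow> independent ((\<lambda>a. e a m) ` {..<rk})"
    "m \<in> W \<Longrightarrow> span ((\<lambda>a. e a m) ` {..<rk}) = fib E m"
    using bspec[OF * assms] by simp_all
qed

lemma frame_transition: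
  assumes "(W, e) \<in> frames E" "(W', e') \<in> frames E" "a < rk" "b < rk"
  shows "smooth_fun E (W \<inter> W') (frame_comp E e (e' a) b)"
proof -
  have *: "\<forall>(W, e)\<in>frames E. \<forall>(W', e')\<in>frames E. \<forall>a<rnk E. \<forall>b<rnk E.
       smooth_fun E (W \<inter> W') (frame_comp E e (e' a) b)"
    using vector_bundle unfolding vector_bundle_def by (elim conjE)
  from bspec[OF this assms(1)] have "\<forall>(W', e')\<in>frames E. \<forall>a<rnk E. \<forall>b<rnk E.
       smooth_fun E (W \<inter> W') (frame_comp E e (e' a) b)" by simp
  from bspec[OF this assms(2)] assms(3,4) show ?thesis by simp
qed

lemma frame_mem_fib: "(W, e) \<in> frames E \<Longrightarrow> m \<in> W \<Longrightarrow> a < rk \<Longrightarrow> e a m \<in> fib E m"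
  by (subst frame_span[symmetric]) (auto intro: span_base)

lemma frame_expand:
  assumes f: "(W, e) \<in> frames E" and m: "m \<in> W" and u: "u m \<in> fib E m"
  shows "u m = (\<Sum>a<rk. frame_comp E e u a m *\<^sub>R e a m)"
proof -
  let ?B = "(\<lambda>a. e a m) ` {..<rk}"
  have "(\<Sum>b\<in>?B. representation ?B (u m) b *\<^sub>R b) = u m"
    by (rule real_vector.sum_representation_eq) (use frame_independent[OF f m] frame_span[OF f m] u in auto)
  then show ?thesis
    by (simp add: sum.reindex[OF frame_inj[OF f m]] frame_comp_def)
qed

lemma frame_comp_eqI:
  assumes f: "(W, e) \<in> frames E" and m: "m \<in> W" and u: "u m = (\<Sum>a<rk. c a *\<^sub>R e a m)" and a: "a < rk"
  shows "frame_comp E e u a m = c a"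
proof -
  let ?B = "(\<lambda>a. e a m) ` {..<rk}"
  note ind = frame_independent[OF f m]
  have sp: "e b m \<in> span ?B" if "b < rk" for b using that by (auto intro: span_base)
  have "representation ?B (u m) (e a m) = (\<Sum>b<rk. representation ?B (c b *\<^sub>R e b m) (e a m))"
    unfolding u by (subst real_vector.representation_sum[OF ind]) (use sp span_scale in auto)
  also have "\<dots> = (\<Sum>b<rk. if b = a then c b else 0)"
  proof (rule sum.cong[OF refl])
    fix b assume "b \<in> {..<rk}"
    then have b: "b < rk" by simp
    have "representation ?B (e b m) = (\<lambda>v. if v = e b m then 1 else 0)"
      by (rule real_vector.representation_basis[OF ind]) (use b in auto)
    moreover have "e a m = e b m \<longleftrightarrow> b = a"
      using frame_inj[OF f m] a b by (auto simp: inj_on_def)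
    ultimately show "representation ?B (c b *\<^sub>R e b m) (e a m) = (if b = a then c b else 0)"
      by (subst real_vector.representation_scale[OF ind sp[OF b]]) auto
  qed
  also have "\<dots> = c a" using a by simp
  finally show ?thesis by (simp add: frame_comp_def)
qed

lemma frame_comp_at_cong: "u m = v m \<Longrightarrow> frame_comp E e u a m = frame_comp E e v a m"
  by (simp add: frame_comp_def)

lemma frame_comp_add:
  assumes "(W, e) \<in> frames E" "m \<in> W" "a < rk" "u m \<in> fib E m" "v m \<in> fib E m"
  shows "frame_comp E e (u + v) a m = frame_comp E e u a m + frame_comp E e v a m"
  by (rule frame_comp_eqI[OF assms(1,2) _ assms(3), of _ "\<lambda>a. frame_comp E e u a m + frame_comp E e v a m"])
    (use frame_expand[OF assms(1,2), of u, OF assms(4)] frame_expand[OF assms(1,2), of v, OF assms(5)] in \<open>simp add: scaleR_add_left sum.distrib\<close>)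

lemma frame_comp_fmult:
  assumes "(W, e) \<in> frames E" "m \<in> W" "a < rk" "u m \<in> fib E m"
  shows "frame_comp E e (fmult f u) a m = f m * frame_comp E e u a m"
proof (rule frame_comp_eqI[OF assms(1,2) _ assms(3), of _ "\<lambda>a. f m * frame_comp E e u a m"])
  show "fmult f u m = (\<Sum>a<rk. (f m * frame_comp E e u a m) *\<^sub>R e a m)"
    using arg_cong[OF frame_expand[OF assms(1,2), of u, OF assms(4)], of "scaleR (f m)"]
    by (simp add: fmult_def scaleR_sum_right)
qed

lemma Gamma_fib: "u \<in> Gamma E \<Longrightarrow> u m \<in> fib E m"
  by (simp add: Gamma_def)

lemma Gamma_smooth: "u \<in> Gamma E \<Longrightarrow> (W, e) \<in> frames E \<Longrightarrow> a < rk \<Longrightarrow> smooth_fun E W (frame_comp E e u a)"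
  by (auto simp: Gamma_def)

lemma GammaI:
  assumes "\<And>m. u m \<in> fib E m"
    and "\<And>W e a. (W, e) \<in> frames E \<Longrightarrow> a < rk \<Longrightarrow> smooth_fun E W (frame_comp E e u a)"
  shows "u \<in> Gamma E"
  using assms by (auto simp: Gamma_def)

text \<open>
  Near each point, smoothness in a single frame suffices, because the components in another frame
  are obtained by multiplication with the smooth transition matrix.
\<close>

lemma Gamma_localI:
  assumes fib: "\<And>m. u m \<in> fib E m"
    and loc: "\<And>m. \<exists>W e O'. (W, e) \<in> frames E \<and> open O' \<and> m \<in> O' \<and> O' \<subseteq> W \<and>
      (\<forall>a<rk. smooth_fun E O' (frame_comp E e u a))"
  shows "u \<in> Gamma E"
proof -
  have "smooth_fun E W' (frame_comp E e' u b)" if f': "(W', e') \<in> frames E" and b: "b < rk" for W' e' b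
  proof (rule smooth_fun_local[OF frame_open[OF f']])
    fix m assume m: "m \<in> W'"
    obtain W e O' where f: "(W, e) \<in> frames E" and O': "open O'" "m \<in> O'" "O' \<subseteq> W"
      and sm: "\<forall>a<rk. smooth_fun E O' (frame_comp E e u a)"
      using loc[of m] by blast
    let ?S = "O' \<inter> W'"
    have S: "open ?S" using O' frame_open[OF f'] by auto
    have "smooth_fun E ?S (\<lambda>m. \<Sum>a<rk. frame_comp E e u a m * frame_comp E e' (e a) b m)"
    proof (intro smooth_fun_sum[OF S] smooth_fun_mult[OF S])
      fix a assume a: "a \<in> {..<rk}"
      show "smooth_fun E ?S (frame_comp E e u a)"
        by (rule smooth_fun_subset[of O']) (use sm a in simp_all)
      have "a < rk" using a by simp
      from frame_transition[OF f' f this b] show "smooth_fun E ?S (frame_comp E e' (e a) b)"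
        by (rule smooth_fun_subset) (use O'(3) in blast)
    qed
    then have "smooth_fun E ?S (frame_comp E e' u b)"
    proof (rule smooth_fun_cong[OF S, rotated])
      fix m assume m: "m \<in> ?S"
      then have mW: "m \<in> W" "m \<in> W'" using O' by auto
      have "frame_comp E e' u b m = (\<Sum>a<rk. frame_comp E e u a m * frame_comp E e' (e a) b m)"
      proof (rule frame_comp_eqI[OF f' mW(2) _ b, of _ "\<lambda>b. \<Sum>a<rk. frame_comp E e u a m * frame_comp E e' (e a) b m"])
        have "u m = (\<Sum>a<rk. frame_comp E e u a m *\<^sub>R (\<Sum>b<rk. frame_comp E e' (e a) b m *\<^sub>R e' b m))"
          unfolding frame_expand[OF f mW(1), of u, OF fib]
        proof (rule sum.cong[OF refl])
          fix a assume "a \<in> {..<rk}"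
          then have "e a m \<in> fib E m" using frame_mem_fib[OF f mW(1)] by simp
          then show "frame_comp E e u a m *\<^sub>R e a m = frame_comp E e u a m *\<^sub>R (\<Sum>b<rk. frame_comp E e' (e a) b m *\<^sub>R e' b m)"
            by (rule arg_cong[OF frame_expand[OF f' mW(2)]])
        qed
        also have "\<dots> = (\<Sum>a<rk. \<Sum>b<rk. (frame_comp E e u a m * frame_comp E e' (e a) b m) *\<^sub>R e' b m)"
          by (simp only: scaleR_sum_right scaleR_scaleR)
        also have "\<dots> = (\<Sum>b<rk. (\<Sum>a<rk. frame_comp E e u a m * frame_comp E e' (e a) b m) *\<^sub>R e' b m)"
          unfolding scaleR_sum_left by (rule sum.swap)
        finally show "u m = (\<Sum>b<rk. (\<Sum>a<rk. frame_comp E e u a m * frame_comp E e' (e a) b m) *\<^sub>R e' b m)" .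
      qed
      then show "(\<Sum>a<rk. frame_comp E e u a m * frame_comp E e' (e a) b m) = frame_comp E e' u b m" by (rule sym)
    qed
    then show "\<exists>S. m \<in> S \<and> open S \<and> smooth_fun E S (frame_comp E e' u b)"
      using S m O'(2) by (intro exI[of _ ?S]) simp
  qed
  then show ?thesis by (rule GammaI[OF fib])
qed

lemma C_infinity_iff: "f \<in> C_infinity E \<longleftrightarrow> smooth_fun E UNIV f"
  by (simp add: C_infinity_def)

lemma C_infinity_const: "(\<lambda>_. c) \<in> C_infinity E"
  by (simp add: C_infinity_iff smooth_fun_const)

lemma C_infinity_add: "f \<in> C_infinity E \<Longrightarrow> g \<in> C_infinity E \<Longrightarrow> f + g \<in> C_infinity E"
  using smooth_fun_add[of UNIV f g] by (simp add: C_infinity_iff plus_fun_def)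

lemma C_infinity_mult: "f \<in> C_infinity E \<Longrightarrow> g \<in> C_infinity E \<Longrightarrow> f * g \<in> C_infinity E"
  using smooth_fun_mult[of UNIV f g] by (simp add: C_infinity_iff times_fun_def)

lemma C_infinity_scaleR: "f \<in> C_infinity E \<Longrightarrow> c *\<^sub>R f \<in> C_infinity E"
  using smooth_fun_mult[of UNIV "\<lambda>_. c" f] smooth_fun_const[of UNIV c] by (simp add: C_infinity_iff scaleR_fun_def)

lemma C_infinity_subspace: "subspace (C_infinity E)"
  using C_infinity_const[of 0] by (simp add: subspace_def C_infinity_add C_infinity_scaleR zero_fun_def)

lemma C_infinity_smooth: "f \<in> C_infinity E \<Longrightarrow> smooth_fun E W f"
  using smooth_fun_subset[of UNIV f W] by (simp add: C_infinity_iff)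

lemma Gamma_fmult:
  assumes f: "f \<in> C_infinity E" and u: "u \<in> Gamma E" shows "fmult f u \<in> Gamma E"
proof (rule GammaI)
  show "fmult f u m \<in> fib E m" for m
    using fib_subspace Gamma_fib[OF u] by (simp add: fmult_def subspace_scale)
  fix W e a assume fr: "(W, e) \<in> frames E" and a: "a < rk"
  note W = frame_open[OF fr]
  show "smooth_fun E W (frame_comp E e (fmult f u) a)"
    by (rule smooth_fun_cong[OF W _ smooth_fun_mult[OF W C_infinity_smooth[OF f] Gamma_smooth[OF u fr a]]])
      (simp add: frame_comp_fmult[OF fr _ a Gamma_fib[OF u]])
qed

lemma Gamma_add:
  assumes u: "u \<in> Gamma E" and v: "v \<in> Gamma E" shows "u + v \<in> Gamma E"
proof (rule GammaI)
  show "(u + v) m \<in> fib E m" for m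
    using fib_subspace Gamma_fib[OF u] Gamma_fib[OF v] by (simp add: subspace_add)
  fix W e a assume fr: "(W, e) \<in> frames E" and a: "a < rk"
  note W = frame_open[OF fr]
  show "smooth_fun E W (frame_comp E e (u + v) a)"
    by (rule smooth_fun_cong[OF W _ smooth_fun_add[OF W Gamma_smooth[OF u fr a] Gamma_smooth[OF v fr a]]])
      (simp add: frame_comp_add[OF fr _ a Gamma_fib[OF u] Gamma_fib[OF v]])
qed

lemma scaleR_eq_fmult: "c *\<^sub>R u = fmult (\<lambda>_. c) u"
  by (simp add: fmult_def fun_eq_iff)

lemma Gamma_0: "0 \<in> Gamma E"
proof (rule GammaI)
  show "0 m \<in> fib E m" for m using fib_subspace by (simp add: subspace_0)
  fix W e a assume fr: "(W, e) \<in> frames E" and a: "a < rk"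
  show "smooth_fun E W (frame_comp E e 0 a)"
    by (rule smooth_fun_cong[OF frame_open[OF fr] _ smooth_fun_const[OF frame_open[OF fr], of 0]])
      (use frame_comp_eqI[OF fr _ _ a, of _ 0 "\<lambda>_. 0"] in simp)
qed

lemma frame_comp_lincomb:
  assumes fr: "(W, e) \<in> frames E" "m \<in> W" "a < rk" and u: "u \<in> Gamma E" and v: "v \<in> Gamma E"
  shows "frame_comp E e (s *\<^sub>R u + t *\<^sub>R v) a m = s * frame_comp E e u a m + t * frame_comp E e v a m"
proof -
  have "fmult (\<lambda>_. s) u m \<in> fib E m" "fmult (\<lambda>_. t) v m \<in> fib E m"
    using Gamma_fib[OF u] Gamma_fib[OF v] fib_subspace by (simp_all add: fmult_def subspace_scale)
  then show ?thesis
    using frame_comp_add[OF fr, of "fmult (\<lambda>_. s) u" "fmult (\<lambda>_. t) v"]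
      frame_comp_fmult[where u = u and f = "\<lambda>_. s", OF fr Gamma_fib[OF u]]
      frame_comp_fmult[where u = v and f = "\<lambda>_. t", OF fr Gamma_fib[OF v]]
    by (simp only: scaleR_eq_fmult)
qed

lemma Gamma_subspace: "subspace (Gamma E)"
  unfolding subspace_def
  using Gamma_0 Gamma_add Gamma_fmult[OF C_infinity_const] by (auto simp: scaleR_eq_fmult)

lemma C_infinity_cutoff:
  assumes b: "\<beta> \<in> C_infinity E" and C: "open C" "C \<union> W = UNIV" "\<forall>m\<in>C. \<beta> m = 0"
    and W: "open W" "smooth_fun E W f"
  shows "(\<lambda>m. \<beta> m * f m) \<in> C_infinity E"
  unfolding C_infinity_iff
proof (rule smooth_fun_local)
  fix m :: 'm
  consider "m \<in> C" | "m \<in> W" using C by auto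
  then show "\<exists>W'. m \<in> W' \<and> open W' \<and> smooth_fun E W' (\<lambda>m. \<beta> m * f m)"
  proof cases
    case 1
    then show ?thesis
      using smooth_fun_cong[OF C(1) _ smooth_fun_const[OF C(1), of 0], of "\<lambda>m. \<beta> m * f m"] C by auto
  next
    case 2
    then show ?thesis using smooth_fun_mult[OF W(1) C_infinity_smooth[OF b] W(2)] W(1) by blast
  qed
qed simp

lemma Gamma_cutoff:
  assumes fr: "(W, e) \<in> frames E" and W': "open W'" "W' \<subseteq> W"
    and C: "open C" "C \<union> W' = UNIV" "\<And>m. m \<in> C \<Longrightarrow> u m = 0"
    and u: "\<And>m. m \<in> W' \<Longrightarrow> u m = (\<Sum>a<rk. f a m *\<^sub>R e a m)" "\<And>a. a < rk \<Longrightarrow> smooth_fun E W' (f a)"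
  shows "u \<in> Gamma E"
proof (rule Gamma_localI)
  fix m
  consider "m \<in> C" | "m \<in> W'" using C by auto
  note cases_m = this
  show "u m \<in> fib E m"
    using cases_m
  proof cases
    case 1
    then show ?thesis using C fib_subspace by (simp add: subspace_0)
  next
    case 2
    then have "\<forall>a<rk. e a m \<in> fib E m" using frame_mem_fib[OF fr] W' by blast
    then show ?thesis using u(1)[OF 2] fib_subspace by (auto intro!: subspace_sum subspace_scale)
  qed
  show "\<exists>W e O'. (W, e) \<in> frames E \<and> open O' \<and> m \<in> O' \<and> O' \<subseteq> W \<and>
      (\<forall>a<rk. smooth_fun E O' (frame_comp E e u a))"
    using cases_m
  proof cases
    case 1
    obtain W1 e1 where fr1: "(W1, e1) \<in> frames E" "m \<in> W1" using frame_exists by blast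
    have o: "open (C \<inter> W1)" using C frame_open[OF fr1(1)] by auto
    have "smooth_fun E (C \<inter> W1) (frame_comp E e1 u a)" if "a < rk" for a
      by (rule smooth_fun_cong[OF o _ smooth_fun_const[OF o, of 0]])
        (use frame_comp_eqI[OF fr1(1) _ _ that, of _ u "\<lambda>_. 0"] C(3) in simp)
    then show ?thesis using o 1 fr1 by blast
  next
    case 2
    have "smooth_fun E W' (frame_comp E e u a)" if a: "a < rk" for a
    proof (rule smooth_fun_cong[OF W'(1) _ u(2)[OF a]])
      fix m assume m: "m \<in> W'"
      show "f a m = frame_comp E e u a m"
        using frame_comp_eqI[OF fr, of m u "\<lambda>a. f a m" a] u(1)[OF m] a m W' by auto
    qed
    then show ?thesis using 2 fr W'(1,2) by (intro exI[of _ W] exI[of _ e] exI[of _ W']) simp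
  qed
qed

lemma Gamma_fmult_frame:
  assumes fr: "(W, e) \<in> frames E" and b: "\<beta> \<in> C_infinity E" and W0: "open W0" "W0 \<subseteq> W"
    and C: "open C" "C \<union> W0 = UNIV" "\<forall>m\<in>C. \<beta> m = 0" and a: "a < rk"
  shows "fmult \<beta> (e a) \<in> Gamma E"
proof (rule Gamma_cutoff[OF fr W0 C(1,2), where f = "\<lambda>b m. if b = a then \<beta> m else 0"])
  show "fmult \<beta> (e a) m = 0" if "m \<in> C" for m using C(3) that by (simp add: fmult_def)
  show "fmult \<beta> (e a) m = (\<Sum>b<rk. (if b = a then \<beta> m else 0) *\<^sub>R e b m)" for m
    using a by (simp add: fmult_def if_distrib[of "\<lambda>x. x *\<^sub>R _"] cong: if_cong)
  show "smooth_fun E W0 (\<lambda>m. if b = a then \<beta> m else 0)" for b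
    using C_infinity_smooth[OF b] smooth_fun_const[OF W0(1)] by (cases "b = a") simp_all
qed

definition chart_partial :: "'m set \<Rightarrow> ('m \<Rightarrow> nat \<Rightarrow> real) \<Rightarrow> nat \<Rightarrow> ('m \<Rightarrow> real) \<Rightarrow> 'm \<Rightarrow> real"
  where "chart_partial U \<phi> i f m = partial_deriv i (\<lambda>x. f (inv_into U \<phi> x)) (\<phi> m)"

context
  fixes U W :: "'m set" and \<phi> :: "'m \<Rightarrow> nat \<Rightarrow> real" and i :: nat
  assumes c: "(U, \<phi>) \<in> charts E" and W: "open W" and i: "i < n"
begin

lemma chart_partial_has_derivative:
  assumes "smooth_fun E W f" "m \<in> U \<inter> W"
  shows "((\<lambda>t. f (inv_into U \<phi> ((\<phi> m)(i := t)))) has_real_derivative chart_partial U \<phi> i f m) (at (\<phi> m i))"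
  unfolding chart_partial_def using C_k_on_imp_partial[OF smooth_funD[OF assms(1) c] i] assms(2) by simp

lemma chart_partial_eqI:
  "((\<lambda>t. f (inv_into U \<phi> ((\<phi> m)(i := t)))) has_real_derivative D) (at (\<phi> m i)) \<Longrightarrow> chart_partial U \<phi> i f m = D"
  unfolding chart_partial_def by (rule partial_derivI)

lemma chart_partial_add:
  assumes "smooth_fun E W f" "smooth_fun E W g" "m \<in> U \<inter> W"
  shows "chart_partial U \<phi> i (\<lambda>m. f m + g m) m = chart_partial U \<phi> i f m + chart_partial U \<phi> i g m"
  by (rule chart_partial_eqI)
    (rule DERIV_add[OF chart_partial_has_derivative[OF assms(1,3)] chart_partial_has_derivative[OF assms(2,3)]])

lemma chart_partial_mult:
  assumes "smooth_fun E W f" "smooth_fun E W g" "m \<in> U \<inter> W"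
  shows "chart_partial U \<phi> i (\<lambda>m. f m * g m) m = f m * chart_partial U \<phi> i g m + chart_partial U \<phi> i f m * g m"
proof (rule chart_partial_eqI)
  have "inv_into U \<phi> ((\<phi> m)(i := \<phi> m i)) = m" using chart_inv[OF c] assms(3) by simp
  with DERIV_mult[OF chart_partial_has_derivative[OF assms(1,3)] chart_partial_has_derivative[OF assms(2,3)]]
  show "((\<lambda>t. f (inv_into U \<phi> ((\<phi> m)(i := t))) * g (inv_into U \<phi> ((\<phi> m)(i := t)))) has_real_derivative
    f m * chart_partial U \<phi> i g m + chart_partial U \<phi> i f m * g m) (at (\<phi> m i))"
    by (simp only: mult.commute add.commute)
qed

lemma chart_partial_cong:
  assumes "\<And>m. m \<in> W \<Longrightarrow> f m = g m" "m \<in> U \<inter> W"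
  shows "chart_partial U \<phi> i f m = chart_partial U \<phi> i g m"
  unfolding chart_partial_def
  by (rule partial_deriv_cong[OF chart_image_openin[OF c W] _ i])
    (use assms chart_inv[OF c] in auto)

lemma chart_partial_const: "chart_partial U \<phi> i (\<lambda>_. c) m = 0"
  by (rule chart_partial_eqI) simp

lemma chart_partial_lincomb:
  assumes f: "smooth_fun E W f" and g: "smooth_fun E W g" and m: "m \<in> U \<inter> W"
  shows "chart_partial U \<phi> i (\<lambda>m. s * f m + t * g m) m = s * chart_partial U \<phi> i f m + t * chart_partial U \<phi> i g m"
  using chart_partial_add[OF smooth_fun_mult[OF W smooth_fun_const[OF W, of s] f]
      smooth_fun_mult[OF W smooth_fun_const[OF W, of t] g] m]
    chart_partial_mult[OF smooth_fun_const[OF W, of s] f m]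
    chart_partial_mult[OF smooth_fun_const[OF W, of t] g m]
  by (simp add: chart_partial_const)

lemma chart_partial_smooth:
  assumes "smooth_fun E W f"
  shows "smooth_fun E (U \<inter> W) (chart_partial U \<phi> i f)"
  unfolding chart_partial_def
proof (rule smooth_fun_chart[OF c _ _ _ chart_image_openin[OF c W]])
  show "C_k_on n k (\<phi> ` (U \<inter> W)) (partial_deriv i (\<lambda>x. f (inv_into U \<phi> x)))" for k
    using smooth_funD[OF assms c, of "Suc k"] i by simp
qed (use chart_open[OF c] W in auto)

end

section \<open>Derivations are first-order differential operators\<close>

lemma vector_fieldI:
  assumes "\<And>f. f \<in> C_infinity E \<Longrightarrow> X f \<in> C_infinity E"
    and "\<And>f g a b. f \<in> C_infinity E \<Longrightarrow> g \<in> C_infinity E \<Longrightarrow> X (a *\<^sub>R f + b *\<^sub>R g) = a *\<^sub>R X f + b *\<^sub>R X g"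
    and "\<And>f g. f \<in> C_infinity E \<Longrightarrow> g \<in> C_infinity E \<Longrightarrow> X (f * g) = f * X g + g * X f"
  shows "vector_field E X"
  using assms by (simp add: vector_field_def)

lemma gauge_derivationsI:
  assumes "\<And>u. u \<in> Gamma E \<Longrightarrow> d u \<in> Gamma E" "\<And>u. u \<notin> Gamma E \<Longrightarrow> d u = 0"
    and "\<And>u v a b. u \<in> Gamma E \<Longrightarrow> v \<in> Gamma E \<Longrightarrow> d (a *\<^sub>R u + b *\<^sub>R v) = a *\<^sub>R d u + b *\<^sub>R d v"
    and "vector_field E X"
    and "\<And>f u. f \<in> C_infinity E \<Longrightarrow> u \<in> Gamma E \<Longrightarrow> d (fmult f u) = fmult f (d u) + fmult (X f) u"
  shows "d \<in> gauge_derivations E"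
  unfolding gauge_derivations_def linear_map_on_def
  by (intro CollectI conjI ballI allI impI exI[of _ X] assms)

lemma derivation_symbol:
  assumes "d \<in> gauge_derivations E"
  obtains X where "vector_field E X"
    "\<And>f u. f \<in> C_infinity E \<Longrightarrow> u \<in> Gamma E \<Longrightarrow> d (fmult f u) = fmult f (d u) + fmult (X f) u"
  using assms unfolding gauge_derivations_def by blast

lemma
  assumes "d \<in> gauge_derivations E"
  shows derivation_Gamma: "u \<in> Gamma E \<Longrightarrow> d u \<in> Gamma E"
    and derivation_outside: "u \<notin> Gamma E \<Longrightarrow> d u = 0"
    and derivation_linear: "u \<in> Gamma E \<Longrightarrow> v \<in> Gamma E \<Longrightarrow> d (a *\<^sub>R u + b *\<^sub>R v) = a *\<^sub>R d u + b *\<^sub>R d v"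
  using assms unfolding gauge_derivations_def linear_map_on_def by blast+

lemma
  assumes "d \<in> gauge_derivations E"
  shows derivation_add: "u \<in> Gamma E \<Longrightarrow> v \<in> Gamma E \<Longrightarrow> d (u + v) = d u + d v"
    and derivation_scaleR: "u \<in> Gamma E \<Longrightarrow> d (a *\<^sub>R u) = a *\<^sub>R d u"
    and derivation_0: "d 0 = 0"
    and derivation_diff: "u \<in> Gamma E \<Longrightarrow> v \<in> Gamma E \<Longrightarrow> d (u - v) = d u - d v"
proof -
  note lin = derivation_linear[OF assms]
  show "u \<in> Gamma E \<Longrightarrow> v \<in> Gamma E \<Longrightarrow> d (u + v) = d u + d v"
    using lin[of u v 1 1] by simp
  show "u \<in> Gamma E \<Longrightarrow> d (a *\<^sub>R u) = a *\<^sub>R d u"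
    using lin[of u u a 0] by simp
  show "d 0 = 0"
    using lin[OF Gamma_0 Gamma_0, of 0 0] by simp
  show "u \<in> Gamma E \<Longrightarrow> v \<in> Gamma E \<Longrightarrow> d (u - v) = d u - d v"
    using lin[of u v 1 "-1"] by simp
qed

lemma derivation_sum:
  assumes "d \<in> gauge_derivations E"
  shows "(\<And>i. i \<in> I \<Longrightarrow> u i \<in> Gamma E) \<Longrightarrow> d (\<Sum>i\<in>I. u i) = (\<Sum>i\<in>I. d (u i))"
  by (induction I rule: infinite_finite_induct)
    (simp_all add: derivation_0[OF assms] derivation_add[OF assms] subspace_sum[OF Gamma_subspace])

text \<open>
  A section \<open>w\<close> that vanishes to first order at \<open>m\<close> is killed at \<open>m\<close> by every derivation \<open>d\<close>.  Hadamard's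
  lemma for the components of \<open>w\<close> gives \<open>w = \<Sum>\<^bsub>a,i\<^esub> (x\<^sub>i - p\<^sub>i) H\<^bsub>ia\<^esub> e\<^sub>a\<close> near \<open>m\<close>, where both scalar factors vanish
  at \<open>m\<close>; by the Leibniz rule \<open>d\<close> maps a section with such a factorization to one vanishing at \<open>m\<close>.  A bump function
  \<open>\<beta>\<close> turns the three local factors into global ones, so that \<open>\<beta>\<^sup>3 w\<close> is a sum of such products.
\<close>

lemma derivation_vanish:
  assumes d: "d \<in> gauge_derivations E" and fr: "(W, e) \<in> frames E" and c: "(U, \<phi>) \<in> charts E"
    and m: "m \<in> W \<inter> U" and w: "w \<in> Gamma E" "w m = 0"
    and dw: "\<And>a i. a < rk \<Longrightarrow> i < n \<Longrightarrow> chart_partial U \<phi> i (frame_comp E e w a) m = 0"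
  shows "d w m = 0"
proof -
  define p where "p = \<phi> m"
  have V: "openin (Euclidean_space n) (\<phi> ` (U \<inter> W))" by (rule chart_image_openin[OF c frame_open[OF fr]])
  have pV: "p \<in> \<phi> ` (U \<inter> W)" using m by (auto simp: p_def)
  obtain r where r: "r > 0" "coord_box n p r \<subseteq> \<phi> ` (U \<inter> W)" using coord_box_exists[OF V pV] .
  let ?B = "coord_box n p r"
  have pB: "p \<in> ?B" using Euclidean_space_zero[OF V pV] r by (auto simp: coord_box_def)
  define W0 where "W0 = U \<inter> \<phi> -` ?B"
  have W0: "open W0" "W0 \<subseteq> U" "m \<in> W0" "\<phi> ` W0 \<subseteq> ?B"
    using chart_preimage_open[OF c openin_coord_box] m pB by (auto simp: W0_def p_def)
  have W0W: "W0 \<subseteq> W"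
  proof
    fix m' assume "m' \<in> W0"
    then obtain w where "m' \<in> U" "w \<in> U" "w \<in> W" "\<phi> m' = \<phi> w" using r(2) by (auto simp: W0_def)
    then show "m' \<in> W" using chart_inv[OF c] by metis
  qed
  define f where "f a x = frame_comp E e w a (inv_into U \<phi> x)" for a x
  have f: "C_k_on n k ?B (f a)" if "a < rk" for k a
    unfolding f_def using smooth_funD[OF Gamma_smooth[OF w(1) fr that] c] by (rule C_k_on_subset) (rule r(2))
  define H where "H i a = hadamard_quotient p (f a) i" for i a
  have H: "C_k_on n k ?B (H i a)" if "a < rk" "i < n" for k i a
    unfolding H_def by (rule hadamard_quotient_C_k[OF pB that(2) f[OF that(1)]])
  have H0: "H i a p = 0" if "a < rk" "i < n" for i a
    using dw[OF that] by (simp add: H_def hadamard_quotient_at chart_partial_def f_def[abs_def] p_def)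
  have f0: "f a p = 0" if "a < rk" for a
  proof -
    have "inv_into U \<phi> p = m" using chart_inv[OF c] m by (simp add: p_def)
    then show ?thesis
      using frame_comp_eqI[OF fr _ _ that, of m w "\<lambda>_. 0"] w(2) m by (simp add: f_def)
  qed
  obtain \<beta> A C where b: "smooth_fun E UNIV \<beta>" and A: "m \<in> A" "\<forall>m'\<in>A. \<beta> m' = 1"
    and C: "open C" "C \<union> W0 = UNIV" "\<forall>m'\<in>C. \<beta> m' = 0"
    by (rule bump[OF W0(1,3)]) (rule that)
  have b: "\<beta> \<in> C_infinity E" using b by (simp add: C_infinity_iff)
  have bm: "\<beta> m = 1" using A by simp
  define Y where "Y i m' = \<beta> m' * (\<phi> m' i - p i)" for i m'
  have Y: "Y i \<in> C_infinity E" for i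
    unfolding Y_def
    by (rule C_infinity_cutoff[OF b C W0(1) smooth_fun_chart[OF c W0(1,2)
            C_k_on_diff[OF openin_coord_box C_k_on_coord[OF openin_coord_box] C_k_on_const[OF openin_coord_box]]
            openin_coord_box W0(4)]])
  define K where "K i a m' = \<beta> m' * H i a (\<phi> m')" for i a m'
  have K: "K i a \<in> C_infinity E" if "a < rk" "i < n" for i a
    unfolding K_def
    by (rule C_infinity_cutoff[OF b C W0(1) smooth_fun_chart[OF c W0(1,2) H[OF that] openin_coord_box W0(4)]])
  have e': "fmult \<beta> (e a) \<in> Gamma E" if "a < rk" for a
    by (rule Gamma_fmult_frame[OF fr b W0(1) W0W C that])
  \<comment> \<open>one factor each for the coordinate difference, the Hadamard quotient and the frame section\<close>
  let ?b3 = "\<beta> * (\<beta> * \<beta>)"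
  have b3: "?b3 \<in> C_infinity E" by (intro C_infinity_mult b)
  have eq: "fmult ?b3 w = (\<Sum>a<rk. \<Sum>i<n. fmult (Y i) (fmult (K i a) (fmult \<beta> (e a))))"
  proof
    fix m'
    consider "m' \<in> C" | "m' \<in> W0" using C by auto
    then show "fmult ?b3 w m' = (\<Sum>a<rk. \<Sum>i<n. fmult (Y i) (fmult (K i a) (fmult \<beta> (e a)))) m'"
    proof cases
      case 1
      then show ?thesis using C(3) by (simp add: fmult_def sum_fun_apply)
    next
      case 2
      then have mW: "m' \<in> W" "m' \<in> U" "\<phi> m' \<in> ?B" using W0 W0W by auto
      have "frame_comp E e w a m' = (\<Sum>i<n. (\<phi> m' i - p i) * H i a (\<phi> m'))" if "a < rk" for a
        using hadamard[OF pB f[OF that] mW(3)] f0[OF that] chart_inv[OF c mW(2)] by (simp add: f_def[of a "\<phi> m'"] H_def)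
      then have "w m' = (\<Sum>a<rk. (\<Sum>i<n. (\<phi> m' i - p i) * H i a (\<phi> m')) *\<^sub>R e a m')"
        using frame_expand[OF fr mW(1), of w, OF Gamma_fib[OF w(1)]] by simp
      then show ?thesis
        by (simp add: fmult_def sum_fun_apply Y_def K_def scaleR_sum_left scaleR_sum_right mult_ac)
    qed
  qed
  obtain X where X: "\<And>f u. f \<in> C_infinity E \<Longrightarrow> u \<in> Gamma E \<Longrightarrow> d (fmult f u) = fmult f (d u) + fmult (X f) u"
    using derivation_symbol[OF d] by metis
  let ?t = "\<lambda>a i. fmult (Y i) (fmult (K i a) (fmult \<beta> (e a)))"
  have t: "?t a i \<in> Gamma E" if "a < rk" "i < n" for a i
    by (intro Gamma_fmult Y K e' that)
  \<comment> \<open>the derivative of the cutoff does not contribute, as the section vanishes at the point\<close>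
  have "d w m = d (fmult ?b3 w) m"
    using X[OF b3 w(1)] w(2) bm by (simp add: fmult_def)
  also have "d (fmult ?b3 w) = (\<Sum>a<rk. d (\<Sum>i<n. ?t a i))"
    unfolding eq
    by (rule derivation_sum[OF d]) (auto intro!: subspace_sum[OF Gamma_subspace] t)
  also have "\<dots> = (\<Sum>a<rk. \<Sum>i<n. d (?t a i))"
    by (intro sum.cong refl derivation_sum[OF d]) (auto intro: t)
  also have "\<dots> m = (\<Sum>a<rk. \<Sum>i<n. d (?t a i) m)"
    by (simp add: sum_fun_apply)
  also have "\<dots> = 0"
  proof (intro sum.neutral ballI)
    fix a i assume "a \<in> {..<rk}" "i \<in> {..<n}"
    then have ai: "a < rk" "i < n" by auto
    have "Y i m = 0" "K i a m = 0" using H0[OF ai] by (simp_all add: Y_def K_def p_def)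
    then show "d (fmult (Y i) (fmult (K i a) (fmult \<beta> (e a)))) m = 0"
      using X[OF Y Gamma_fmult[OF K[OF ai] e'[OF ai(1)]], of i] by (simp add: fmult_def)
  qed
  finally show ?thesis .
qed

end

section \<open>The gauge Lie algebroid and the jet bundle\<close>

context smooth_vector_bundle
begin

lemma vector_field_lincomb:
  assumes X: "vector_field E X" and Y: "vector_field E Y"
  shows "vector_field E (\<lambda>f. a *\<^sub>R X f + b *\<^sub>R Y f)"
proof (rule vector_fieldI)
  show "a *\<^sub>R X f + b *\<^sub>R Y f \<in> C_infinity E" if "f \<in> C_infinity E" for f
    using X Y that by (auto simp: vector_field_def intro!: C_infinity_add C_infinity_scaleR)
  fix f g assume fg: "f \<in> C_infinity E" "g \<in> C_infinity E"
  have X1: "X (s *\<^sub>R f + t *\<^sub>R g) = s *\<^sub>R X f + t *\<^sub>R X g" "X (f * g) = f * X g + g * X f" for s t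
    using X fg unfolding vector_field_def by blast+
  have Y1: "Y (s *\<^sub>R f + t *\<^sub>R g) = s *\<^sub>R Y f + t *\<^sub>R Y g" "Y (f * g) = f * Y g + g * Y f" for s t
    using Y fg unfolding vector_field_def by blast+
  show "a *\<^sub>R X (f * g) + b *\<^sub>R Y (f * g) = f * (a *\<^sub>R X g + b *\<^sub>R Y g) + g * (a *\<^sub>R X f + b *\<^sub>R Y f)"
    unfolding X1 Y1 by (rule ext) (simp add: algebra_simps)
  show "a *\<^sub>R X (s *\<^sub>R f + t *\<^sub>R g) + b *\<^sub>R Y (s *\<^sub>R f + t *\<^sub>R g) =
       s *\<^sub>R (a *\<^sub>R X f + b *\<^sub>R Y f) + t *\<^sub>R (a *\<^sub>R X g + b *\<^sub>R Y g)" for s t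
    unfolding X1 Y1 by (rule ext) (simp add: algebra_simps)
qed

lemma vector_field_commutator:
  assumes X: "vector_field E X" and Y: "vector_field E Y"
  shows "vector_field E (\<lambda>f. X (Y f) - Y (X f))"
proof (rule vector_fieldI)
  have Xm: "X f \<in> C_infinity E" and Ym: "Y f \<in> C_infinity E" if "f \<in> C_infinity E" for f
    using X Y that unfolding vector_field_def by blast+
  show "X (Y f) - Y (X f) \<in> C_infinity E" if "f \<in> C_infinity E" for f
    using subspace_diff[OF C_infinity_subspace] Xm Ym that by blast
  have X1: "X (s *\<^sub>R f + t *\<^sub>R g) = s *\<^sub>R X f + t *\<^sub>R X g" "X (f * g) = f * X g + g * X f"
    if "f \<in> C_infinity E" "g \<in> C_infinity E" for s t f g
    using X that unfolding vector_field_def by blast+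
  have Y1: "Y (s *\<^sub>R f + t *\<^sub>R g) = s *\<^sub>R Y f + t *\<^sub>R Y g" "Y (f * g) = f * Y g + g * Y f"
    if "f \<in> C_infinity E" "g \<in> C_infinity E" for s t f g
    using Y that unfolding vector_field_def by blast+
  have X2: "X (f + g) = X f + X g" and Y2: "Y (f + g) = Y f + Y g"
    if "f \<in> C_infinity E" "g \<in> C_infinity E" for f g
    using X1(1)[OF that, of 1 1] Y1(1)[OF that, of 1 1] by simp_all
  fix f g assume fg: "f \<in> C_infinity E" "g \<in> C_infinity E"
  show "X (Y (s *\<^sub>R f + t *\<^sub>R g)) - Y (X (s *\<^sub>R f + t *\<^sub>R g)) =
      s *\<^sub>R (X (Y f) - Y (X f)) + t *\<^sub>R (X (Y g) - Y (X g))" for s t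
    by (simp add: X1(1) Y1(1) fg Xm Ym algebra_simps)
  show "X (Y (f * g)) - Y (X (f * g)) = f * (X (Y g) - Y (X g)) + g * (X (Y f) - Y (X f))"
    by (simp add: X1(2) Y1(2) X2 Y2 fg Xm Ym C_infinity_mult algebra_simps)
qed

lemma act_apply [simp]: "act d u m = d m u"
  by (simp add: act_def)

lemma Gamma_D_iff: "d \<in> Gamma_D E \<longleftrightarrow> act d \<in> gauge_derivations E"
  by (simp add: Gamma_D_def)

lemma Gamma_D_outside: "d \<in> Gamma_D E \<Longrightarrow> u \<notin> Gamma E \<Longrightarrow> d m u = 0"
  using derivation_outside[of "act d" u] by (metis Gamma_D_iff act_apply zero_fun_apply)

lemma Gamma_D_lincomb:
  assumes d: "d \<in> Gamma_D E" and t: "t \<in> Gamma_D E"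
  shows "a *\<^sub>R d + b *\<^sub>R t \<in> Gamma_D E"
proof -
  have d': "act d \<in> gauge_derivations E" and t': "act t \<in> gauge_derivations E"
    using d t by (simp_all add: Gamma_D_iff)
  obtain X where X: "vector_field E X"
    "\<And>f u. f \<in> C_infinity E \<Longrightarrow> u \<in> Gamma E \<Longrightarrow> act d (fmult f u) = fmult f (act d u) + fmult (X f) u"
    using derivation_symbol[OF d'] by metis
  obtain Y where Y: "vector_field E Y"
    "\<And>f u. f \<in> C_infinity E \<Longrightarrow> u \<in> Gamma E \<Longrightarrow> act t (fmult f u) = fmult f (act t u) + fmult (Y f) u"
    using derivation_symbol[OF t'] by metis
  have eq: "act (a *\<^sub>R d + b *\<^sub>R t) u = a *\<^sub>R act d u + b *\<^sub>R act t u" for u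
    by (rule ext) simp
  show ?thesis unfolding Gamma_D_iff
  proof (rule gauge_derivationsI)
    show "vector_field E (\<lambda>f. a *\<^sub>R X f + b *\<^sub>R Y f)" by (rule vector_field_lincomb[OF X(1) Y(1)])
    show "act (a *\<^sub>R d + b *\<^sub>R t) u \<in> Gamma E" if "u \<in> Gamma E" for u
      unfolding eq using derivation_Gamma[OF d' that] derivation_Gamma[OF t' that]
      by (simp add: subspace_add subspace_scale Gamma_subspace)
    show "act (a *\<^sub>R d + b *\<^sub>R t) u = 0" if "u \<notin> Gamma E" for u
      unfolding eq using derivation_outside[OF d' that] derivation_outside[OF t' that] by simp
    show "act (a *\<^sub>R d + b *\<^sub>R t) (r *\<^sub>R u + s *\<^sub>R v) =
       r *\<^sub>R act (a *\<^sub>R d + b *\<^sub>R t) u + s *\<^sub>R act (a *\<^sub>R d + b *\<^sub>R t) v" if "u \<in> Gamma E" "v \<in> Gamma E" for u v r s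
      unfolding eq derivation_linear[OF d' that] derivation_linear[OF t' that]
      by (simp add: algebra_simps)
    show "act (a *\<^sub>R d + b *\<^sub>R t) (fmult f u) =
       fmult f (act (a *\<^sub>R d + b *\<^sub>R t) u) + fmult (a *\<^sub>R X f + b *\<^sub>R Y f) u" if "f \<in> C_infinity E" "u \<in> Gamma E" for f u
      unfolding eq X(2)[OF that] Y(2)[OF that] by (rule ext) (simp add: fmult_def algebra_simps)
  qed
qed

text \<open>
  The identity operator has symbol 0.  Its pairing with a jet section yields the values of the
  sections that represent the jets.
\<close>

lemma identity_Gamma_D: "(\<lambda>m u. if u \<in> Gamma E then u m else 0) \<in> Gamma_D E"
  unfolding Gamma_D_iff
proof (rule gauge_derivationsI)
  let ?i = "act (\<lambda>m u. if u \<in> Gamma E then u m else 0)"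
  have i: "?i u = (if u \<in> Gamma E then u else 0)" for u by (rule ext) simp
  show "vector_field E (\<lambda>_. 0)"
    by (rule vector_fieldI) (simp_all add: subspace_0[OF C_infinity_subspace])
  show "?i u \<in> Gamma E" if "u \<in> Gamma E" for u using that by (simp add: i)
  show "?i u = 0" if "u \<notin> Gamma E" for u using that by (simp add: i)
  show "?i (a *\<^sub>R u + b *\<^sub>R v) = a *\<^sub>R ?i u + b *\<^sub>R ?i v" if "u \<in> Gamma E" "v \<in> Gamma E" for u v a b
    using that by (simp add: i subspace_add subspace_scale Gamma_subspace)
  show "?i (fmult f u) = fmult f (?i u) + fmult 0 u" if "f \<in> C_infinity E" "u \<in> Gamma E" for f u
    using that by (simp add: i Gamma_fmult) (simp add: fmult_def fun_eq_iff)
qed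

lemma Gamma_D_subspace: "subspace (Gamma_D E)"
  by (rule subspace_lincombI[OF identity_Gamma_D Gamma_D_lincomb])

lemma bracket_D_Gamma_D:
  assumes d: "d \<in> Gamma_D E" and t: "t \<in> Gamma_D E"
  shows "bracket_D d t \<in> Gamma_D E"
proof -
  have d': "act d \<in> gauge_derivations E" and t': "act t \<in> gauge_derivations E"
    using d t by (simp_all add: Gamma_D_iff)
  obtain X where X: "vector_field E X"
    "\<And>f u. f \<in> C_infinity E \<Longrightarrow> u \<in> Gamma E \<Longrightarrow> act d (fmult f u) = fmult f (act d u) + fmult (X f) u"
    using derivation_symbol[OF d'] by metis
  obtain Y where Y: "vector_field E Y"
    "\<And>f u. f \<in> C_infinity E \<Longrightarrow> u \<in> Gamma E \<Longrightarrow> act t (fmult f u) = fmult f (act t u) + fmult (Y f) u"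
    using derivation_symbol[OF t'] by metis
  have Xm: "X f \<in> C_infinity E" and Ym: "Y f \<in> C_infinity E" if "f \<in> C_infinity E" for f
    using X(1) Y(1) that unfolding vector_field_def by blast+
  note dm = derivation_Gamma[OF d'] and tm = derivation_Gamma[OF t']
  have eq: "act (bracket_D d t) u = act d (act t u) - act t (act d u)" for u
    by (rule ext) (simp add: bracket_D_def)
  show ?thesis unfolding Gamma_D_iff
  proof (rule gauge_derivationsI)
    show "vector_field E (\<lambda>f. X (Y f) - Y (X f))" by (rule vector_field_commutator[OF X(1) Y(1)])
    show "act (bracket_D d t) u \<in> Gamma E" if "u \<in> Gamma E" for u
      unfolding eq using dm tm that by (simp add: subspace_diff Gamma_subspace)
    show "act (bracket_D d t) u = 0" if "u \<notin> Gamma E" for u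
      unfolding eq using derivation_outside[OF d' that] derivation_outside[OF t' that]
        derivation_0[OF d'] derivation_0[OF t'] by simp
    show "act (bracket_D d t) (r *\<^sub>R u + s *\<^sub>R v) = r *\<^sub>R act (bracket_D d t) u + s *\<^sub>R act (bracket_D d t) v"
      if "u \<in> Gamma E" "v \<in> Gamma E" for u v r s
      unfolding eq derivation_linear[OF d' that] derivation_linear[OF t' that]
        derivation_linear[OF d' tm[OF that(1)] tm[OF that(2)]]
        derivation_linear[OF t' dm[OF that(1)] dm[OF that(2)]]
      by (simp add: algebra_simps)
    show "act (bracket_D d t) (fmult f u) = fmult f (act (bracket_D d t) u) + fmult (X (Y f) - Y (X f)) u"
      if f: "f \<in> C_infinity E" and u: "u \<in> Gamma E" for f u
    proof -
      have "act d (act t (fmult f u)) = act d (fmult f (act t u)) + act d (fmult (Y f) u)"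
        unfolding Y(2)[OF f u]
        by (rule derivation_add[OF d' Gamma_fmult[OF f tm[OF u]] Gamma_fmult[OF Ym[OF f] u]])
      moreover have "act t (act d (fmult f u)) = act t (fmult f (act d u)) + act t (fmult (X f) u)"
        unfolding X(2)[OF f u]
        by (rule derivation_add[OF t' Gamma_fmult[OF f dm[OF u]] Gamma_fmult[OF Xm[OF f] u]])
      ultimately show ?thesis
        unfolding eq X(2)[OF f tm[OF u]] X(2)[OF Ym[OF f] u] Y(2)[OF f dm[OF u]] Y(2)[OF Xm[OF f] u]
        by (simp only:) (rule ext, simp add: fmult_def algebra_simps)
    qed
  qed
qed

lemma fib_DE:
  assumes "\<delta> \<in> fib_D E m" obtains d where "d \<in> Gamma_D E" "\<delta> = d m"
  using assms by (auto simp: fib_D_def)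

lemma fib_DI: "d \<in> Gamma_D E \<Longrightarrow> d m \<in> fib_D E m"
  by (auto simp: fib_D_def)

lemma fib_D_lincomb:
  assumes "\<delta> \<in> fib_D E m" "\<epsilon> \<in> fib_D E m" shows "a *\<^sub>R \<delta> + b *\<^sub>R \<epsilon> \<in> fib_D E m"
proof -
  obtain d t where "d \<in> Gamma_D E" "\<delta> = d m" "t \<in> Gamma_D E" "\<epsilon> = t m"
    using assms by (auto elim!: fib_DE)
  then show ?thesis using fib_DI[OF Gamma_D_lincomb[of d t a b], of m] by simp
qed

lemma fib_D_subspace: "subspace (fib_D E m)"
  by (rule subspace_lincombI[OF fib_DI[OF identity_Gamma_D] fib_D_lincomb])

lemma fib_D_linear:
  assumes "\<delta> \<in> fib_D E m" "u \<in> Gamma E" "v \<in> Gamma E"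
  shows "\<delta> (a *\<^sub>R u + b *\<^sub>R v) = a *\<^sub>R \<delta> u + b *\<^sub>R \<delta> v"
proof -
  obtain d where d: "d \<in> Gamma_D E" "\<delta> = d m" using assms(1) by (rule fib_DE)
  from derivation_linear[OF _ assms(2,3), of "act d" a b] d
  have "act d (a *\<^sub>R u + b *\<^sub>R v) m = (a *\<^sub>R act d u + b *\<^sub>R act d v) m" by (simp only: Gamma_D_iff)
  then show ?thesis by (simp add: d)
qed

text \<open>
  It suffices to compare first derivatives in one chart and one frame, whereas \<open>same_jet\<close> asks for all
  of them.
\<close>

lemma jet_eqI:
  assumes \<delta>: "\<delta> \<in> fib_D E m" and fr: "(W, e) \<in> frames E" and c: "(U, \<phi>) \<in> charts E"
    and m: "m \<in> W \<inter> U" and uv: "u \<in> Gamma E" "v \<in> Gamma E" "u m = v m"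
    and p: "\<And>a i. a < rk \<Longrightarrow> i < n \<Longrightarrow>
      chart_partial U \<phi> i (frame_comp E e u a) m = chart_partial U \<phi> i (frame_comp E e v a) m"
  shows "\<delta> u = \<delta> v"
proof -
  obtain d where d: "d \<in> Gamma_D E" "\<delta> = d m" using \<delta> by (rule fib_DE)
  have d': "act d \<in> gauge_derivations E" using d by (simp add: Gamma_D_iff)
  define w where "w = u + (-1) *\<^sub>R v"
  have w: "w \<in> Gamma E" using uv by (simp add: w_def subspace_diff Gamma_subspace)
  have "act d w m = 0"
  proof (rule derivation_vanish[OF d' fr c m w])
    show "w m = 0" using uv by (simp add: w_def)
    fix a i assume a: "a < rk" and i: "i < n"
    note W = frame_open[OF fr] and mUW = m[unfolded Int_commute[of W]]
    note su = Gamma_smooth[OF uv(1) fr a] and sv = Gamma_smooth[OF uv(2) fr a]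
    have "chart_partial U \<phi> i (frame_comp E e w a) m =
        chart_partial U \<phi> i (\<lambda>m. 1 * frame_comp E e u a m + (-1) * frame_comp E e v a m) m"
      by (rule chart_partial_cong[OF c W i _ mUW])
        (use frame_comp_lincomb[OF fr _ a uv(1,2), of _ 1 "-1"] in \<open>simp add: w_def\<close>)
    also have "\<dots> = 0"
      using p[OF a i] by (subst chart_partial_lincomb[OF c W i su sv mUW]) simp
    finally show "chart_partial U \<phi> i (frame_comp E e w a) m = 0" .
  qed
  moreover have "\<delta> w = 1 *\<^sub>R \<delta> u + (-1) *\<^sub>R \<delta> v"
    using fib_D_linear[OF \<delta> uv(1,2), of 1 "-1"] by (simp add: w_def)
  ultimately show ?thesis by (simp add: d)
qed

text \<open>
  The identification of jets with linear maps on the fibre of the gauge Lie algebroid does not depend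
  on the chosen representative, because derivations are operators of first order.
\<close>

lemma fib_J_eq: "fib_J E m = {diff_0 E u m | u. u \<in> Gamma E}"
proof -
  have "jet_hom E m (jet E m u) = diff_0 E u m" if u: "u \<in> Gamma E" for u
  proof (rule ext)
    fix \<delta>
    show "jet_hom E m (jet E m u) \<delta> = diff_0 E u m \<delta>"
    proof (cases "\<delta> \<in> fib_D E m")
      case True
      have "u \<in> jet E m u" using u by (auto simp: jet_def same_jet_def)
      then have "(SOME v. v \<in> jet E m u) \<in> jet E m u" by (rule someI[of "\<lambda>v. v \<in> jet E m u"])
      then obtain v where v: "v = (SOME v. v \<in> jet E m u)" "v \<in> Gamma E" "same_jet E m u v" by (auto simp: jet_def)
      obtain W e where fr: "(W, e) \<in> frames E" "m \<in> W" using frame_exists by blast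
      obtain U \<phi> where c: "(U, \<phi>) \<in> charts E" "m \<in> U" using chart_exists by blast
      have "\<delta> u = \<delta> v"
      proof (rule jet_eqI[OF True fr(1) c(1) _ u v(2)])
        show "m \<in> W \<inter> U" using fr c by simp
        show "u m = v m" using v(3) by (simp add: same_jet_def)
        show "chart_partial U \<phi> i (frame_comp E e u a) m = chart_partial U \<phi> i (frame_comp E e v a) m"
          if "a < rk" "i < n" for a i
        proof -
          from v(3) have *: "\<forall>(W, e)\<in>frames E. \<forall>(U, \<phi>)\<in>charts E. m \<in> W \<inter> U \<longrightarrow>
             (\<forall>a<rnk E. \<forall>i<mdim E.
                partial_deriv i (\<lambda>x. frame_comp E e u a (inv_into U \<phi> x)) (\<phi> m) =
                partial_deriv i (\<lambda>x. frame_comp E e v a (inv_into U \<phi> x)) (\<phi> m))"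
            unfolding same_jet_def by (elim conjE)
          from bspec[OF bspec[OF this fr(1), unfolded prod.case] c(1)]
          show ?thesis using fr c that by (simp add: chart_partial_def)
        qed
      qed
      then show ?thesis using True by (simp add: jet_hom_def diff_0_def v(1))
    qed (simp add: jet_hom_def diff_0_def)
  qed
  then show ?thesis unfolding fib_J_def by (intro Collect_cong) metis
qed

lemma fib_JE:
  assumes "\<mu> \<in> fib_J E m" obtains u where "u \<in> Gamma E" "\<mu> = diff_0 E u m"
  using assms by (auto simp: fib_J_eq)

lemma diff_0_fib_J: "u \<in> Gamma E \<Longrightarrow> diff_0 E u m \<in> fib_J E m"
  by (auto simp: fib_J_eq)

lemma diff_0_apply: "\<delta> \<in> fib_D E m \<Longrightarrow> diff_0 E u m \<delta> = \<delta> u"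
  by (simp add: diff_0_def)

lemma diff_0_lincomb:
  assumes "u \<in> Gamma E" "v \<in> Gamma E"
  shows "diff_0 E (a *\<^sub>R u + b *\<^sub>R v) m = a *\<^sub>R diff_0 E u m + b *\<^sub>R diff_0 E v m"
  by (rule ext) (simp add: diff_0_def fib_D_linear[OF _ assms])

lemma fib_J_lincomb:
  assumes "\<mu> \<in> fib_J E m" "\<nu> \<in> fib_J E m" shows "a *\<^sub>R \<mu> + b *\<^sub>R \<nu> \<in> fib_J E m"
proof -
  obtain u v where uv: "u \<in> Gamma E" "\<mu> = diff_0 E u m" "v \<in> Gamma E" "\<nu> = diff_0 E v m"
    using assms by (auto elim!: fib_JE)
  then have "a *\<^sub>R u + b *\<^sub>R v \<in> Gamma E" by (simp add: subspace_add subspace_scale Gamma_subspace)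
  from diff_0_fib_J[OF this, of m] show ?thesis using uv by (simp add: diff_0_lincomb)
qed

lemma fib_J_subspace: "subspace (fib_J E m)"
  by (rule subspace_lincombI[OF diff_0_fib_J[OF Gamma_0] fib_J_lincomb])

lemma fib_J_outside: "\<mu> \<in> fib_J E m \<Longrightarrow> \<delta> \<notin> fib_D E m \<Longrightarrow> \<mu> \<delta> = 0"
  by (auto simp: diff_0_def elim!: fib_JE)

lemma fib_J_linear:
  assumes "\<mu> \<in> fib_J E m" "\<delta> \<in> fib_D E m" "\<epsilon> \<in> fib_D E m"
  shows "\<mu> (a *\<^sub>R \<delta> + b *\<^sub>R \<epsilon>) = a *\<^sub>R \<mu> \<delta> + b *\<^sub>R \<mu> \<epsilon>"
proof -
  obtain u where "\<mu> = diff_0 E u m" using assms(1) by (rule fib_JE)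
  then show ?thesis using assms fib_D_lincomb[OF assms(2,3), of a b] by (simp add: diff_0_apply)
qed

lemma Gamma_J_fib: "\<mu> \<in> Gamma_J E \<Longrightarrow> \<mu> m \<in> fib_J E m"
  by (simp add: Gamma_J_def)

lemma Gamma_J_pair: "\<mu> \<in> Gamma_J E \<Longrightarrow> d \<in> Gamma_D E \<Longrightarrow> pair_E \<mu> d \<in> Gamma E"
  by (simp add: Gamma_J_def)

lemma Gamma_JI: "(\<And>m. \<mu> m \<in> fib_J E m) \<Longrightarrow> (\<And>d. d \<in> Gamma_D E \<Longrightarrow> pair_E \<mu> d \<in> Gamma E) \<Longrightarrow> \<mu> \<in> Gamma_J E"
  by (simp add: Gamma_J_def)

lemma Gamma_J_eqI:
  assumes "\<mu> \<in> Gamma_J E" "\<nu> \<in> Gamma_J E" "\<And>d. d \<in> Gamma_D E \<Longrightarrow> pair_E \<mu> d = pair_E \<nu> d"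
  shows "\<mu> = \<nu>"
proof (intro ext)
  fix m \<delta>
  show "\<mu> m \<delta> = \<nu> m \<delta>"
  proof (cases "\<delta> \<in> fib_D E m")
    case True
    then obtain d where d: "d \<in> Gamma_D E" "\<delta> = d m" by (rule fib_DE)
    then show ?thesis using fun_cong[OF assms(3)[OF d(1)], of m] by (simp add: pair_E_def)
  next
    case False
    then show ?thesis using fib_J_outside Gamma_J_fib assms(1,2) by metis
  qed
qed

lemma pair_diff_0: "d \<in> Gamma_D E \<Longrightarrow> pair_E (diff_0 E u) d = act d u"
  by (rule ext) (simp add: pair_E_def diff_0_apply fib_DI)

lemma diff_0_Gamma_J: "u \<in> Gamma E \<Longrightarrow> diff_0 E u \<in> Gamma_J E"
  using derivation_Gamma by (intro Gamma_JI) (auto simp: diff_0_fib_J pair_diff_0 Gamma_D_iff)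

text \<open>
  Operators are determined by their pairings with the sections \<open>du\<close>.
\<close>

lemma Gamma_D_eqI:
  assumes "d \<in> Gamma_D E" "t \<in> Gamma_D E" "\<And>\<mu>. \<mu> \<in> Gamma_J E \<Longrightarrow> pair_E \<mu> d = pair_E \<mu> t"
  shows "d = t"
proof (intro ext)
  fix m u
  show "d m u = t m u"
  proof (cases "u \<in> Gamma E")
    case True
    from assms(3)[OF diff_0_Gamma_J[OF this]] show ?thesis
      using assms(1,2) by (simp add: pair_diff_0) (metis act_apply)
  next
    case False
    then show ?thesis by (simp add: Gamma_D_outside assms(1,2))
  qed
qed

lemma Gamma_J_lincomb:
  assumes "\<mu> \<in> Gamma_J E" "\<nu> \<in> Gamma_J E" shows "a *\<^sub>R \<mu> + b *\<^sub>R \<nu> \<in> Gamma_J E"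
proof (rule Gamma_JI)
  show "(a *\<^sub>R \<mu> + b *\<^sub>R \<nu>) m \<in> fib_J E m" for m
    using fib_J_lincomb[OF Gamma_J_fib[OF assms(1)] Gamma_J_fib[OF assms(2)]] by simp
  fix d assume d: "d \<in> Gamma_D E"
  have "pair_E (a *\<^sub>R \<mu> + b *\<^sub>R \<nu>) d = a *\<^sub>R pair_E \<mu> d + b *\<^sub>R pair_E \<nu> d"
    by (rule ext) (simp add: pair_E_def)
  then show "pair_E (a *\<^sub>R \<mu> + b *\<^sub>R \<nu>) d \<in> Gamma E"
    using Gamma_J_pair d assms by (simp add: subspace_add subspace_scale Gamma_subspace)
qed

lemma Gamma_J_subspace: "subspace (Gamma_J E)"
  by (rule subspace_lincombI[OF diff_0_Gamma_J[OF Gamma_0] Gamma_J_lincomb])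

lemma Gamma_J_fmult:
  assumes f: "f \<in> C_infinity E" and \<mu>: "\<mu> \<in> Gamma_J E" shows "fmult f \<mu> \<in> Gamma_J E"
proof (rule Gamma_JI)
  show "fmult f \<mu> m \<in> fib_J E m" for m
    using fib_J_lincomb[OF Gamma_J_fib[OF \<mu>] Gamma_J_fib[OF \<mu>], of "f m" m 0] by (simp add: fmult_def)
  fix d assume d: "d \<in> Gamma_D E"
  have "pair_E (fmult f \<mu>) d = fmult f (pair_E \<mu> d)"
    by (rule ext) (simp add: pair_E_def fmult_def)
  then show "pair_E (fmult f \<mu>) d \<in> Gamma E"
    using Gamma_J_pair[OF \<mu> d] Gamma_fmult[OF f] by simp
qed

text \<open>
  The operator \<open>\<beta> \<partial>\<^sub>i\<close>, acting on the components in the frame \<open>e\<close>.  Its symbol is the vector field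
  \<open>\<beta> \<partial>\<^sub>i\<close>.
\<close>

lemma chart_derivation_Gamma_D:
  assumes fr: "(W, e) \<in> frames E" and c: "(U, \<phi>) \<in> charts E" and i: "i < n"
    and b: "\<beta> \<in> C_infinity E" and C: "open C" "C \<union> (U \<inter> W) = UNIV" "\<forall>m\<in>C. \<beta> m = 0"
  shows "(\<lambda>m u. if u \<in> Gamma E then \<Sum>a<rk. (\<beta> m * chart_partial U \<phi> i (frame_comp E e u a) m) *\<^sub>R e a m else 0) \<in> Gamma_D E"
  unfolding Gamma_D_iff
proof (rule gauge_derivationsI)
  note W = frame_open[OF fr]
  have UW: "open (U \<inter> W)" using W chart_open[OF c] by auto
  let ?D = "act (\<lambda>m u. if u \<in> Gamma E then \<Sum>a<rk. (\<beta> m * chart_partial U \<phi> i (frame_comp E e u a) m) *\<^sub>R e a m else 0)"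
  let ?X = "\<lambda>f m. \<beta> m * chart_partial U \<phi> i f m"
  have D: "?D u m = (\<Sum>a<rk. (\<beta> m * chart_partial U \<phi> i (frame_comp E e u a) m) *\<^sub>R e a m)" if "u \<in> Gamma E" for u m
    using that by simp
  have X0: "\<beta> m = 0" if "m \<notin> U \<inter> W" for m using C that by blast
  show "vector_field E ?X"
  proof (rule vector_fieldI)
    fix f assume f: "f \<in> C_infinity E"
    show "?X f \<in> C_infinity E"
      by (rule C_infinity_cutoff[OF b C UW chart_partial_smooth[OF c W i C_infinity_smooth[OF f]]])
    fix g assume g: "g \<in> C_infinity E"
    note sf = C_infinity_smooth[OF f, of W] and sg = C_infinity_smooth[OF g, of W]
    show "?X (f * g) = f * ?X g + g * ?X f"
    proof
      fix m
      have "f * g = (\<lambda>m. f m * g m)" by (rule ext) simp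
      then show "?X (f * g) m = (f * ?X g + g * ?X f) m"
        using chart_partial_mult[OF c W i sf sg, of m] X0[of m] by (cases "m \<in> U \<inter> W") (simp_all add: algebra_simps)
    qed
    show "?X (s *\<^sub>R f + t *\<^sub>R g) = s *\<^sub>R ?X f + t *\<^sub>R ?X g" for s t
    proof
      fix m
      have "s *\<^sub>R f + t *\<^sub>R g = (\<lambda>m. s * f m + t * g m)" by (rule ext) simp
      then show "?X (s *\<^sub>R f + t *\<^sub>R g) m = (s *\<^sub>R ?X f + t *\<^sub>R ?X g) m"
        using chart_partial_lincomb[OF c W i sf sg, of m s t]
         X0[of m] by (cases "m \<in> U \<inter> W") (simp_all add: algebra_simps)
    qed
  qed
  show "?D u \<in> Gamma E" if u: "u \<in> Gamma E" for u
  proof (rule Gamma_cutoff[OF fr UW _ C(1,2)])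
    show "?D u m = 0" if "m \<in> C" for m using C(3) that u by simp
    show "?D u m = (\<Sum>a<rk. (\<beta> m * chart_partial U \<phi> i (frame_comp E e u a) m) *\<^sub>R e a m)" for m
      using u by simp
    show "smooth_fun E (U \<inter> W) (\<lambda>m. \<beta> m * chart_partial U \<phi> i (frame_comp E e u a) m)" if "a < rk" for a
      by (rule smooth_fun_mult[OF UW C_infinity_smooth[OF b] chart_partial_smooth[OF c W i Gamma_smooth[OF u fr that]]])
  qed simp
  show "?D u = 0" if "u \<notin> Gamma E" for u using that by (intro ext) simp
  show "?D (s *\<^sub>R u + t *\<^sub>R v) = s *\<^sub>R ?D u + t *\<^sub>R ?D v" if u: "u \<in> Gamma E" and v: "v \<in> Gamma E" for u v s t
  proof
    fix m
    have uv: "s *\<^sub>R u + t *\<^sub>R v \<in> Gamma E" using u v by (simp add: subspace_add subspace_scale Gamma_subspace)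
    show "?D (s *\<^sub>R u + t *\<^sub>R v) m = (s *\<^sub>R ?D u + t *\<^sub>R ?D v) m"
    proof (cases "m \<in> U \<inter> W")
      case True
      have "chart_partial U \<phi> i (frame_comp E e (s *\<^sub>R u + t *\<^sub>R v) a) m =
        s * chart_partial U \<phi> i (frame_comp E e u a) m + t * chart_partial U \<phi> i (frame_comp E e v a) m" if a: "a < rk" for a
        unfolding chart_partial_lincomb[OF c W i Gamma_smooth[OF u fr a] Gamma_smooth[OF v fr a] True, symmetric]
        by (rule chart_partial_cong[OF c W i _ True]) (rule frame_comp_lincomb[OF fr _ a u v])
      then show ?thesis
        using D[OF uv, of m] D[OF u, of m] D[OF v, of m]
        by (simp add: algebra_simps scaleR_sum_right sum.distrib)
    next
      case False
      then show ?thesis using X0[OF False] uv u v by simp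
    qed
  qed
  show "?D (fmult f u) = fmult f (?D u) + fmult (?X f) u" if f: "f \<in> C_infinity E" and u: "u \<in> Gamma E" for f u
  proof
    fix m
    have fu: "fmult f u \<in> Gamma E" by (rule Gamma_fmult[OF f u])
    show "?D (fmult f u) m = (fmult f (?D u) + fmult (?X f) u) m"
    proof (cases "m \<in> U \<inter> W")
      case True
      have "chart_partial U \<phi> i (frame_comp E e (fmult f u) a) m =
        f m * chart_partial U \<phi> i (frame_comp E e u a) m + chart_partial U \<phi> i f m * frame_comp E e u a m" if a: "a < rk" for a
      proof -
        note su = Gamma_smooth[OF u fr a]
        have "chart_partial U \<phi> i (frame_comp E e (fmult f u) a) m = chart_partial U \<phi> i (\<lambda>m. f m * frame_comp E e u a m) m"
          by (rule chart_partial_cong[OF c W i _ True]) (rule frame_comp_fmult[OF fr _ a Gamma_fib[OF u]])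
        then show ?thesis
          using chart_partial_mult[OF c W i C_infinity_smooth[OF f] su True] by simp
      qed
      moreover have "u m = (\<Sum>a<rk. frame_comp E e u a m *\<^sub>R e a m)"
        by (rule frame_expand[OF fr _ Gamma_fib[OF u]]) (use True in simp)
      then have "fmult (?X f) u m = (\<Sum>a<rk. (\<beta> m * (chart_partial U \<phi> i f m * frame_comp E e u a m)) *\<^sub>R e a m)"
        by (simp add: fmult_def scaleR_sum_right mult.assoc)
      ultimately show ?thesis
        using D[OF fu, of m] D[OF u, of m]
        by (simp add: fmult_def algebra_simps scaleR_sum_right sum.distrib)
    next
      case False
      then show ?thesis using X0[OF False] fu u by (simp add: fmult_def)
    qed
  qed
qed

end

section \<open>Lie derivatives of jet sections\<close>

context smooth_vector_bundle
begin

text \<open>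
  Derivations are local operators: multiplying both sections by a bump function supported in \<open>A\<close>
  makes them equal.
\<close>

lemma derivation_local:
  assumes d: "d \<in> gauge_derivations E" and u: "u \<in> Gamma E" and v: "v \<in> Gamma E"
    and A: "open A" "m \<in> A" "\<And>m'. m' \<in> A \<Longrightarrow> u m' = v m'"
  shows "d u m = d v m"
proof -
  obtain \<beta> A' C where b: "smooth_fun E UNIV \<beta>" and A': "open A'" "m \<in> A'" "A' \<subseteq> A" "\<forall>m'\<in>A'. \<beta> m' = 1"
    and C: "open C" "C \<union> A = UNIV" "\<forall>m'\<in>C. \<beta> m' = 0"
    by (rule bump[OF A(1,2)]) (rule that)
  have b: "\<beta> \<in> C_infinity E" using b by (simp add: C_infinity_iff)
  obtain X where X: "\<And>f u. f \<in> C_infinity E \<Longrightarrow> u \<in> Gamma E \<Longrightarrow> d (fmult f u) = fmult f (d u) + fmult (X f) u"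
    using derivation_symbol[OF d] by metis
  have "fmult \<beta> u = fmult \<beta> v"
  proof
    fix m'
    have "m' \<in> C \<or> m' \<in> A" using C by auto
    then show "fmult \<beta> u m' = fmult \<beta> v m'" using C A by (auto simp: fmult_def)
  qed
  then have "fmult \<beta> (d u) + fmult (X \<beta>) u = fmult \<beta> (d v) + fmult (X \<beta>) v"
    using X[OF b u] X[OF b v] by simp
  from fun_cong[OF this, of m] show ?thesis
    using A A' by (simp add: fmult_def)
qed

text \<open>
  The map \<open>t \<mapsto> d\<langle>\<mu>, t\<rangle> - \<langle>\<mu>, [d, t]\<rangle>\<close>, which the Lie derivative of \<open>\<mu>\<close> is to induce, is at \<open>m\<close> the evaluation on
  a jet.
\<close>

definition has_Lie_jet :: "('m \<Rightarrow> ('m, 'v) dfib) \<Rightarrow> 'm \<Rightarrow> ('m \<Rightarrow> ('m, 'v) jfib) \<Rightarrow> bool"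
  where "has_Lie_jet d m \<mu> \<longleftrightarrow> (\<exists>u\<in>Gamma E. \<forall>t\<in>Gamma_D E.
    act d (pair_E \<mu> t) m - pair_E \<mu> (bracket_D d t) m = act t u m)"

context
  fixes d :: "'m \<Rightarrow> ('m, 'v) dfib" and m :: 'm
  assumes d: "d \<in> Gamma_D E"
begin

lemma act_derivation: "act d \<in> gauge_derivations E" using d by (simp add: Gamma_D_iff)

text \<open>
  The Lie derivative commutes with \<open>d\<close>: \<open>L\<^sub>d (du) = d(d u)\<close>.
\<close>

lemma has_Lie_jet_diff_0:
  assumes u: "u \<in> Gamma E" shows "has_Lie_jet d m (diff_0 E u)"
  unfolding has_Lie_jet_def
proof (intro bexI ballI)
  show "act d u \<in> Gamma E" using derivation_Gamma[OF act_derivation u] .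
  fix t assume t: "t \<in> Gamma_D E"
  show "act d (pair_E (diff_0 E u) t) m - pair_E (diff_0 E u) (bracket_D d t) m = act t (act d u) m"
    unfolding pair_diff_0[OF t] pair_diff_0[OF bracket_D_Gamma_D[OF d t]] by (simp add: bracket_D_def)
qed

lemma has_Lie_jet_add:
  assumes mem: "\<mu> \<in> Gamma_J E" "\<nu> \<in> Gamma_J E" and "has_Lie_jet d m \<mu>" "has_Lie_jet d m \<nu>"
  shows "has_Lie_jet d m (\<mu> + \<nu>)"
proof -
  obtain u v where u: "u \<in> Gamma E" "\<forall>t\<in>Gamma_D E. act d (pair_E \<mu> t) m - pair_E \<mu> (bracket_D d t) m = act t u m"
    and v: "v \<in> Gamma E" "\<forall>t\<in>Gamma_D E. act d (pair_E \<nu> t) m - pair_E \<nu> (bracket_D d t) m = act t v m"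
    using assms(3,4) unfolding has_Lie_jet_def by blast
  show ?thesis unfolding has_Lie_jet_def
  proof (intro bexI ballI)
    show "u + v \<in> Gamma E" using u(1) v(1) by (rule Gamma_add)
    fix t assume t: "t \<in> Gamma_D E"
    have p: "pair_E (\<mu> + \<nu>) s = pair_E \<mu> s + pair_E \<nu> s" for s
      by (rule ext) (simp add: pair_E_def)
    have "act d (pair_E (\<mu> + \<nu>) t) = act d (pair_E \<mu> t) + act d (pair_E \<nu> t)"
      unfolding p by (rule derivation_add[OF act_derivation Gamma_J_pair[OF mem(1) t] Gamma_J_pair[OF mem(2) t]])
    moreover have "act t (u + v) = act t u + act t v"
      using derivation_add[OF _ u(1) v(1), of "act t"] t by (simp only: Gamma_D_iff)
    ultimately show "act d (pair_E (\<mu> + \<nu>) t) m - pair_E (\<mu> + \<nu>) (bracket_D d t) m = act t (u + v) m"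
      using bspec[OF u(2) t] bspec[OF v(2) t] by (simp only: p plus_fun_apply) (simp only: algebra_simps)
  qed
qed

text \<open>
  If \<open>L\<^sub>d \<mu>\<close> is the jet of \<open>u\<close> at \<open>m\<close>, and \<open>\<mu>\<close> itself is the jet of \<open>w\<close> there, then
  \<open>L\<^sub>d (f \<mu>) = f L\<^sub>d \<mu> + X(f) \<mu>\<close> is the jet of \<open>f(m) u + X(f)(m) w\<close>.
\<close>

lemma has_Lie_jet_fmult:
  assumes f: "f \<in> C_infinity E" and mem: "\<mu> \<in> Gamma_J E" and "has_Lie_jet d m \<mu>"
  shows "has_Lie_jet d m (fmult f \<mu>)"
proof -
  obtain u where u: "u \<in> Gamma E" "\<forall>t\<in>Gamma_D E. act d (pair_E \<mu> t) m - pair_E \<mu> (bracket_D d t) m = act t u m"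
    using assms(3) unfolding has_Lie_jet_def by blast
  obtain w where w: "w \<in> Gamma E" "\<mu> m = diff_0 E w m" using fib_JE[OF Gamma_J_fib[OF mem]] .
  obtain X where X: "\<And>f u. f \<in> C_infinity E \<Longrightarrow> u \<in> Gamma E \<Longrightarrow> act d (fmult f u) = fmult f (act d u) + fmult (X f) u"
    using derivation_symbol[OF act_derivation] by metis
  show ?thesis unfolding has_Lie_jet_def
  proof (intro bexI ballI)
    show "f m *\<^sub>R u + X f m *\<^sub>R w \<in> Gamma E" using u(1) w(1) by (simp add: subspace_add subspace_scale Gamma_subspace)
    fix t assume t: "t \<in> Gamma_D E"
    have p: "pair_E (fmult f \<mu>) s = fmult f (pair_E \<mu> s)" for s
      by (rule ext) (simp add: pair_E_def fmult_def)
    have 1: "act d (pair_E (fmult f \<mu>) t) m = f m *\<^sub>R act d (pair_E \<mu> t) m + X f m *\<^sub>R act t w m"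
      unfolding p X[OF f Gamma_J_pair[OF mem t]] using w fib_DI[OF t, of m]
      by (simp add: fmult_def pair_E_def diff_0_apply)
    have 2: "act t (f m *\<^sub>R u + X f m *\<^sub>R w) m = f m *\<^sub>R act t u m + X f m *\<^sub>R act t w m"
      using fib_D_linear[OF fib_DI[OF t] u(1) w(1)] by (simp only: act_apply)
    have 3: "pair_E (fmult f \<mu>) (bracket_D d t) m = f m *\<^sub>R pair_E \<mu> (bracket_D d t) m"
      unfolding p by (simp add: fmult_def)
    show "act d (pair_E (fmult f \<mu>) t) m - pair_E (fmult f \<mu>) (bracket_D d t) m = act t (f m *\<^sub>R u + X f m *\<^sub>R w) m"
      unfolding 1 2 3 bspec[OF u(2) t, symmetric] by (simp only: algebra_simps)
  qed
qed

text \<open>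
  Since derivations are local operators, the germ of \<open>\<mu>\<close> at \<open>m\<close> determines both terms of the Lie
  derivative at \<open>m\<close>.
\<close>

lemma has_Lie_jet_cong:
  assumes mem: "\<mu> \<in> Gamma_J E" "\<nu> \<in> Gamma_J E" and A: "open A" "m \<in> A" "\<And>m'. m' \<in> A \<Longrightarrow> \<mu> m' = \<nu> m'"
    and "has_Lie_jet d m \<nu>"
  shows "has_Lie_jet d m \<mu>"
proof -
  have "act d (pair_E \<mu> t) m = act d (pair_E \<nu> t) m" if t: "t \<in> Gamma_D E" for t
    by (rule derivation_local[OF act_derivation Gamma_J_pair[OF mem(1) t] Gamma_J_pair[OF mem(2) t] A(1,2)])
      (simp add: pair_E_def A(3))
  moreover have "pair_E \<mu> s m = pair_E \<nu> s m" for s by (simp add: pair_E_def A)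
  ultimately show ?thesis using assms(6) unfolding has_Lie_jet_def by simp
qed

lemma has_Lie_jet_sum:
  assumes "\<And>i. i \<in> I \<Longrightarrow> \<mu> i \<in> Gamma_J E" "\<And>i. i \<in> I \<Longrightarrow> has_Lie_jet d m (\<mu> i)"
  shows "has_Lie_jet d m (\<Sum>i\<in>I. \<mu> i)"
proof -
  have "diff_0 E 0 = 0" using diff_0_lincomb[OF Gamma_0 Gamma_0, of 0 0] by (intro ext) simp
  then have 0: "has_Lie_jet d m 0" using has_Lie_jet_diff_0[OF Gamma_0] by simp
  show ?thesis using assms
  proof (induction I rule: infinite_finite_induct)
    case (insert x F)
    have "(\<Sum>i\<in>F. \<mu> i) \<in> Gamma_J E" using insert.prems by (intro subspace_sum[OF Gamma_J_subspace]) simp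
    then have "has_Lie_jet d m (\<mu> x + (\<Sum>i\<in>F. \<mu> i))" using insert by (intro has_Lie_jet_add) simp_all
    then show ?case unfolding sum.insert[OF insert.hyps(1,2)] .
  qed (simp_all add: 0)
qed

end

text \<open>
  Where \<open>\<mu>\<close> is the jet of \<open>w\<^sub>0 = \<Sum>\<^sub>a u\<^sub>a e\<^sub>a\<close>, one has
  \<open>\<mu> = \<Sum>\<^sub>a u\<^sub>a de\<^sub>a + \<Sum>\<^bsub>a,i\<^esub> \<partial>\<^sub>i u\<^sub>a (d(x\<^sub>i e\<^sub>a) - x\<^sub>i de\<^sub>a)\<close>: at this point both sides are the jet of the same first-order
  Taylor polynomial.  The section \<open>w\<^sub>0\<close> depends on the point, but \<open>u\<^sub>a\<close> and \<open>\<partial>\<^sub>i u\<^sub>a\<close> are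
  the components of the pairings of \<open>\<mu>\<close> with the identity and with the operator \<open>\<partial>\<^sub>i\<close>, and thus smooth
  functions of the point.
\<close>

lemma Gamma_J_local_generators:
  assumes \<mu>: "\<mu> \<in> Gamma_J E"
  obtains A g w and I :: "(nat \<times> nat) set" where "open A" "m \<in> A" "\<forall>i\<in>I. g i \<in> C_infinity E"
    "\<forall>i\<in>I. w i \<in> Gamma E" "\<forall>m'\<in>A. \<mu> m' = (\<Sum>i\<in>I. fmult (g i) (diff_0 E (w i))) m'"
proof -
  obtain W e where fr: "(W, e) \<in> frames E" and mW: "m \<in> W" using frame_exists by blast
  obtain U \<phi> where c: "(U, \<phi>) \<in> charts E" and mU: "m \<in> U" using chart_exists by blast
  note W = frame_open[OF fr]
  define W0 where "W0 = U \<inter> W"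
  have W0: "open W0" "m \<in> W0" "W0 \<subseteq> W" "W0 \<subseteq> U"
    using W chart_open[OF c] mW mU by (auto simp: W0_def)
  obtain \<beta> A C where b: "smooth_fun E UNIV \<beta>" and A: "open A" "m \<in> A" "A \<subseteq> W0" "\<forall>m'\<in>A. \<beta> m' = 1"
    and C: "open C" "C \<union> W0 = UNIV" "\<forall>m'\<in>C. \<beta> m' = 0"
    by (rule bump[OF W0(1,2)]) (rule that)
  have b: "\<beta> \<in> C_infinity E" using b by (simp add: C_infinity_iff)
  define e' where "e' a = fmult \<beta> (e a)" for a
  have e': "e' a \<in> Gamma E" if "a < rk" for a
    unfolding e'_def by (rule Gamma_fmult_frame[OF fr b W0(1,3) C that])
  define x where "x i m' = \<beta> m' * \<phi> m' i" for i m'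
  have x: "x i \<in> C_infinity E" for i
    unfolding x_def
    by (rule C_infinity_cutoff[OF b C W0(1) smooth_fun_chart[OF c W0(1,4)
          C_k_on_coord[OF chart_openin[OF c]] chart_openin[OF c]]]) (use W0(4) in auto)
  define T where "T = (\<lambda>m u. if u \<in> Gamma E then u m else (0::'v))"
  have T: "T \<in> Gamma_D E" unfolding T_def by (rule identity_Gamma_D)
  define D where "D i = (\<lambda>m u. if u \<in> Gamma E then \<Sum>a<rk. (\<beta> m * chart_partial U \<phi> i (frame_comp E e u a) m) *\<^sub>R e a m else 0)" for i
  have D: "D i \<in> Gamma_D E" if "i < n" for i
    unfolding D_def by (rule chart_derivation_Gamma_D[OF fr c that b C(1) C(2)[unfolded W0_def] C(3)])
  define q where "q a m' = \<beta> m' * frame_comp E e (pair_E \<mu> T) a m'" for a m'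
  define p where "p i a m' = \<beta> m' * frame_comp E e (pair_E \<mu> (D i)) a m'" for i a m'
  have q: "q a \<in> C_infinity E" if "a < rk" for a
    unfolding q_def
    by (rule C_infinity_cutoff[OF b C W0(1) smooth_fun_subset[OF Gamma_smooth[OF Gamma_J_pair[OF \<mu> T] fr that] W0(3)]])
  have p: "p i a \<in> C_infinity E" if "a < rk" "i < n" for i a
    unfolding p_def
    by (rule C_infinity_cutoff[OF b C W0(1) smooth_fun_subset[OF Gamma_smooth[OF Gamma_J_pair[OF \<mu> D[OF that(2)]] fr that(1)] W0(3)]])
  define I where "I = {..<rk} \<times> {..<Suc n}"
  \<comment> \<open>the index n, one beyond the coordinates, stands for the coefficient of the jet of a frame section\<close>
  define g where "g = (\<lambda>(a, i). if i < n then p i a else q a - (\<Sum>i<n. p i a * x i))"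
  define w where "w = (\<lambda>(a, i). if i < n then fmult (x i) (e' a) else e' a)"
  have g: "g k \<in> C_infinity E" if "k \<in> I" for k
    using that unfolding g_def I_def
    by (auto intro!: p q subspace_diff[OF C_infinity_subspace] subspace_sum[OF C_infinity_subspace] C_infinity_mult x)
  have w: "w k \<in> Gamma E" if "k \<in> I" for k
    using that unfolding w_def I_def by (auto intro!: e' Gamma_fmult x)
  have sum_I: "(\<Sum>k\<in>I. h k) = (\<Sum>a<rk. (\<Sum>i<n. h (a, i)) + h (a, n))" for h :: "nat \<times> nat \<Rightarrow> 'z::comm_monoid_add"
    unfolding I_def sum.cartesian_product[symmetric, of "\<lambda>a i. h (a, i)", simplified] by simp
  have "\<mu> m' = (\<Sum>k\<in>I. fmult (g k) (diff_0 E (w k))) m'" if m': "m' \<in> A" for m'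
  proof (rule ext)
    fix \<delta>
    have m'W: "m' \<in> W" "m' \<in> U" and bm': "\<beta> m' = 1" using A m' W0 by auto
    obtain w0 where w0: "w0 \<in> Gamma E" "\<mu> m' = diff_0 E w0 m'" using fib_JE[OF Gamma_J_fib[OF \<mu>]] .
    show "\<mu> m' \<delta> = (\<Sum>k\<in>I. fmult (g k) (diff_0 E (w k))) m' \<delta>"
    proof (cases "\<delta> \<in> fib_D E m'")
      case False
      then show ?thesis unfolding w0(2) by (simp add: sum_fun_apply fmult_def diff_0_def)
    next
      case True
      have "pair_E \<mu> T m' = w0 m'"
        using fib_DI[OF T, of m'] w0 by (simp add: pair_E_def diff_0_apply) (simp add: T_def)
      then have q': "q a m' = frame_comp E e w0 a m'" for a
        unfolding q_def bm' using frame_comp_at_cong[of "pair_E \<mu> T" m' w0 e a] by simp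
      have p': "p i a m' = chart_partial U \<phi> i (frame_comp E e w0 a) m'" if a: "a < rk" and i: "i < n" for i a
      proof -
        have "pair_E \<mu> (D i) m' = (\<Sum>a<rk. chart_partial U \<phi> i (frame_comp E e w0 a) m' *\<^sub>R e a m')"
          using fib_DI[OF D[OF i], of m'] w0 bm' by (simp add: pair_E_def diff_0_apply) (simp add: D_def)
        from frame_comp_eqI[where u = "pair_E \<mu> (D i)" and c = "\<lambda>a. chart_partial U \<phi> i (frame_comp E e w0 a) m'", OF fr m'W(1) this a]
        show ?thesis unfolding p_def bm' by simp
      qed
      define v where "v = (\<Sum>k\<in>I. g k m' *\<^sub>R w k)"
      have v: "v \<in> Gamma E"
        unfolding v_def by (intro subspace_sum[OF Gamma_subspace] subspace_scale[OF Gamma_subspace] w)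
      define k where "k b y = g (b, n) m' + (\<Sum>i<n. p i b m' * y i)" for b and y :: "nat \<Rightarrow> real"
      have v_eq: "v m'' = (\<Sum>b<rk. k b (\<phi> m'') *\<^sub>R e b m'')" if "m'' \<in> A" for m''
      proof -
        have "\<beta> m'' = 1" using that A by auto
        then have "x i m'' = \<phi> m'' i" "e' a m'' = e a m''" for i a by (simp_all add: x_def e'_def fmult_def)
        then show ?thesis
          by (simp add: v_def sum_fun_apply sum_I w_def k_def fmult_def scaleR_add_left scaleR_sum_left add.commute)
            (simp add: g_def)
      qed
      have comp: "frame_comp E e v b m'' = k b (\<phi> m'')" if "m'' \<in> A" "b < rk" for b m''
        using frame_comp_eqI[where c = "\<lambda>b. k b (\<phi> m'')" and m = m'' and u = v, OF fr _ v_eq[OF that(1)] that(2)] that A W0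
        by blast
      have k: "k b (\<phi> m') = frame_comp E e w0 b m'" for b
        using bm' by (simp add: k_def g_def sum_fun_apply x_def q')
      have "\<delta> v = \<delta> w0"
      proof (rule jet_eqI[OF True fr c _ v w0(1)])
        show "m' \<in> W \<inter> U" using m'W by simp
        show "v m' = w0 m'"
          using v_eq[OF m'] frame_expand[OF fr m'W(1), of w0] Gamma_fib[OF w0(1)] by (simp add: k)
        fix b j assume bj: "b < rk" "j < n"
        have "chart_partial U \<phi> j (frame_comp E e v b) m' = partial_deriv j (k b) (\<phi> m')"
          unfolding chart_partial_def
          by (rule partial_deriv_cong[OF chart_image_openin[OF c A(1)] _ bj(2)])
            (use chart_inv[OF c] comp bj m' m'W in auto)
        also have "\<dots> = p j b m'"
        proof (rule partial_derivI)
          have "((\<lambda>t. p i b m' * ((\<phi> m')(j := t)) i) has_real_derivative (if i = j then p j b m' else 0)) (at (\<phi> m' j))" for i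
            by (cases "i = j") (auto intro!: derivative_eq_intros)
          then have "((\<lambda>t. g (b, n) m' + (\<Sum>i<n. p i b m' * ((\<phi> m')(j := t)) i)) has_real_derivative
            0 + (\<Sum>i<n. if i = j then p j b m' else 0)) (at (\<phi> m' j))"
            by (intro DERIV_add DERIV_const DERIV_sum)
          then show "((\<lambda>t. k b ((\<phi> m')(j := t))) has_real_derivative p j b m') (at (\<phi> m' j))"
            unfolding k_def using bj by simp
        qed
        finally show "chart_partial U \<phi> j (frame_comp E e v b) m' = chart_partial U \<phi> j (frame_comp E e w0 b) m'"
          using p'[OF bj] by simp
      qed
      moreover have "\<delta> v = (\<Sum>k\<in>I. g k m' *\<^sub>R \<delta> (w k))"
      proof -
        obtain t where t: "t \<in> Gamma_D E" "\<delta> = t m'" using True by (rule fib_DE)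
        have t': "act t \<in> gauge_derivations E" using t(1) by (simp add: Gamma_D_iff)
        have "act t v = (\<Sum>k\<in>I. act t (g k m' *\<^sub>R w k))"
          unfolding v_def by (intro derivation_sum[OF t'] subspace_scale[OF Gamma_subspace] w)
        also have "\<dots> = (\<Sum>k\<in>I. g k m' *\<^sub>R act t (w k))"
          by (intro sum.cong refl derivation_scaleR[OF t'] w)
        finally have "act t v m' = (\<Sum>k\<in>I. g k m' *\<^sub>R act t (w k)) m'" by (rule fun_cong)
        then show ?thesis using t(2) by (simp add: sum_fun_apply)
      qed
      ultimately show ?thesis
        unfolding w0(2) using True by (simp add: sum_fun_apply fmult_def diff_0_apply)
    qed
  qed
  then have "\<forall>m'\<in>A. \<mu> m' = (\<Sum>k\<in>I. fmult (g k) (diff_0 E (w k))) m'" by (rule ballI)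
  moreover have "\<forall>i\<in>I. g i \<in> C_infinity E" "\<forall>i\<in>I. w i \<in> Gamma E" using g w by simp_all
  ultimately show thesis by (intro that[OF A(1,2)])
qed

text \<open>
  The property is local, additive and stable under multiplication by functions, and it holds for
  \<open>du\<close>; locally every jet section is generated from these.
\<close>

lemma has_Lie_jet_Gamma_J:
  assumes d: "d \<in> Gamma_D E" and \<mu>: "\<mu> \<in> Gamma_J E"
  shows "has_Lie_jet d m \<mu>"
proof -
  obtain A g w and I :: "(nat \<times> nat) set" where A: "open A" "m \<in> A" and g: "\<forall>i\<in>I. g i \<in> C_infinity E"
    and w: "\<forall>i\<in>I. w i \<in> Gamma E" and eq: "\<forall>m'\<in>A. \<mu> m' = (\<Sum>i\<in>I. fmult (g i) (diff_0 E (w i))) m'"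
    by (rule Gamma_J_local_generators[OF \<mu>, of m]) (rule that)
  have mem: "fmult (g i) (diff_0 E (w i)) \<in> Gamma_J E" if "i \<in> I" for i
    using that by (intro Gamma_J_fmult diff_0_Gamma_J bspec[OF g] bspec[OF w])
  show ?thesis
  proof (rule has_Lie_jet_cong[OF d \<mu> _ A])
    show "(\<Sum>i\<in>I. fmult (g i) (diff_0 E (w i))) \<in> Gamma_J E"
      by (rule subspace_sum[OF Gamma_J_subspace mem])
    show "has_Lie_jet d m (\<Sum>i\<in>I. fmult (g i) (diff_0 E (w i)))"
      by (intro has_Lie_jet_sum[OF d] mem has_Lie_jet_fmult[OF d] bspec[OF g] bspec[OF w] diff_0_Gamma_J has_Lie_jet_diff_0[OF d])
  qed (use eq in blast)
qed

text \<open>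
  The definite description in \<open>J_section\<close> is resolved by exhibiting a section.
\<close>

lemma J_section_eqI:
  assumes "\<mu> \<in> Gamma_J E" "\<And>d. d \<in> Gamma_D E \<Longrightarrow> pair_E \<mu> d = F d"
  shows "J_section E F = \<mu>"
  unfolding J_section_def
proof (rule the_equality)
  show "\<mu> \<in> Gamma_J E \<and> (\<forall>d\<in>Gamma_D E. pair_E \<mu> d = F d)" using assms by simp
  show "\<nu> = \<mu>" if "\<nu> \<in> Gamma_J E \<and> (\<forall>d\<in>Gamma_D E. pair_E \<nu> d = F d)" for \<nu>
    using that assms by (intro Gamma_J_eqI) auto
qed

lemma
  assumes d: "d \<in> Gamma_D E" and \<mu>: "\<mu> \<in> Gamma_J E"
  shows Lie_derivative_Gamma_J: "Lie_derivative E d \<mu> \<in> Gamma_J E"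
    and pair_Lie_derivative: "t \<in> Gamma_D E \<Longrightarrow>
      pair_E (Lie_derivative E d \<mu>) t = act d (pair_E \<mu> t) - pair_E \<mu> (bracket_D d t)"
proof -
  let ?F = "\<lambda>t. act d (pair_E \<mu> t) - pair_E \<mu> (bracket_D d t)"
  have "\<forall>m. \<exists>u. u \<in> Gamma E \<and> (\<forall>t\<in>Gamma_D E. ?F t m = act t u m)"
    using has_Lie_jet_Gamma_J[OF d \<mu>] unfolding has_Lie_jet_def by (auto simp: Bex_def)
  then obtain U where U: "\<And>m. U m \<in> Gamma E" "\<And>m t. t \<in> Gamma_D E \<Longrightarrow> ?F t m = act t (U m) m"
    by metis
  define \<nu> where "\<nu> m = diff_0 E (U m) m" for m
  have pair: "pair_E \<nu> t = ?F t" if t: "t \<in> Gamma_D E" for t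
    by (rule ext) (simp only: U(2)[OF t], simp add: pair_E_def \<nu>_def diff_0_apply fib_DI[OF t])
  have d': "act d \<in> gauge_derivations E" using d by (simp add: Gamma_D_iff)
  have \<nu>: "\<nu> \<in> Gamma_J E"
  proof (rule Gamma_JI)
    show "\<nu> m \<in> fib_J E m" for m unfolding \<nu>_def by (rule diff_0_fib_J[OF U(1)])
    show "pair_E \<nu> t \<in> Gamma E" if t: "t \<in> Gamma_D E" for t
      unfolding pair[OF t]
      by (intro subspace_diff[OF Gamma_subspace] derivation_Gamma[OF d'] Gamma_J_pair[OF \<mu>] t bracket_D_Gamma_D[OF d t])
  qed
  have eq: "Lie_derivative E d \<mu> = \<nu>"
    unfolding Lie_derivative_def by (rule J_section_eqI[OF \<nu> pair])
  show "Lie_derivative E d \<mu> \<in> Gamma_J E" unfolding eq by (rule \<nu>)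
  show "pair_E (Lie_derivative E d \<mu>) t = ?F t" if "t \<in> Gamma_D E" unfolding eq by (rule pair[OF that])
qed

end

section \<open>Torsion in an abstract gauge calculus\<close>

text \<open>
  Additivity is all the linearity that the computation with brackets uses.  It is stated with
  differences because they yield zero and negatives as well.
\<close>

definition additive_on :: "'a::real_vector set \<Rightarrow> ('a \<Rightarrow> 'b::real_vector) \<Rightarrow> bool"
  where "additive_on A f \<longleftrightarrow> (\<forall>x\<in>A. \<forall>y\<in>A. f (x - y) = f x - f y)"

lemma additive_on_rules:
  assumes "subspace A" "additive_on A f"
  shows "x \<in> A \<Longrightarrow> y \<in> A \<Longrightarrow> f (x - y) = f x - f y"
    and "f 0 = 0"
    and "x \<in> A \<Longrightarrow> f (- x) = - f x"
    and "x \<in> A \<Longrightarrow> y \<in> A \<Longrightarrow> f (x + y) = f x + f y"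
proof -
  note z = subspace_0[OF assms(1)]
  show d: "f (x - y) = f x - f y" if "x \<in> A" "y \<in> A" for x y
    using assms that by (auto simp: additive_on_def)
  show 0: "f 0 = 0" using d[OF z z] by simp
  show n: "f (- x) = - f x" if "x \<in> A" for x using d[OF z that] 0 by simp
  show "f (x + y) = f x + f y" if "x \<in> A" "y \<in> A"
    using d[OF that(1) subspace_neg[OF assms(1) that(2)]] n[OF that(2)] by simp
qed

text \<open>
  The sets \<open>G\<close>, \<open>D\<close> and \<open>J\<close> stand for the sections of \<open>E\<close>, of the gauge Lie algebroid and of the jet
  bundle; \<open>br\<close>, \<open>ac\<close>, \<open>pr\<close>, \<open>L\<close> and \<open>df\<close> for the commutator, the action on \<open>\<Gamma>(E)\<close>, the pairing, the
  Lie derivative and \<open>d\<close>.  The pairing is nondegenerate on both sides, so equations are proved by pairing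
  them with all sections of the other bundle.
\<close>

locale gauge_calculus =
  fixes G :: "'g::real_vector set" and D :: "'d::real_vector set" and J :: "'j::real_vector set"
    and br :: "'d \<Rightarrow> 'd \<Rightarrow> 'd" and ac :: "'d \<Rightarrow> 'g \<Rightarrow> 'g" and pr :: "'j \<Rightarrow> 'd \<Rightarrow> 'g"
    and L :: "'d \<Rightarrow> 'j \<Rightarrow> 'j" and df :: "'g \<Rightarrow> 'j"
  assumes G: "subspace G" and D: "subspace D" and J: "subspace J"
    and br_mem: "d \<in> D \<Longrightarrow> t \<in> D \<Longrightarrow> br d t \<in> D"
    and br_skew: "br d t = - br t d"
    and br_additive: "d \<in> D \<Longrightarrow> additive_on D (br d)"
    and ac_mem: "d \<in> D \<Longrightarrow> u \<in> G \<Longrightarrow> ac d u \<in> G"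
    and ac_additive: "d \<in> D \<Longrightarrow> additive_on G (ac d)" "additive_on D (\<lambda>d. ac d u)"
    and pr_mem: "\<mu> \<in> J \<Longrightarrow> d \<in> D \<Longrightarrow> pr \<mu> d \<in> G"
    and pr_additive: "\<mu> \<in> J \<Longrightarrow> additive_on D (pr \<mu>)" "additive_on J (\<lambda>\<mu>. pr \<mu> d)"
    and J_eqI: "\<mu> \<in> J \<Longrightarrow> \<nu> \<in> J \<Longrightarrow> (\<And>d. d \<in> D \<Longrightarrow> pr \<mu> d = pr \<nu> d) \<Longrightarrow> \<mu> = \<nu>"
    and D_eqI: "d \<in> D \<Longrightarrow> t \<in> D \<Longrightarrow> (\<And>\<mu>. \<mu> \<in> J \<Longrightarrow> pr \<mu> d = pr \<mu> t) \<Longrightarrow> d = t"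
    and df_mem: "u \<in> G \<Longrightarrow> df u \<in> J"
    and pr_df: "u \<in> G \<Longrightarrow> d \<in> D \<Longrightarrow> pr (df u) d = ac d u"
    and L_mem: "d \<in> D \<Longrightarrow> \<mu> \<in> J \<Longrightarrow> L d \<mu> \<in> J"
    and pr_L: "d \<in> D \<Longrightarrow> \<mu> \<in> J \<Longrightarrow> t \<in> D \<Longrightarrow> pr (L d \<mu>) t = ac d (pr \<mu> t) - pr \<mu> (br d t)"
begin

lemma br_additive': "t \<in> D \<Longrightarrow> additive_on D (\<lambda>d. br d t)"
  unfolding additive_on_def using additive_on_rules(1)[OF D br_additive] by (metis br_skew minus_diff_eq minus_diff_minus)

lemma J_eq_iff: "\<mu> \<in> J \<Longrightarrow> \<nu> \<in> J \<Longrightarrow> \<mu> = \<nu> \<longleftrightarrow> (\<forall>d\<in>D. pr \<mu> d = pr \<nu> d)"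
  using J_eqI by blast

lemma df_additive: "additive_on G df"
  unfolding additive_on_def
  by (auto intro!: J_eqI df_mem subspace_diff[OF G] subspace_diff[OF J]
      simp: additive_on_rules[OF J pr_additive(2)] additive_on_rules[OF G ac_additive(1)] pr_df df_mem subspace_diff[OF G])

lemmas mems = subspace_0[OF G] subspace_0[OF D] subspace_0[OF J]
  subspace_add[OF G] subspace_add[OF D] subspace_add[OF J] subspace_diff[OF G] subspace_diff[OF D] subspace_diff[OF J]
  subspace_neg[OF G] subspace_neg[OF D] subspace_neg[OF J] br_mem ac_mem pr_mem df_mem L_mem

lemmas adds = additive_on_rules[OF D br_additive] additive_on_rules[OF D br_additive']
  additive_on_rules[OF G ac_additive(1)] additive_on_rules[OF D ac_additive(2)]
  additive_on_rules[OF D pr_additive(1)] additive_on_rules[OF J pr_additive(2)]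
  additive_on_rules[OF G df_additive]

lemma L_additive: "\<mu> \<in> J \<Longrightarrow> additive_on D (\<lambda>d. L d \<mu>)" "d \<in> D \<Longrightarrow> additive_on J (L d)"
  unfolding additive_on_def
  by (auto intro!: J_eqI simp: mems adds pr_L algebra_simps)

lemmas L_adds = additive_on_rules[OF D L_additive(1)] additive_on_rules[OF J L_additive(2)]

definition omni :: "('d \<times> 'j) set" where "omni = D \<times> J"

text \<open>
  Twice the pairing of the omni-Lie algebroid, which avoids the factor \<open>1/2\<close>.
\<close>

definition pairing :: "'d \<times> 'j \<Rightarrow> 'd \<times> 'j \<Rightarrow> 'g"
  where "pairing a b = pr (snd a) (fst b) + pr (snd b) (fst a)"

definition bracket :: "'d \<times> 'j \<Rightarrow> 'd \<times> 'j \<Rightarrow> 'd \<times> 'j"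
  where "bracket a b = (br (fst a) (fst b), L (fst a) (snd b) - L (fst b) (snd a) + df (pr (snd a) (fst b)))"

lemma omni: "subspace omni" unfolding omni_def by (rule subspace_Times[OF D J])

lemma pairing_commute: "pairing a b = pairing b a" by (simp add: pairing_def add.commute)

lemma pairing_mem: "a \<in> omni \<Longrightarrow> b \<in> omni \<Longrightarrow> pairing a b \<in> G"
  by (auto simp: omni_def pairing_def mems)

lemma pairing_additive: "a \<in> omni \<Longrightarrow> additive_on omni (pairing a)"
  by (auto simp: additive_on_def omni_def pairing_def adds)

lemma pairing_additive': "a \<in> omni \<Longrightarrow> additive_on omni (\<lambda>b. pairing b a)"
  using pairing_additive[of a] by (simp add: pairing_commute[of _ a])

lemma bracket_mem: "a \<in> omni \<Longrightarrow> b \<in> omni \<Longrightarrow> bracket a b \<in> omni"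
  by (auto simp: omni_def bracket_def mems)

lemma bracket_additive: "a \<in> omni \<Longrightarrow> additive_on omni (bracket a)" "a \<in> omni \<Longrightarrow> additive_on omni (\<lambda>b. bracket b a)"
  by (auto simp: additive_on_def omni_def bracket_def adds mems L_adds)

lemma pairing_nondegenerate:
  assumes "a \<in> omni" "\<And>b. b \<in> omni \<Longrightarrow> pairing a b = 0"
  shows "a = 0"
proof -
  obtain d \<mu> where a: "a = (d, \<mu>)" "d \<in> D" "\<mu> \<in> J" using assms(1) by (auto simp: omni_def)
  have "pr \<mu> t = 0" if "t \<in> D" for t
    using assms(2)[of "(t, 0)"] that a by (simp add: omni_def pairing_def adds mems)
  moreover have "pr \<nu> d = 0" if "\<nu> \<in> J" for \<nu>
    using assms(2)[of "(0, \<nu>)"] that a by (simp add: omni_def pairing_def adds mems)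
  ultimately have "\<mu> = 0" "d = 0"
    using J_eqI[of \<mu> 0] D_eqI[of d 0] a by (auto simp: mems adds)
  then show ?thesis by (simp add: a zero_prod_def)
qed

text \<open>
  Written out, the left-hand side consists of six terms \<open>pr \<mu> (br d t)\<close>, which cancel in pairs, and of
  derivatives of pairings, of which only those along \<open>fst a\<close> survive.
\<close>

lemma bracket_invariant:
  assumes "a \<in> omni" "b \<in> omni" "c \<in> omni"
  shows "pairing (bracket a b) c + pairing b (bracket a c) = ac (fst a) (pairing b c)"
proof -
  obtain d \<mu> where a: "a = (d, \<mu>)" "d \<in> D" "\<mu> \<in> J" using assms by (auto simp: omni_def)
  obtain t \<nu> where b: "b = (t, \<nu>)" "t \<in> D" "\<nu> \<in> J" using assms by (auto simp: omni_def)
  obtain k \<kappa> where c: "c = (k, \<kappa>)" "k \<in> D" "\<kappa> \<in> J" using assms by (auto simp: omni_def)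
  have "br k t = - br t k" by (rule br_skew)
  with a b c show ?thesis
    by (simp add: pairing_def bracket_def mems adds pr_L pr_df)
qed

lemma bracket_symmetric_part:
  assumes "a \<in> omni" "b \<in> omni"
  shows "bracket a b + bracket b a = (0, df (pairing a b))"
proof -
  have "br (fst a) (fst b) = - br (fst b) (fst a)" by (rule br_skew)
  then show ?thesis
    using assms by (auto simp: omni_def bracket_def pairing_def adds mems)
qed

definition coboundary :: "('d \<Rightarrow> 'd \<Rightarrow> 'g) \<Rightarrow> 'd \<Rightarrow> 'd \<Rightarrow> 'd \<Rightarrow> 'g"
  where "coboundary s d t k = ac d (s t k) - ac t (s d k) + ac k (s d t)
       - s (br d t) k + s (br d k) t - s (br t k) d"

end

text \<open>
  The operators \<open>N\<close>, \<open>Ns\<close>, \<open>P\<close> and \<open>S\<close> stand for \<open>N\<close>, \<open>N\<^sup>\<star>\<close>, \<open>\<pi>\<^sup>\<sharp>\<close> and \<open>\<sigma>\<^sub>\<natural>\<close>.  The antisymmetry of \<open>\<pi>\<close> and \<open>\<sigma>\<close>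
  appears as \<open>pr_P\<close> and \<open>pr_S\<close>.
\<close>

locale almost_complex_calculus = gauge_calculus G D J br ac pr L df
  for G :: "'g::real_vector set" and D :: "'d::real_vector set" and J :: "'j::real_vector set"
    and br ac pr L df +
  fixes N :: "'d \<Rightarrow> 'd" and Ns :: "'j \<Rightarrow> 'j" and P :: "'j \<Rightarrow> 'd" and S :: "'d \<Rightarrow> 'j"
  assumes N_mem: "d \<in> D \<Longrightarrow> N d \<in> D" and N_additive: "additive_on D N"
    and Ns_mem: "\<mu> \<in> J \<Longrightarrow> Ns \<mu> \<in> J" and Ns_additive: "additive_on J Ns"
    and P_mem: "\<mu> \<in> J \<Longrightarrow> P \<mu> \<in> D" and P_additive: "additive_on J P"
    and S_mem: "d \<in> D \<Longrightarrow> S d \<in> J" and S_additive: "additive_on D S"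
    and pr_Ns: "\<mu> \<in> J \<Longrightarrow> d \<in> D \<Longrightarrow> pr (Ns \<mu>) d = pr \<mu> (N d)"
    and pr_P: "\<mu> \<in> J \<Longrightarrow> \<nu> \<in> J \<Longrightarrow> pr \<nu> (P \<mu>) = - pr \<mu> (P \<nu>)"
    and pr_S: "d \<in> D \<Longrightarrow> t \<in> D \<Longrightarrow> pr (S d) t = - pr (S t) d"
    and P_S: "d \<in> D \<Longrightarrow> P (S d) + N (N d) = - d"
    and S_N: "d \<in> D \<Longrightarrow> S (N d) = Ns (S d)"
begin

lemmas op_mems = N_mem Ns_mem P_mem S_mem

lemmas op_adds = additive_on_rules[OF D N_additive] additive_on_rules[OF J Ns_additive]
  additive_on_rules[OF J P_additive] additive_on_rules[OF D S_additive]

text \<open>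
  The generalized almost complex structure, acting on pairs of sections.
\<close>

definition matrix :: "'d \<times> 'j \<Rightarrow> 'd \<times> 'j"
  where "matrix a = (N (fst a) + P (snd a), S (fst a) - Ns (snd a))"

lemma matrix_mem: "a \<in> omni \<Longrightarrow> matrix a \<in> omni"
  by (auto simp: omni_def matrix_def mems op_mems)

lemma matrix_additive: "additive_on omni matrix"
  by (auto simp: additive_on_def omni_def matrix_def adds mems op_adds)

text \<open>
  Each of the three blocks contributes one cancellation: \<open>N\<close> is adjoint to \<open>N\<^sup>\<star>\<close>, which enters with the
  opposite sign, and \<open>\<pi>\<close>, \<open>\<sigma>\<close> are antisymmetric.
\<close>

lemma matrix_skew: "a \<in> omni \<Longrightarrow> b \<in> omni \<Longrightarrow> pairing (matrix a) b = - pairing a (matrix b)"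
proof -
  assume "a \<in> omni" "b \<in> omni"
  then obtain d \<mu> t \<nu> where ab: "a = (d, \<mu>)" "d \<in> D" "\<mu> \<in> J" "b = (t, \<nu>)" "t \<in> D" "\<nu> \<in> J"
    by (auto simp: omni_def)
  then show ?thesis
    using pr_P[of \<mu> \<nu>] pr_S[of d t]
    by (simp add: matrix_def pairing_def adds mems op_mems pr_Ns)
qed

definition torsion :: "'d \<times> 'j \<Rightarrow> 'd \<times> 'j \<Rightarrow> 'd \<times> 'j"
  where "torsion a b = bracket (matrix a) (matrix b) - bracket a b - matrix (bracket (matrix a) b + bracket a (matrix b))"

lemmas omni_mems = subspace_0[OF omni] subspace_add[OF omni] subspace_diff[OF omni] subspace_neg[OF omni]
   bracket_mem matrix_mem

lemmas omni_adds = additive_on_rules[OF omni pairing_additive] additive_on_rules[OF omni pairing_additive']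
  additive_on_rules[OF omni bracket_additive(1)] additive_on_rules[OF omni bracket_additive(2)]
  additive_on_rules[OF omni matrix_additive]

lemma torsion_mem: "a \<in> omni \<Longrightarrow> b \<in> omni \<Longrightarrow> torsion a b \<in> omni"
  by (simp add: torsion_def omni_mems)

lemma torsion_additive: "a \<in> omni \<Longrightarrow> additive_on omni (torsion a)" "a \<in> omni \<Longrightarrow> additive_on omni (\<lambda>b. torsion b a)"
  by (auto simp: additive_on_def torsion_def omni_adds omni_mems algebra_simps)

lemma torsion_forms: "torsion (0, \<mu>) (0, \<nu>) = (br (P \<mu>) (P \<nu>) - P (L (P \<mu>) \<nu> - L (P \<nu>) \<mu> - df (pr \<nu> (P \<mu>))),
    Ns (L (P \<mu>) \<nu> - L (P \<nu>) \<mu> - df (pr \<nu> (P \<mu>))) - (L (P \<mu>) (Ns \<nu>) - L (P \<nu>) (Ns \<mu>) - df (pr \<nu> (P (Ns \<mu>)))))"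
  if "\<mu> \<in> J" "\<nu> \<in> J"
  using that pr_P[of \<nu> \<mu>] pr_P[of "Ns \<mu>" \<nu>]
  by (simp add: torsion_def bracket_def matrix_def mems adds op_mems op_adds L_adds )

text \<open>
  The formula \<open>i\<^bsub>d\<and>t\<^esub> d\<sigma> = L\<^sub>d \<sigma>(t) - L\<^sub>t \<sigma>(d) + d(\<sigma>(d, t)) - \<sigma>[d, t]\<close>.  It exhibits \<open>i\<^bsub>d\<and>t\<^esub> d\<sigma>\<close> as a section of the jet bundle.
\<close>

lemma coboundary_S:
  assumes "d \<in> D" "t \<in> D" "k \<in> D"
  shows "coboundary (\<lambda>x y. pr (S x) y) d t k = pr (L d (S t) - L t (S d) + df (pr (S d) t) - S (br d t)) k"
  using assms pr_S[of "br d k" t] pr_S[of "br t k" d]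
  by (simp add: coboundary_def mems adds op_mems pr_L pr_df)

lemma coboundary_SN:
  assumes "d \<in> D" "t \<in> D" "k \<in> D"
  shows "coboundary (\<lambda>x y. pr (S (N x)) y) d t k = pr (L d (S (N t)) - L t (S (N d)) + df (pr (S (N d)) t) - S (N (br d t))) k"
proof -
  have *: "pr (S (N x)) y = - pr (S (N y)) x" if "x \<in> D" "y \<in> D" for x y
    using that by (metis N_mem S_N S_mem pr_Ns pr_S)
  show ?thesis
  using assms *[of "br d k" t] *[of "br t k" d]
  by (simp add: coboundary_def mems adds op_mems pr_L pr_df)
qed

text \<open>
  The first component uses \<open>\<pi>\<^sup>\<sharp> \<sigma> = - id - N\<^sup>2\<close> on \<open>[d, t]\<close>, which cancels the term \<open>[d, t]\<close> and completes
  the Nijenhuis tensor of \<open>N\<close>.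
\<close>

lemma torsion_gauge:
  assumes d: "d \<in> D" and t: "t \<in> D"
  shows "fst (torsion (d, 0) (t, 0)) = br (N d) (N t) - N (br (N d) t + br d (N t) - N (br d t))
      - P (L d (S t) - L t (S d) + df (pr (S d) t) - S (br d t))"
    and "snd (torsion (d, 0) (t, 0)) =
      (L (N d) (S t) - L (N t) (S d) + df (pr (S d) (N t)) - S (br (N d) t) - S (br d (N t))
      + Ns (L d (S t) - L t (S d) + df (pr (S d) t) - S (br d t)) + Ns (S (br d t)))"
proof -
  have "P (S (br d t)) = - br d t - N (N (br d t))"
    using P_S[of "br d t"] d t by (simp add: algebra_simps mems)
  then show "fst (torsion (d, 0) (t, 0)) = br (N d) (N t) - N (br (N d) t + br d (N t) - N (br d t))
      - P (L d (S t) - L t (S d) + df (pr (S d) t) - S (br d t))"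
    using d t by (simp add: torsion_def bracket_def matrix_def mems adds op_mems op_adds L_adds)
  show "snd (torsion (d, 0) (t, 0)) =
      (L (N d) (S t) - L (N t) (S d) + df (pr (S d) (N t)) - S (br (N d) t) - S (br d (N t))
      + Ns (L d (S t) - L t (S d) + df (pr (S d) t) - S (br d t)) + Ns (S (br d t)))"
    using d t by (simp add: torsion_def bracket_def matrix_def mems adds op_mems op_adds L_adds)
qed

text \<open>
  Summing the formulas for \<open>i\<^bsub>Nd\<and>t\<^esub> d\<sigma>\<close>, \<open>i\<^bsub>d\<and>Nt\<^esub> d\<sigma>\<close> and \<open>N\<^sup>\<star>(i\<^bsub>d\<and>t\<^esub> d\<sigma>)\<close> and subtracting the one for
  \<open>i\<^bsub>d\<and>t\<^esub> d\<sigma>\<^sub>N\<close>, the terms containing \<open>\<sigma> N\<close> cancel, except for \<open>\<sigma>(N[d, t]) = N\<^sup>\<star>(\<sigma>[d, t])\<close>.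
\<close>

lemma snd_torsion_gauge_coboundary:
  assumes d: "d \<in> D" and t: "t \<in> D" and k: "k \<in> D"
  shows "pr (snd (torsion (d, 0) (t, 0))) k =
    coboundary (\<lambda>x y. pr (S x) y) (N d) t k + coboundary (\<lambda>x y. pr (S x) y) d (N t) k + coboundary (\<lambda>x y. pr (S x) y) d t (N k)
     - coboundary (\<lambda>x y. pr (S (N x)) y) d t k"
  using d t k unfolding torsion_gauge(2)[OF d t]
  by (simp add: coboundary_S coboundary_SN mems adds op_mems op_adds L_adds pr_Ns S_N[of "br d t"])

context
  assumes matrix_orthogonal: "\<And>a b. a \<in> omni \<Longrightarrow> b \<in> omni \<Longrightarrow> pairing (matrix a) (matrix b) = pairing a b"
begin

text \<open>
  In \<open>T(a, b) + T(b, a)\<close> only the symmetric parts of the brackets are left.  These are differentials of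
  \<open>(\<J>a, \<J>b) - (a, b)\<close> and \<open>(\<J>a, b) + (a, \<J>b)\<close>, and both are zero.
\<close>

lemma torsion_skew:
  assumes "a \<in> omni" "b \<in> omni"
  shows "torsion b a = - torsion a b"
proof -
  have "torsion a b + torsion b a = (bracket (matrix a) (matrix b) + bracket (matrix b) (matrix a)) - (bracket a b + bracket b a)
     - matrix ((bracket (matrix a) b + bracket b (matrix a)) + (bracket a (matrix b) + bracket (matrix b) a))"
    using assms by (simp add: torsion_def omni_mems omni_adds)
  also have "\<dots> = - matrix (0, df (pairing (matrix a) b + pairing a (matrix b)))"
    using assms by (simp add: bracket_symmetric_part omni_mems matrix_orthogonal adds pairing_mem)
  also have "\<dots> = 0"
    using assms by (simp add: matrix_skew adds) (simp add: matrix_def op_adds zero_prod_def)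
  finally show ?thesis by (simp add: eq_neg_iff_add_eq_0 add.commute)
qed

text \<open>
  Move every \<open>\<J>\<close> in front of a bracket to the other side of the pairing, which costs a sign.  Then the
  summands of \<open>(T(a, b), c) + (T(a, c), b)\<close> group into left-hand sides of the invariance rule, and the resulting derivatives
  along \<open>a\<close> and \<open>\<J>a\<close> are those of \<open>(\<J>b, \<J>c) - (b, c)\<close> and \<open>(\<J>b, c) + (b, \<J>c)\<close>, which vanish.
\<close>

lemma torsion_skew':
  assumes "a \<in> omni" "b \<in> omni" "c \<in> omni"
  shows "pairing (torsion a b) c = - pairing (torsion a c) b"
proof -
  have sk: "pairing (matrix x) y = - pairing x (matrix y)" if "x \<in> omni" "y \<in> omni" for x y using matrix_skew that .
  have torsion: "pairing (torsion a b) c = pairing (bracket (matrix a) (matrix b)) c - pairing (bracket a b) c + pairing (bracket (matrix a) b) (matrix c) + pairing (bracket a (matrix b)) (matrix c)"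
    if "b \<in> omni" "c \<in> omni" for b c
    using assms(1) that by (simp add: torsion_def omni_mems omni_adds sk)
  have 1: "pairing (bracket x y) z = ac (fst x) (pairing y z) - pairing (bracket x z) y" if "x \<in> omni" "y \<in> omni" "z \<in> omni" for x y z
    using bracket_invariant[OF that] pairing_commute[of y] by (simp add: algebra_simps)
  have "pairing (torsion a b) c + pairing (torsion a c) b =
     ac (fst (matrix a)) (pairing (matrix b) c) + ac (fst (matrix a)) (pairing b (matrix c)) + ac (fst a) (pairing (matrix b) (matrix c)) - ac (fst a) (pairing b c)"
    using assms by (simp add: torsion omni_mems 1[of a b c] 1[of a "matrix b" "matrix c"] 1[of "matrix a" "matrix b" c] 1[of "matrix a" b "matrix c"])
  also have "\<dots> = 0"
  proof -
    have "fst (matrix a) \<in> D" using matrix_mem[OF assms(1)] by (auto simp: omni_def)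
    then show ?thesis using assms
      by (simp add: matrix_orthogonal sk[OF _ assms(3)] additive_on_rules[OF G ac_additive(1)] pairing_mem omni_mems)
  qed
  finally show ?thesis by (simp add: eq_neg_iff_add_eq_0)
qed

text \<open>
  The mixed torsion \<open>T(d, \<mu>)\<close> pairs with \<open>t\<close> to \<open>-(T(d, t), \<mu>)\<close>, and with \<open>\<nu>\<close> to
  \<open>(T(\<mu>, \<nu>), d)\<close>.  Both are zero if the torsion vanishes on each summand.
\<close>

theorem integrable_iff:
  "(\<forall>a\<in>omni. \<forall>b\<in>omni. torsion a b = 0) \<longleftrightarrow>
    (\<forall>\<mu>\<in>J. \<forall>\<nu>\<in>J. torsion (0, \<mu>) (0, \<nu>) = 0) \<and> (\<forall>d\<in>D. \<forall>t\<in>D. torsion (d, 0) (t, 0) = 0)" (is "?l \<longleftrightarrow> ?r")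
proof
  assume ?l
  then show ?r by (auto simp: omni_def mems)
next
  assume r: ?r
  have m: "(d, 0) \<in> omni" "(0, \<mu>) \<in> omni" if "d \<in> D" "\<mu> \<in> J" for d \<mu>
    using that by (auto simp: omni_def mems)
  have mixed: "torsion (d, 0) (0, \<mu>) = 0" if d: "d \<in> D" and \<mu>: "\<mu> \<in> J" for d \<mu>
  proof (rule pairing_nondegenerate)
    show "torsion (d, 0) (0, \<mu>) \<in> omni" using torsion_mem m d \<mu> by blast
    fix b assume "b \<in> omni"
    then obtain t \<nu> where b: "b = (t, \<nu>)" "t \<in> D" "\<nu> \<in> J" by (auto simp: omni_def)
    have mm: "(d, 0) \<in> omni" "(t, 0) \<in> omni" "(0, \<mu>) \<in> omni" "(0, \<nu>) \<in> omni" using d \<mu> b m by auto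
    have "b = (t, 0) + (0, \<nu>)" using b by simp
    then have "pairing (torsion (d, 0) (0, \<mu>)) b = pairing (torsion (d, 0) (0, \<mu>)) (t, 0) + pairing (torsion (d, 0) (0, \<mu>)) (0, \<nu>)"
      using mm torsion_mem additive_on_rules(4)[OF omni pairing_additive] by metis
    moreover have "pairing (torsion (d, 0) (0, \<mu>)) (t, 0) = 0"
      using torsion_skew'[OF mm(1,3,2)] r d b by (simp add: pairing_def adds mems \<mu>)
    moreover have "pairing (torsion (d, 0) (0, \<mu>)) (0, \<nu>) = 0"
    proof -
      have "torsion (d, 0) (0, \<mu>) = - torsion (0, \<mu>) (d, 0)" using torsion_skew mm by blast
      then have "pairing (torsion (d, 0) (0, \<mu>)) (0, \<nu>) = - pairing (torsion (0, \<mu>) (d, 0)) (0, \<nu>)"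
        using omni_adds torsion_mem mm by simp
      also have "\<dots> = pairing (torsion (0, \<mu>) (0, \<nu>)) (d, 0)" using torsion_skew'[OF mm(3,1,4)] by simp
      also have "\<dots> = 0" using r \<mu> b by (simp add: pairing_def adds mems d)
      finally show ?thesis .
    qed
    ultimately show "pairing (torsion (d, 0) (0, \<mu>)) b = 0" by simp
  qed
  show ?l
  proof (intro ballI)
    fix a b assume "a \<in> omni" "b \<in> omni"
    then obtain d \<mu> t \<nu> where ab: "a = (d, 0) + (0, \<mu>)" "b = (t, 0) + (0, \<nu>)" and
      mem: "d \<in> D" "\<mu> \<in> J" "t \<in> D" "\<nu> \<in> J" by (auto simp: omni_def)
    have mm: "(d, 0) \<in> omni" "(t, 0) \<in> omni" "(0, \<mu>) \<in> omni" "(0, \<nu>) \<in> omni" using mem m by auto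
    then have s: "(t, 0) + (0, \<nu>) \<in> omni" using omni subspace_add by blast
    have "torsion a b = torsion (d, 0) ((t, 0) + (0, \<nu>)) + torsion (0, \<mu>) ((t, 0) + (0, \<nu>))"
      unfolding ab using additive_on_rules(4)[OF omni torsion_additive(2)[OF s] mm(1,3)] .
    also have "torsion (d, 0) ((t, 0) + (0, \<nu>)) = torsion (d, 0) (t, 0) + torsion (d, 0) (0, \<nu>)"
      using additive_on_rules(4)[OF omni torsion_additive(1)[OF mm(1)] mm(2,4)] .
    also have "torsion (0, \<mu>) ((t, 0) + (0, \<nu>)) = torsion (0, \<mu>) (t, 0) + torsion (0, \<mu>) (0, \<nu>)"
      using additive_on_rules(4)[OF omni torsion_additive(1)[OF mm(3)] mm(2,4)] .
    also have "torsion (0, \<mu>) (t, 0) = - torsion (t, 0) (0, \<mu>)" using torsion_skew mm by blast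
    finally show "torsion a b = 0" using mixed r mem by simp
  qed
qed

end

end

section \<open>Generalized complex structures on the omni-Lie algebroid\<close>

lemma (in smooth_vector_bundle) gauge_calculus:
  "gauge_calculus (Gamma E) (Gamma_D E) (Gamma_J E) bracket_D act pair_E (Lie_derivative E) (diff_0 E)"
proof
  note gd = Gamma_D_iff[THEN iffD1]
  show "subspace (Gamma E)" "subspace (Gamma_D E)" "subspace (Gamma_J E)"
    by (rule Gamma_subspace Gamma_D_subspace Gamma_J_subspace)+
  show "bracket_D d t \<in> Gamma_D E" if "d \<in> Gamma_D E" "t \<in> Gamma_D E" for d t
    using bracket_D_Gamma_D that .
  show "bracket_D d t = - bracket_D t d" for d t :: "'m \<Rightarrow> ('m, 'v) dfib"
    by (intro ext) (simp add: bracket_D_def)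
  show "additive_on (Gamma_D E) (bracket_D d)" if d: "d \<in> Gamma_D E" for d
    unfolding additive_on_def
  proof (intro ballI ext)
    fix x y m u assume x: "x \<in> Gamma_D E" and y: "y \<in> Gamma_D E"
    have mem: "act z u \<in> Gamma E" if z: "z \<in> Gamma_D E" for z
      using derivation_Gamma[OF gd[OF z]] derivation_outside[OF gd[OF z]] Gamma_0 by (cases "u \<in> Gamma E") auto
    have "act (x - y) u = act x u - act y u" by (rule ext) simp
    then have "act d (act (x - y) u) = act d (act x u) - act d (act y u)"
      using derivation_diff[OF gd[OF d] mem[OF x] mem[OF y]] by simp
    then have "act d (act (x - y) u) m = act d (act x u) m - act d (act y u) m" by simp
    then show "bracket_D d (x - y) m u = (bracket_D d x - bracket_D d y) m u"
      by (simp add: bracket_D_def)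
  qed
  show "act d u \<in> Gamma E" if "d \<in> Gamma_D E" "u \<in> Gamma E" for d u
    using derivation_Gamma[OF gd] that by blast
  show "additive_on (Gamma E) (act d)" if d: "d \<in> Gamma_D E" for d
    unfolding additive_on_def by (intro ballI derivation_diff[OF gd[OF d]])
  show "additive_on (Gamma_D E) (\<lambda>d. act d u)" for u
    unfolding additive_on_def by (intro ballI ext) simp
  show "pair_E \<mu> d \<in> Gamma E" if "\<mu> \<in> Gamma_J E" "d \<in> Gamma_D E" for \<mu> d
    using Gamma_J_pair that .
  show "additive_on (Gamma_D E) (pair_E \<mu>)" if \<mu>: "\<mu> \<in> Gamma_J E" for \<mu>
    unfolding additive_on_def
  proof (intro ballI ext)
    fix x y m assume "x \<in> Gamma_D E" "y \<in> Gamma_D E"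
    from fib_J_linear[OF Gamma_J_fib[OF \<mu>] fib_DI[OF this(1)] fib_DI[OF this(2)], of m 1 "-1"]
    show "pair_E \<mu> (x - y) m = (pair_E \<mu> x - pair_E \<mu> y) m" by (simp add: pair_E_def)
  qed
  show "additive_on (Gamma_J E) (\<lambda>\<mu>. pair_E \<mu> d)" for d
    unfolding additive_on_def by (intro ballI ext) (simp add: pair_E_def)
  show "\<mu> = \<nu>" if "\<mu> \<in> Gamma_J E" "\<nu> \<in> Gamma_J E" "\<And>d. d \<in> Gamma_D E \<Longrightarrow> pair_E \<mu> d = pair_E \<nu> d" for \<mu> \<nu>
    using Gamma_J_eqI that .
  show "d = t" if "d \<in> Gamma_D E" "t \<in> Gamma_D E" "\<And>\<mu>. \<mu> \<in> Gamma_J E \<Longrightarrow> pair_E \<mu> d = pair_E \<mu> t" for d t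
    using Gamma_D_eqI that .
  show "diff_0 E u \<in> Gamma_J E" if "u \<in> Gamma E" for u using diff_0_Gamma_J that .
  show "pair_E (diff_0 E u) d = act d u" if "u \<in> Gamma E" "d \<in> Gamma_D E" for u d
    using pair_diff_0[OF that(2)] .
  show "Lie_derivative E d \<mu> \<in> Gamma_J E" if "d \<in> Gamma_D E" "\<mu> \<in> Gamma_J E" for d \<mu>
    using Lie_derivative_Gamma_J that .
  show "pair_E (Lie_derivative E d \<mu>) t = act d (pair_E \<mu> t) - pair_E \<mu> (bracket_D d t)"
    if "d \<in> Gamma_D E" "\<mu> \<in> Gamma_J E" "t \<in> Gamma_D E" for d \<mu> t
    using pair_Lie_derivative that .
qed

lemma linear_map_on_diff:
  "linear_map_on V f \<Longrightarrow> x \<in> V \<Longrightarrow> y \<in> V \<Longrightarrow> f (x - y) = f x - f y"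
proof -
  assume "linear_map_on V f" "x \<in> V" "y \<in> V"
  then have "f (1 *\<^sub>R x + (-1) *\<^sub>R y) = 1 *\<^sub>R f x + (-1) *\<^sub>R f y"
    unfolding linear_map_on_def by blast
  then show "f (x - y) = f x - f y" by simp
qed

lemma two_form_skew:
  "two_form A \<Gamma>A B \<Gamma>B F \<Longrightarrow> x \<in> A m \<Longrightarrow> y \<in> A m \<Longrightarrow> F m y x = - F m x y"
proof -
  assume F: "two_form A \<Gamma>A B \<Gamma>B F" and x: "x \<in> A m" and y: "y \<in> A m"
  have "\<forall>m. \<forall>x\<in>A m. linear_map_on (A m) (F m x) \<and> (\<forall>y\<in>A m. F m x y \<in> B m \<and> F m y x = - F m x y)"
    using F unfolding two_form_def by (elim conjE)
  from bspec[OF conjunct2[OF bspec[OF spec[OF this] x]] y] show "F m y x = - F m x y" by (rule conjunct2)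
qed

lemma two_form_additive:
  assumes F: "two_form A \<Gamma>A B \<Gamma>B F" and A: "subspace (A m)" and "x \<in> A m" "y \<in> A m" "z \<in> A m"
  shows "F m x (y - z) = F m x y - F m x z" "F m (x - y) z = F m x z - F m y z"
proof -
  note skew = two_form_skew[OF F]
  have "\<forall>m. \<forall>x\<in>A m. linear_map_on (A m) (F m x) \<and> (\<forall>y\<in>A m. F m x y \<in> B m \<and> F m y x = - F m x y)"
    using F unfolding two_form_def by (elim conjE)
  from conjunct1[OF bspec[OF spec[OF this]]] have lin: "linear_map_on (A m) (F m w)" if "w \<in> A m" for w
    using that .
  show "F m x (y - z) = F m x y - F m x z"
    by (rule linear_map_on_diff[OF lin]) fact+
  have "F m (x - y) z = - F m z (x - y)"
    by (rule skew) (use assms subspace_diff[OF A] in simp_all)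
  also have "\<dots> = F m x z - F m y z"
    unfolding linear_map_on_diff[OF lin[OF assms(5)] assms(3,4)]
      skew[OF assms(5,3)] skew[OF assms(5,4)] by simp
  finally show "F m (x - y) z = F m x z - F m y z" .
qed

lemma Gamma_olI: "d \<in> Gamma_D E \<Longrightarrow> \<mu> \<in> Gamma_J E \<Longrightarrow> (\<lambda>m. (d m, \<mu> m)) \<in> Gamma_ol E"
  unfolding Gamma_ol_def by (intro CollectI exI[of _ d] exI[of _ \<mu>] conjI) simp_all

lemma Gamma_olE:
  assumes "e \<in> Gamma_ol E"
  obtains d \<mu> where "d \<in> Gamma_D E" "e = (\<lambda>m. (d m, \<mu> m))" "\<mu> \<in> Gamma_J E"
proof -
  from assms obtain d \<mu> where "e = (\<lambda>m. (d m, \<mu> m)) \<and> d \<in> Gamma_D E \<and> \<mu> \<in> Gamma_J E"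
    unfolding Gamma_ol_def by (elim CollectE exE)
  then show thesis by (elim conjE) (rule that)
qed

locale omni_almost_complex = smooth_vector_bundle E
  for E :: "('m::{t2_space, second_countable_topology}, 'v::real_vector) vbundle" +
  fixes N :: "'m \<Rightarrow> ('m, 'v) dfib \<Rightarrow> ('m, 'v) dfib"
    and \<pi> :: "'m \<Rightarrow> ('m, 'v) jfib \<Rightarrow> ('m, 'v) jfib \<Rightarrow> 'v"
    and \<sigma> :: "'m \<Rightarrow> ('m, 'v) dfib \<Rightarrow> ('m, 'v) dfib \<Rightarrow> 'v"
  assumes N_bundle_map: "bundle_map (fib_D E) (Gamma_D E) (fib_D E) (Gamma_D E) N"
    and star_fib_J: "\<And>m \<mu>. \<mu> \<in> fib_J E m \<Longrightarrow> star E N m \<mu> \<in> fib_J E m"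
    and \<pi>_form: "two_form_J E \<pi>"
    and \<sigma>_form: "two_form_D E \<sigma>"
    and sharp_flat: "\<And>m \<delta>. \<delta> \<in> fib_D E m \<Longrightarrow> sharp E \<pi> m (flat E \<sigma> m \<delta>) + N m (N m \<delta>) = - \<delta>"
    and flat_N: "\<And>m \<delta>. \<delta> \<in> fib_D E m \<Longrightarrow> flat E \<sigma> m (N m \<delta>) = star E N m (flat E \<sigma> m \<delta>)"
    and almost_complex: "generalized_almost_complex E (matrix_J E N \<pi> \<sigma>)"
begin

lemma N_linear: "linear_map_on (fib_D E m) (N m)"
  and N_Gamma: "d \<in> Gamma_D E \<Longrightarrow> ap N d \<in> Gamma_D E"
  using N_bundle_map unfolding bundle_map_def ap_def
  by (elim conjE, simp add: image_subset_iff)+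

lemma \<pi>_two_form: "two_form (fib_J E) (Gamma_J E) (fib E) (Gamma E) \<pi>"
  and sharp_fib_D: "\<mu> \<in> fib_J E m \<Longrightarrow> sharp E \<pi> m \<mu> \<in> fib_D E m"
  using \<pi>_form unfolding two_form_J_def by (elim conjE, simp)+

lemma \<sigma>_two_form: "two_form (fib_D E) (Gamma_D E) (fib E) (Gamma E) \<sigma>"
  and flat_fib_J: "\<delta> \<in> fib_D E m \<Longrightarrow> flat E \<sigma> m \<delta> \<in> fib_J E m"
  using \<sigma>_form unfolding two_form_D_def by (elim conjE, simp)+

lemma matrix_Gamma_ol: "e \<in> Gamma_ol E \<Longrightarrow> ap (matrix_J E N \<pi> \<sigma>) e \<in> Gamma_ol E"
  using almost_complex unfolding generalized_almost_complex_def bundle_map_def ap_def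
  by (elim conjE) simp

lemma fib_J_sharp:
  assumes \<mu>: "\<mu> \<in> fib_J E m" and \<nu>: "\<nu> \<in> fib_J E m"
  shows "\<nu> (sharp E \<pi> m \<mu>) = \<pi> m \<mu> \<nu>"
proof -
  obtain u where u: "u \<in> Gamma E" "\<nu> = diff_0 E u m" using \<nu> by (rule fib_JE)
  then show ?thesis using sharp_fib_D[OF \<mu>] by (simp add: diff_0_apply) (simp add: sharp_def)
qed

lemma pair_star: "d \<in> Gamma_D E \<Longrightarrow> pair_E (ap (star E N) \<mu>) d = pair_E \<mu> (ap N d)"
  by (rule ext) (simp add: pair_E_def ap_def star_def fib_DI)

lemma pair_sharp: "\<mu> \<in> Gamma_J E \<Longrightarrow> \<nu> \<in> Gamma_J E \<Longrightarrow> pair_E \<nu> (ap (sharp E \<pi>) \<mu>) = (\<lambda>m. \<pi> m (\<mu> m) (\<nu> m))"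
  by (rule ext) (simp add: pair_E_def ap_def fib_J_sharp Gamma_J_fib)

lemma pair_flat: "t \<in> Gamma_D E \<Longrightarrow> pair_E (ap (flat E \<sigma>) d) t = (\<lambda>m. \<sigma> m (d m) (t m))"
  by (rule ext) (simp add: pair_E_def ap_def flat_def fib_DI)

text \<open>
  The matrix maps \<open>(0, \<mu>)\<close> to \<open>(\<pi>\<^sup>\<sharp>\<mu>, - N\<^sup>\<star>\<mu>)\<close>.  As a bundle map it preserves smooth sections, so its
  first component is a smooth section of the gauge Lie algebroid.
\<close>

lemma sharp_Gamma_D:
  assumes \<mu>: "\<mu> \<in> Gamma_J E" shows "ap (sharp E \<pi>) \<mu> \<in> Gamma_D E"
proof -
  have "(\<lambda>m. ((0 :: 'm \<Rightarrow> ('m, 'v) dfib) m, \<mu> m)) \<in> Gamma_ol E"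
    by (rule Gamma_olI[OF subspace_0[OF Gamma_D_subspace] \<mu>])
  from matrix_Gamma_ol[OF this] obtain d \<nu> where d: "d \<in> Gamma_D E"
    and eq: "ap (matrix_J E N \<pi> \<sigma>) (\<lambda>m. ((0 :: 'm \<Rightarrow> ('m, 'v) dfib) m, \<mu> m)) = (\<lambda>m. (d m, \<nu> m))"
    by (rule Gamma_olE)
  have "d m = ap (sharp E \<pi>) \<mu> m" for m
  proof -
    have "N m 0 = 0" using linear_map_on_diff[OF N_linear[of m], of 0 0] subspace_0[OF fib_D_subspace] by simp
    then show ?thesis using fun_cong[OF eq, of m] by (simp add: ap_def matrix_J_def)
  qed
  then have "d = ap (sharp E \<pi>) \<mu>" by (rule ext)
  then show ?thesis using d by simp
qed

lemma almost_complex_calculus: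
  "almost_complex_calculus (Gamma E) (Gamma_D E) (Gamma_J E) bracket_D act pair_E (Lie_derivative E) (diff_0 E)
    (ap N) (ap (star E N)) (ap (sharp E \<pi>)) (ap (flat E \<sigma>))"
proof (rule almost_complex_calculus.intro[OF gauge_calculus], unfold_locales)
  show "ap N d \<in> Gamma_D E" if "d \<in> Gamma_D E" for d using N_Gamma that .
  show "additive_on (Gamma_D E) (ap N)"
    unfolding additive_on_def by (intro ballI ext) (simp add: ap_def linear_map_on_diff[OF N_linear] fib_DI)
  show "ap (star E N) \<mu> \<in> Gamma_J E" if "\<mu> \<in> Gamma_J E" for \<mu>
    by (rule Gamma_JI) (use that in \<open>simp_all add: pair_star Gamma_J_pair N_Gamma\<close>, simp add: ap_def star_fib_J Gamma_J_fib)
  show "additive_on (Gamma_J E) (ap (star E N))"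
    unfolding additive_on_def by (intro ballI ext) (simp add: ap_def star_def)
  show "ap (sharp E \<pi>) \<mu> \<in> Gamma_D E" if "\<mu> \<in> Gamma_J E" for \<mu> using sharp_Gamma_D that .
  show "additive_on (Gamma_J E) (ap (sharp E \<pi>))"
    unfolding additive_on_def
    by (intro ballI ext) (simp add: ap_def sharp_def two_form_additive(2)[OF \<pi>_two_form fib_J_subspace] Gamma_J_fib diff_0_fib_J)
  show "ap (flat E \<sigma>) d \<in> Gamma_J E" if d: "d \<in> Gamma_D E" for d
  proof (rule Gamma_JI)
    show "ap (flat E \<sigma>) d m \<in> fib_J E m" for m using d by (simp add: ap_def flat_fib_J fib_DI)
    show "pair_E (ap (flat E \<sigma>) d) t \<in> Gamma E" if "t \<in> Gamma_D E" for t
      using \<sigma>_two_form d that unfolding pair_flat[OF that] two_form_def by blast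
  qed
  show "additive_on (Gamma_D E) (ap (flat E \<sigma>))"
    unfolding additive_on_def
    by (intro ballI ext) (simp add: ap_def flat_def two_form_additive(2)[OF \<sigma>_two_form fib_D_subspace] fib_DI)
  show "pair_E (ap (star E N) \<mu>) d = pair_E \<mu> (ap N d)" if "\<mu> \<in> Gamma_J E" "d \<in> Gamma_D E" for \<mu> d
    using pair_star[OF that(2)] .
  show "pair_E \<nu> (ap (sharp E \<pi>) \<mu>) = - pair_E \<mu> (ap (sharp E \<pi>) \<nu>)"
    if "\<mu> \<in> Gamma_J E" "\<nu> \<in> Gamma_J E" for \<mu> \<nu>
  proof
    fix m
    show "pair_E \<nu> (ap (sharp E \<pi>) \<mu>) m = (- pair_E \<mu> (ap (sharp E \<pi>) \<nu>)) m"
      using two_form_skew[OF \<pi>_two_form Gamma_J_fib[OF that(2)] Gamma_J_fib[OF that(1)]] by (simp add: pair_sharp that)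
  qed
  show "pair_E (ap (flat E \<sigma>) d) t = - pair_E (ap (flat E \<sigma>) t) d"
    if "d \<in> Gamma_D E" "t \<in> Gamma_D E" for d t
  proof
    fix m
    show "pair_E (ap (flat E \<sigma>) d) t m = (- pair_E (ap (flat E \<sigma>) t) d) m"
      using two_form_skew[OF \<sigma>_two_form fib_DI[OF that(2)] fib_DI[OF that(1)]] by (simp add: pair_flat that)
  qed
  show "ap (sharp E \<pi>) (ap (flat E \<sigma>) d) + ap N (ap N d) = - d" if "d \<in> Gamma_D E" for d
    by (rule ext) (use sharp_flat[OF fib_DI[OF that]] in \<open>simp add: ap_def\<close>)
  show "ap (flat E \<sigma>) (ap N d) = ap (star E N) (ap (flat E \<sigma>) d)" if "d \<in> Gamma_D E" for d
    by (rule ext) (use flat_N[OF fib_DI[OF that]] in \<open>simp add: ap_def\<close>)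
qed

sublocale calc: almost_complex_calculus "Gamma E" "Gamma_D E" "Gamma_J E" bracket_D act pair_E "Lie_derivative E" "diff_0 E"
    "ap N" "ap (star E N)" "ap (sharp E \<pi>)" "ap (flat E \<sigma>)"
  by (rule almost_complex_calculus)

text \<open>
  The definitions represent a section of \<open>\<DD>E \<oplus> \<JJ>E\<close> by a function into pairs, the abstract calculus by a pair of functions.
\<close>

definition join :: "('m \<Rightarrow> ('m, 'v) dfib) \<times> ('m \<Rightarrow> ('m, 'v) jfib) \<Rightarrow> 'm \<Rightarrow> ('m, 'v) olfib"
  where "join a = (\<lambda>m. (fst a m, snd a m))"

lemma Gamma_ol_eq: "Gamma_ol E = join ` calc.omni"
proof (intro set_eqI iffI)
  fix e assume "e \<in> Gamma_ol E"
  then obtain d \<mu> where "d \<in> Gamma_D E" "e = (\<lambda>m. (d m, \<mu> m))" "\<mu> \<in> Gamma_J E" by (rule Gamma_olE)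
  then show "e \<in> join ` calc.omni"
    by (intro image_eqI[of _ _ "(d, \<mu>)"]) (simp_all add: join_def calc.omni_def)
next
  fix e assume "e \<in> join ` calc.omni"
  then show "e \<in> Gamma_ol E" by (auto simp: join_def calc.omni_def intro: Gamma_olI)
qed

lemma bracket_ol_join: "bracket_ol E (join a) (join b) = join (calc.bracket a b)"
  by (simp add: bracket_ol_def join_def calc.bracket_def comp_def Let_def)

lemma matrix_J_join: "ap (matrix_J E N \<pi> \<sigma>) (join a) = join (calc.matrix a)"
  by (rule ext) (simp add: ap_def matrix_J_def join_def calc.matrix_def)

lemma join_add: "join a + join b = join (a + b)" and join_diff: "join a - join b = join (a - b)"
  by (rule ext, simp add: join_def)+

lemma join_eq_0: "join a = 0 \<longleftrightarrow> a = 0"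
  by (auto simp: join_def fun_eq_iff prod_eq_iff)

lemma pairing_eq_pair_ol: "calc.pairing a b m = 2 *\<^sub>R pair_ol (join a m) (join b m)"
  by (simp add: calc.pairing_def pair_ol_def join_def pair_E_def)

lemma matrix_orthogonal:
  assumes "a \<in> calc.omni" "b \<in> calc.omni" shows "calc.pairing (calc.matrix a) (calc.matrix b) = calc.pairing a b"
proof
  fix m
  have "join a m \<in> fib_ol E m" "join b m \<in> fib_ol E m"
    using assms by (auto simp: join_def fib_ol_def calc.omni_def fib_DI Gamma_J_fib)
  then have "pair_ol (matrix_J E N \<pi> \<sigma> m (join a m)) (matrix_J E N \<pi> \<sigma> m (join b m)) = pair_ol (join a m) (join b m)"
    using almost_complex unfolding generalized_almost_complex_def by (elim conjE) simp
  then show "calc.pairing (calc.matrix a) (calc.matrix b) m = calc.pairing a b m"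
    unfolding pairing_eq_pair_ol matrix_J_join[symmetric] by (simp add: ap_def)
qed

lemma generalized_complex_iff:
  "generalized_complex E (matrix_J E N \<pi> \<sigma>) \<longleftrightarrow> (\<forall>a\<in>calc.omni. \<forall>b\<in>calc.omni. calc.torsion a b = 0)"
  using almost_complex
  by (simp add: generalized_complex_def Gamma_ol_eq bracket_ol_join matrix_J_join join_add join_diff join_eq_0 calc.torsion_def del: right_minus_eq)

lemma diff_2_eq:
  assumes "d \<in> Gamma_D E" "t \<in> Gamma_D E" "k \<in> Gamma_D E"
  shows "diff_2 \<sigma> d t k = calc.coboundary (\<lambda>x. pair_E (ap (flat E \<sigma>) x)) d t k"
    and "diff_2 (\<lambda>m \<delta> \<epsilon>. \<sigma> m (N m \<delta>) \<epsilon>) d t k = calc.coboundary (\<lambda>x. pair_E (ap (flat E \<sigma>) (ap N x))) d t k"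
  unfolding diff_2_def calc.coboundary_def Let_def using assms
  by (simp_all add: pair_flat) (simp_all add: ap_def)

lemma J_section_diff_2:
  assumes d: "d \<in> Gamma_D E" and t: "t \<in> Gamma_D E"
  shows "J_section E (diff_2 \<sigma> d t) = Lie_derivative E d (ap (flat E \<sigma>) t) - Lie_derivative E t (ap (flat E \<sigma>) d)
    + diff_0 E (pair_E (ap (flat E \<sigma>) d) t) - ap (flat E \<sigma>) (bracket_D d t)"
  by (rule J_section_eqI) (use d t in \<open>simp_all add: calc.mems calc.op_mems diff_2_eq calc.coboundary_S\<close>)

lemma torsion_forms_zero_iff:
  assumes "\<mu> \<in> Gamma_J E" "\<nu> \<in> Gamma_J E"
  shows "calc.torsion (0, \<mu>) (0, \<nu>) = 0 \<longleftrightarrow>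
    ap (sharp E \<pi>) (bracket_\<pi> E \<pi> \<mu> \<nu>) = bracket_D (ap (sharp E \<pi>) \<mu>) (ap (sharp E \<pi>) \<nu>) \<and>
    ap (star E N) (bracket_\<pi> E \<pi> \<mu> \<nu>) =
       Lie_derivative E (ap (sharp E \<pi>) \<mu>) (ap (star E N) \<nu>)
       - Lie_derivative E (ap (sharp E \<pi>) \<nu>) (ap (star E N) \<mu>)
       - diff_0 E (\<lambda>m. \<pi> m (star E N m (\<mu> m)) (\<nu> m))"
proof -
  have "pair_E \<nu> (ap (sharp E \<pi>) (ap (star E N) \<mu>)) = (\<lambda>m. \<pi> m (star E N m (\<mu> m)) (\<nu> m))"
    using pair_sharp[OF calc.Ns_mem[OF assms(1)] assms(2)] by (simp add: ap_def)
  then show ?thesis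
    unfolding calc.torsion_forms[OF assms] bracket_\<pi>_def by (auto simp: zero_prod_def)
qed

lemma torsion_gauge_zero_iff:
  assumes d: "d \<in> Gamma_D E" and t: "t \<in> Gamma_D E"
  shows "calc.torsion (d, 0) (t, 0) = 0 \<longleftrightarrow>
    Nijenhuis N d t = ap (sharp E \<pi>) (J_section E (diff_2 \<sigma> d t)) \<and>
    (\<forall>k\<in>Gamma_D E. diff_2 \<sigma> (ap N d) t k + diff_2 \<sigma> d (ap N t) k + diff_2 \<sigma> d t (ap N k) =
       diff_2 (\<lambda>m \<delta> \<epsilon>. \<sigma> m (N m \<delta>) \<epsilon>) d t k)"
proof -
  have "fst (calc.torsion (d, 0) (t, 0)) = 0 \<longleftrightarrow> Nijenhuis N d t = ap (sharp E \<pi>) (J_section E (diff_2 \<sigma> d t))"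
    unfolding calc.torsion_gauge(1)[OF d t] J_section_diff_2[OF d t] Nijenhuis_def by (rule right_minus_eq)
  moreover have "snd (calc.torsion (d, 0) (t, 0)) = 0 \<longleftrightarrow> (\<forall>k\<in>Gamma_D E.
      diff_2 \<sigma> (ap N d) t k + diff_2 \<sigma> d (ap N t) k + diff_2 \<sigma> d t (ap N k) =
       diff_2 (\<lambda>m \<delta> \<epsilon>. \<sigma> m (N m \<delta>) \<epsilon>) d t k)"
  proof -
    have "snd (calc.torsion (d, 0) (t, 0)) \<in> Gamma_J E"
      using calc.torsion_mem[of "(d, 0)" "(t, 0)"] d t by (auto simp: calc.omni_def calc.mems)
    then have "snd (calc.torsion (d, 0) (t, 0)) = 0 \<longleftrightarrow> (\<forall>k\<in>Gamma_D E. pair_E (snd (calc.torsion (d, 0) (t, 0))) k = 0)"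
      using calc.J_eq_iff[of _ 0] calc.mems(3) by (simp add: calc.adds)
    then show ?thesis
      using d t by (simp add: calc.snd_torsion_gauge_coboundary diff_2_eq N_Gamma)
  qed
  ultimately show ?thesis by (simp add: prod_eq_iff)
qed

end

theorem theorem5p4:
  fixes E :: "('m::{t2_space, second_countable_topology}, 'v::real_vector) vbundle"
    and N :: "'m \<Rightarrow> ('m, 'v) dfib \<Rightarrow> ('m, 'v) dfib"
    and \<pi> :: "'m \<Rightarrow> ('m, 'v) jfib \<Rightarrow> ('m, 'v) jfib \<Rightarrow> 'v"
    and \<sigma> :: "'m \<Rightarrow> ('m, 'v) dfib \<Rightarrow> ('m, 'v) dfib \<Rightarrow> 'v"
  assumes "vector_bundle E"
    and "bundle_map (fib_D E) (Gamma_D E) (fib_D E) (Gamma_D E) N"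
    and "\<And>m \<mu>. \<mu> \<in> fib_J E m \<Longrightarrow> star E N m \<mu> \<in> fib_J E m"
    and "two_form_J E \<pi>"
    and "two_form_D E \<sigma>"
    and "\<And>m \<delta>. \<delta> \<in> fib_D E m \<Longrightarrow> sharp E \<pi> m (flat E \<sigma> m \<delta>) + N m (N m \<delta>) = - \<delta>"
    and "\<And>m \<mu>. \<mu> \<in> fib_J E m \<Longrightarrow> N m (sharp E \<pi> m \<mu>) = sharp E \<pi> m (star E N m \<mu>)"
    and "\<And>m \<delta>. \<delta> \<in> fib_D E m \<Longrightarrow> flat E \<sigma> m (N m \<delta>) = star E N m (flat E \<sigma> m \<delta>)"
    and "generalized_almost_complex E (matrix_J E N \<pi> \<sigma>)"
  shows "generalized_complex E (matrix_J E N \<pi> \<sigma>) \<longleftrightarrow>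
    (\<forall>\<mu>\<in>Gamma_J E. \<forall>\<nu>\<in>Gamma_J E.
       ap (sharp E \<pi>) (bracket_\<pi> E \<pi> \<mu> \<nu>) =
       bracket_D (ap (sharp E \<pi>) \<mu>) (ap (sharp E \<pi>) \<nu>)) \<and>
    (\<forall>\<mu>\<in>Gamma_J E. \<forall>\<nu>\<in>Gamma_J E.
       ap (star E N) (bracket_\<pi> E \<pi> \<mu> \<nu>) =
       Lie_derivative E (ap (sharp E \<pi>) \<mu>) (ap (star E N) \<nu>)
       - Lie_derivative E (ap (sharp E \<pi>) \<nu>) (ap (star E N) \<mu>)
       - diff_0 E (\<lambda>m. \<pi> m (star E N m (\<mu> m)) (\<nu> m))) \<and>
    (\<forall>d\<in>Gamma_D E. \<forall>t\<in>Gamma_D E.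
       Nijenhuis N d t = ap (sharp E \<pi>) (J_section E (diff_2 \<sigma> d t))) \<and>
    (\<forall>d\<in>Gamma_D E. \<forall>t\<in>Gamma_D E. \<forall>k\<in>Gamma_D E.
       diff_2 \<sigma> (ap N d) t k + diff_2 \<sigma> d (ap N t) k + diff_2 \<sigma> d t (ap N k) =
       diff_2 (\<lambda>m \<delta> \<epsilon>. \<sigma> m (N m \<delta>) \<epsilon>) d t k)"
proof -
  interpret omni_almost_complex E N \<pi> \<sigma>
    by unfold_locales (fact assms)+
  have "generalized_complex E (matrix_J E N \<pi> \<sigma>) \<longleftrightarrow>
    (\<forall>\<mu>\<in>Gamma_J E. \<forall>\<nu>\<in>Gamma_J E. calc.torsion (0, \<mu>) (0, \<nu>) = 0) \<and>
    (\<forall>d\<in>Gamma_D E. \<forall>t\<in>Gamma_D E. calc.torsion (d, 0) (t, 0) = 0)"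
    unfolding generalized_complex_iff by (rule calc.integrable_iff[OF matrix_orthogonal])
  then show ?thesis
    by (simp only: torsion_forms_zero_iff torsion_gauge_zero_iff ball_conj_distrib conj_assoc cong: ball_cong)
qed

end
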